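(* Suppose that $\lambda>0$, that either $r_0\subset\mathcal{A}_{0,I}$ or $r_0\subset\mathcal{A}_{0,III}$, and that either $r_L\subset\mathcal{A}_{m,II}$ or $r_L\subset\mathcal{A}_{m,IV}$. Assume that for every $i\in\{0,\dots,m\}$ there are $d_i,e_i\in\{c_{1,i},c_{2,i}\}$ with $d_i\neq e_i$ and integers $0\leq\alpha_i<\beta_i$ such that, for every $\kappa\in\{I,III\}$, $$\mathcal{T}_{i,\kappa+1}(d_i)+\mathcal{T}_{i,\kappa+2}(d_i)+\alpha_i\mathcal{T}_i(d_i)>\tau_i,\qquad \mathcal{T}_{i,\kappa}(e_i)+\mathcal{T}_{i,\kappa+1}(e_i)+\beta_i\mathcal{T}_i(e_i)<\tau_i.$$ Assume, in addition, that for every $i\in\{0,\dots,m-1\}$ and every $\kappa\in\{I,III\}$ there are $\hat d>0$ and $\hat e>0$, $\hat d\neq\hat e$, both $i$-admissible, such that $$\mathcal{S}^{c_{2,i\to i+1}}_{\kappa-1\to\kappa}(\hat e)\leq\varsigma_i\leq\mathcal{S}^{c_{1,i\to i+1}}_{\kappa-1\to\kappa}(\hat d).$$ Then, for each such choice of $r_0$ and $r_L$, the boundary value problem $$x'=h(y),\quad y'=-\lambda x-a(t)g(x),\quad (x(0),y(0))\in r_0,\quad (x(L),y(L))\in r_L$$ has at least $$2^m\prod_{i=0}^m(\beta_i-\alpha_i)$$ solutions. Moreover, these solutions are classified by their nodal properties as follows. Let $\kappa_0\in\{I,III\}$ and $q_L\in\{II,IV\}$ be such that $r_0\subset\mathcal{A}_{0,\kappa_0}$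 and $r_L\subset\mathcal{A}_{m,q_L}$. For every $(\kappa_1,\dots,\kappa_m)\in\{I,III\}^m$ and every $(j_0,\dots,j_m)$ with $1\leq j_i\leq\beta_i-\alpha_i$, there is at least one such solution with $(x(t_i),y(t_i))\in\mathcal{A}_{i,\kappa_i}$ for all $i\in\{0,\dots,m\}$ and: \begin{itemize} \item for $i\leq m-1$ with $\kappa_{i+1}=\kappa_i$: $x$ has exactly $2(\alpha_i+j_i)-1$ zeroes in $(t_i,s_i)$ and $y$ has exactly $2(\alpha_i+j_i)$ zeroes in $[t_i,s_i]$; \item for $i\leq m-1$ with $\kappa_{i+1}\neq\kappa_i$: $x$ has exactly $2(\alpha_i+j_i)$ zeroes in $(t_i,s_i)$ and $y$ has exactly $2(\alpha_i+j_i)+1$ zeroes in $[t_i,s_i]$; \item for $i\leq m-1$: $x$ has exactly one zero and $y$ has no zero in $[s_i,t_{i+1}]$; \item on the last interval: $x$ has exactly $2(\alpha_m+j_m)-1$ zeroes in $(t_m,s_m)$ and $y$ exactly $2(\alpha_m+j_m)$ zeroes in $[t_m,s_m]$ if $q_L=\kappa_m-1$, while $x$ has exactly $2(\alpha_m+j_m)$ zeroes in $(t_m,s_m)$ and $y$ exactly $2(\alpha_m+j_m)+1$ zeroes in $[t_m,s_m]$ if $q_L=\kappa_m+1$. \end{itemize}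
   Context: Setting. $m\geq1$, $0=t_0<s_0<t_1<\dots<s_{m-1}<t_m<s_m=L$, $\tau_i:=s_i-t_i$, $\varsigma_i:=t_{i+1}-s_i$. The weight is $a(t)=\mu_i>0$ for $t\in[t_i,s_i]$, $i\in\{0,\dots,m\}$, and $a=0$ on $(s_i,t_{i+1})$, $i\in\{0,\dots,m-1\}$. The function $h:(\varrho_-,\varrho_+)\to\mathbb{R}$, $-\infty\leq\varrho_-<0<\varrho_+\leq+\infty$, is the inverse of an increasing homeomorphism between open intervals containing $0$ (so $h$ is continuous and strictly increasing), with $h(0)=0$; $g:\mathbb{R}\to\mathbb{R}$ is continuous with $g(0)=0$ and $g(s)s>0$ for $s\neq0$. Let $(\mathcal{N}_{i,\lambda})$ be $x'=h(y)$, $y'=-\lambda x-\mu_i g(x)$ and $(\mathcal{L}_\lambda)$ be $x'=h(y)$, $y'=-\lambda x$. Uniqueness of solutions of all initial value problems for these systems is assumed; solutions are in the Carathéodory sense. Put $H(y)=\int_0^y h$, $G(x)=\int_0^x g$, $F_{i,\lambda}(x)=\frac{\lambda}{2}x^2+\mu_iG(x)$, $\mathcal{H}_i(x,y)=H(y)+F_{i,\lambda}(x)$, $\mathcal{E}(x,y)=H(y)+\frac{\lambda}{2}x^2$, $H(\varrho_\pm)=\lim_{y\to\varrho_\pm}H(y)$, $H^*=\min\{H(\varrho_-),H(\varrho_+)\}$. $H_+^{-1}$, $H_-^{-1}$ are the inverses of $H$ restricted to $[0,\varrho_+)$, $(\varrho_-,0]$, and $G_+^{-1}$, $G_-^{-1}$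 the inverses of $G$ restricted to $[0,\infty)$, $(-\infty,0]$. Annuli. For each $i$, $0<c_{1,i}<c_{2,i}<H^*$ are such that for every $c\in[c_{1,i},c_{2,i}]$ there are $x_-(c)<0<x_+(c)$ with $F_{i,\lambda}(x_\pm(c))=c$, $F_{i,\lambda}<c$ on $(x_-(c),x_+(c))$, $F_{i,\lambda}'(x_-(c))<0<F_{i,\lambda}'(x_+(c))$. The annulus $\mathcal{A}_i=\{c_{1,i}\leq\mathcal{H}_i\leq c_{2,i}\}$ is the union of the corresponding closed orbits around the origin and lies in $\mathbb{R}\times(\varrho_-,\varrho_+)$. $\mathcal{A}_{i,j}$, $j\in\{I,II,III,IV\}$, is the intersection of $\mathcal{A}_i$ with the $j$-th closed quadrant. The sets $r_0\subset\mathcal{A}_0$ and $r_L\subset\mathcal{A}_m$ are arcs, each connecting the inner with the outer boundary of the corresponding annulus. Times. $\mathcal{T}_{i,I}(c)=\int_0^{x_+(c)}\frac{dx}{(h\circ H_+^{-1})(c-F_{i,\lambda}(x))}$, $\mathcal{T}_{i,IV}(c)=\int_0^{x_+(c)}\frac{dx}{-(h\circ H_-^{-1})(c-F_{i,\lambda}(x))}$, $\mathcal{T}_{i,III}(c)=\int_{x_-(c)}^0\frac{dx}{-(h\circ H_-^{-1})(c-F_{i,\lambda}(x))}$, $\mathcal{T}_{i,II}(c)=\int_{x_-(c)}^0\frac{dx}{(h\circ H_+^{-1})(c-F_{i,\lambda}(x))}$ are the times spent in each quadrant by the orbit $\mathcal{H}_i=c$, and $\mathcal{T}_i(c)$ is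 their sum (the period). Quadrant indices are added in the cyclic clockwise order $IV\prec III\prec II\prec I\prec IV$: $I+1=IV$, $IV+1=III$, $III+1=II$, $II+1=I$ (so $I-1=II$, $III-1=IV$). Transition times for $\lambda>0$. A number $c>0$ is called $i$-admissible if $c\leq\min\{c_{1,i},c_{1,i+1}\}$ and $$\min\{G(-\sqrt{2c/\lambda}),G(\sqrt{2c/\lambda})\}>\max_{j\in\{i,i+1\}}\frac{c_{2,j}-c}{\mu_j}$$ (so that the closed orbit $\mathcal{E}=c$ of $(\mathcal{L}_\lambda)$ crosses both annuli $\mathcal{A}_i$, $\mathcal{A}_{i+1}$). For such $c$, $k\in\{1,2\}$, $j\in\{i,i+1\}$, put $x_{\ell,c_{k,j}}=G_-^{-1}((c_{k,j}-c)/\mu_j)$, $x_{r,c_{k,j}}=G_+^{-1}((c_{k,j}-c)/\mu_j)$ and $$\mathcal{S}^{c_{k,i\to i+1}}_{II\to I}(c)=\int_{x_{\ell,c_{k,i}}}^{x_{r,c_{k,i+1}}}\frac{dx}{(h\circ H_+^{-1})(c-\frac{\lambda}{2}x^2)},\qquad \mathcal{S}^{c_{k,i\to i+1}}_{IV\to III}(c)=\int_{x_{\ell,c_{k,i+1}}}^{x_{r,c_{k,i}}}\frac{dx}{-(h\circ H_-^{-1})(c-\frac{\lambda}{2}x^2)}.$$ *)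

theory Defs
  imports "HOL-Analysis.Analysis"
begin

section \<open>Planar systems and their Caratheodory solutions\<close>

definition abs_continuous_on_Icc :: "real \<Rightarrow> real \<Rightarrow> (real \<Rightarrow> real) \<Rightarrow> bool" where
  "abs_continuous_on_Icc a b f \<longleftrightarrow>
     (\<forall>\<epsilon>>0. \<exists>\<delta>>0. \<forall>(n::nat) u v.
        (\<forall>k<n. a \<le> u k \<and> u k \<le> v k \<and> v k \<le> b) \<and>
        (\<forall>k<n. \<forall>l<n. k \<noteq> l \<longrightarrow> {u k<..<v k} \<inter> {u l<..<v l} = {}) \<and>
        (\<Sum>k<n. v k - u k) < \<delta>
        \<longrightarrow> (\<Sum>k<n. \<bar>f (v k) - f (u k)\<bar>) < \<epsilon>)"

definition open_interval :: "ereal \<Rightarrow> ereal \<Rightarrow> real set" where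
  "open_interval rm rp = {y. rm < ereal y \<and> ereal y < rp}"

text \<open>The system \<open>x' = h(y)\<close>, \<open>y' = -\<lambda> x - w(t) g(x)\<close> on \<open>[a,b]\<close>, where \<open>h\<close> is defined on
  \<open>(rm,rp)\<close> only. The systems without explicit time dependence are obtained for a constant
  weight \<open>w\<close>: \<open>w = \<mu>\<^sub>i\<close> gives \<open>(\<N>\<^bsub>i,\<lambda>\<^esub>)\<close> and \<open>w = 0\<close> gives \<open>(\<L>\<^sub>\<lambda>)\<close>.\<close>

definition caratheodory_solution ::
  "(real \<Rightarrow> real) \<Rightarrow> ereal \<Rightarrow> ereal \<Rightarrow> (real \<Rightarrow> real) \<Rightarrow> real \<Rightarrow> (real \<Rightarrow> real)
   \<Rightarrow> real \<Rightarrow> real \<Rightarrow> (real \<Rightarrow> real) \<Rightarrow> (real \<Rightarrow> real) \<Rightarrow> bool" where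
  "caratheodory_solution h rm rp g lam w a b x y \<longleftrightarrow>
     abs_continuous_on_Icc a b x \<and> abs_continuous_on_Icc a b y \<and>
     (\<forall>t\<in>{a..b}. y t \<in> open_interval rm rp) \<and>
     (AE t in lebesgue. t \<in> {a..b} \<longrightarrow>
        (x has_real_derivative h (y t)) (at t within {a..b}) \<and>
        (y has_real_derivative (- lam * x t - w t * g (x t))) (at t within {a..b}))"

definition unique_ivp_solutions ::
  "(real \<Rightarrow> real) \<Rightarrow> ereal \<Rightarrow> ereal \<Rightarrow> (real \<Rightarrow> real) \<Rightarrow> real \<Rightarrow> (real \<Rightarrow> real) \<Rightarrow> bool" where
  "unique_ivp_solutions h rm rp g lam w \<longleftrightarrow>
     (\<forall>a b t0 x1 y1 x2 y2.
        t0 \<in> {a..b} \<and>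
        caratheodory_solution h rm rp g lam w a b x1 y1 \<and>
        caratheodory_solution h rm rp g lam w a b x2 y2 \<and>
        x1 t0 = x2 t0 \<and> y1 t0 = y2 t0
        \<longrightarrow> (\<forall>t\<in>{a..b}. x1 t = x2 t \<and> y1 t = y2 t))"

text \<open>Solutions are functions on \<open>[0,L]\<close>; they are represented by functions on the real line that
  are \<open>undefined\<close> off \<open>[0,L]\<close>, so that distinct elements differ somewhere on \<open>[0,L]\<close>.\<close>

definition bvp_solutions ::
  "(real \<Rightarrow> real) \<Rightarrow> ereal \<Rightarrow> ereal \<Rightarrow> (real \<Rightarrow> real) \<Rightarrow> real \<Rightarrow> (real \<Rightarrow> real) \<Rightarrow> real
   \<Rightarrow> (real \<times> real) set \<Rightarrow> (real \<times> real) set \<Rightarrow> ((real \<Rightarrow> real) \<times> (real \<Rightarrow> real)) set" where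
  "bvp_solutions h rm rp g lam a L r0 rL =
     {(x, y). x \<in> extensional {0..L} \<and> y \<in> extensional {0..L} \<and>
        caratheodory_solution h rm rp g lam a 0 L x y \<and>
        (x 0, y 0) \<in> r0 \<and> (x L, y L) \<in> rL}"


section \<open>Energies\<close>

text \<open>\<open>primitive h\<close> and \<open>primitive g\<close> are \<open>H\<close> and \<open>G\<close>; the integral is oriented.\<close>

definition primitive :: "(real \<Rightarrow> real) \<Rightarrow> real \<Rightarrow> real" where
  "primitive f x = (LBINT s=0..x. f s)"

definition F_energy :: "(real \<Rightarrow> real) \<Rightarrow> real \<Rightarrow> real \<Rightarrow> real \<Rightarrow> real" where
  "F_energy g lam mu x = lam / 2 * x\<^sup>2 + mu * primitive g x"

definition nonlinear_energy ::
  "(real \<Rightarrow> real) \<Rightarrow> (real \<Rightarrow> real) \<Rightarrow> real \<Rightarrow> real \<Rightarrow> real \<times> real \<Rightarrow> real" where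
  "nonlinear_energy h g lam mu = (\<lambda>(x, y). primitive h y + F_energy g lam mu x)"

definition H_star :: "(real \<Rightarrow> real) \<Rightarrow> ereal \<Rightarrow> ereal \<Rightarrow> ereal" where
  "H_star h rm rp =
     min (Lim (at_right rm) (\<lambda>z. ereal (primitive h (real_of_ereal z))))
         (Lim (at_left rp) (\<lambda>z. ereal (primitive h (real_of_ereal z))))"

definition H_inv_plus :: "(real \<Rightarrow> real) \<Rightarrow> ereal \<Rightarrow> real \<Rightarrow> real" where
  "H_inv_plus h rp = the_inv_into {y. 0 \<le> y \<and> ereal y < rp} (primitive h)"

definition H_inv_minus :: "(real \<Rightarrow> real) \<Rightarrow> ereal \<Rightarrow> real \<Rightarrow> real" where
  "H_inv_minus h rm = the_inv_into {y. rm < ereal y \<and> y \<le> 0} (primitive h)"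

definition G_inv_plus :: "(real \<Rightarrow> real) \<Rightarrow> real \<Rightarrow> real" where
  "G_inv_plus g = the_inv_into {0..} (primitive g)"

definition G_inv_minus :: "(real \<Rightarrow> real) \<Rightarrow> real \<Rightarrow> real" where
  "G_inv_minus g = the_inv_into {..0} (primitive g)"


section \<open>Quadrants and annuli\<close>

datatype quadrant = Q_I | Q_II | Q_III | Q_IV

fun closed_quadrant :: "quadrant \<Rightarrow> (real \<times> real) set" where
  "closed_quadrant Q_I = {(x, y). 0 \<le> x \<and> 0 \<le> y}"
| "closed_quadrant Q_II = {(x, y). x \<le> 0 \<and> 0 \<le> y}"
| "closed_quadrant Q_III = {(x, y). x \<le> 0 \<and> y \<le> 0}"
| "closed_quadrant Q_IV = {(x, y). 0 \<le> x \<and> y \<le> 0}"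

text \<open>Clockwise successor and predecessor, i.e.\ \<open>\<kappa> + 1\<close> and \<open>\<kappa> - 1\<close>.\<close>

fun q_succ :: "quadrant \<Rightarrow> quadrant" where
  "q_succ Q_I = Q_IV"
| "q_succ Q_IV = Q_III"
| "q_succ Q_III = Q_II"
| "q_succ Q_II = Q_I"

fun q_pred :: "quadrant \<Rightarrow> quadrant" where
  "q_pred Q_I = Q_II"
| "q_pred Q_II = Q_III"
| "q_pred Q_III = Q_IV"
| "q_pred Q_IV = Q_I"

text \<open>\<open>\<lambda> > 0\<close> and \<open>g(s) s > 0\<close> make every level set of the energy in \<open>\<real> \<times> (rm,rp)\<close>
  at a level below \<open>H_star\<close> a single closed orbit, so no component needs to be singled out here.\<close>

definition annulus ::
  "(real \<Rightarrow> real) \<Rightarrow> ereal \<Rightarrow> ereal \<Rightarrow> (real \<Rightarrow> real) \<Rightarrow> real \<Rightarrow> real \<Rightarrow> real \<Rightarrow> real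
   \<Rightarrow> (real \<times> real) set" where
  "annulus h rm rp g lam mu c1 c2 =
     {p. snd p \<in> open_interval rm rp \<and>
         c1 \<le> nonlinear_energy h g lam mu p \<and> nonlinear_energy h g lam mu p \<le> c2}"

definition annulus_quadrant ::
  "(real \<Rightarrow> real) \<Rightarrow> ereal \<Rightarrow> ereal \<Rightarrow> (real \<Rightarrow> real) \<Rightarrow> real \<Rightarrow> real \<Rightarrow> real \<Rightarrow> real
   \<Rightarrow> quadrant \<Rightarrow> (real \<times> real) set" where
  "annulus_quadrant h rm rp g lam mu c1 c2 q =
     annulus h rm rp g lam mu c1 c2 \<inter> closed_quadrant q"

definition crossing_arc ::
  "(real \<Rightarrow> real) \<Rightarrow> ereal \<Rightarrow> ereal \<Rightarrow> (real \<Rightarrow> real) \<Rightarrow> real \<Rightarrow> real \<Rightarrow> real \<Rightarrow> real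
   \<Rightarrow> (real \<times> real) set \<Rightarrow> bool" where
  "crossing_arc h rm rp g lam mu c1 c2 r \<longleftrightarrow>
     r \<subseteq> annulus h rm rp g lam mu c1 c2 \<and>
     (\<exists>\<gamma>. arc \<gamma> \<and> path_image \<gamma> = r \<and>
          nonlinear_energy h g lam mu (pathstart \<gamma>) = c1 \<and>
          nonlinear_energy h g lam mu (pathfinish \<gamma>) = c2)"


section \<open>Times\<close>

text \<open>Time spent in a quadrant by the orbit of energy \<open>c\<close>; \<open>xm\<close> and \<open>xp\<close> are its intersections
  with the \<open>x\<close>-axis. The integrand has an integrable singularity at \<open>xm\<close>, \<open>xp\<close>.\<close>

fun quadrant_time ::
  "(real \<Rightarrow> real) \<Rightarrow> ereal \<Rightarrow> ereal \<Rightarrow> (real \<Rightarrow> real) \<Rightarrow> real \<Rightarrow> real \<Rightarrow> real \<Rightarrow> real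
   \<Rightarrow> quadrant \<Rightarrow> real \<Rightarrow> real" where
  "quadrant_time h rm rp g lam mu xm xp Q_I c =
     (LBINT x=0..xp. 1 / h (H_inv_plus h rp (c - F_energy g lam mu x)))"
| "quadrant_time h rm rp g lam mu xm xp Q_IV c =
     (LBINT x=0..xp. 1 / (- h (H_inv_minus h rm (c - F_energy g lam mu x))))"
| "quadrant_time h rm rp g lam mu xm xp Q_III c =
     (LBINT x=xm..0. 1 / (- h (H_inv_minus h rm (c - F_energy g lam mu x))))"
| "quadrant_time h rm rp g lam mu xm xp Q_II c =
     (LBINT x=xm..0. 1 / h (H_inv_plus h rp (c - F_energy g lam mu x)))"

definition period ::
  "(real \<Rightarrow> real) \<Rightarrow> ereal \<Rightarrow> ereal \<Rightarrow> (real \<Rightarrow> real) \<Rightarrow> real \<Rightarrow> real \<Rightarrow> real \<Rightarrow> real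
   \<Rightarrow> real \<Rightarrow> real" where
  "period h rm rp g lam mu xm xp c =
     (\<Sum>q\<in>{Q_I, Q_II, Q_III, Q_IV}. quadrant_time h rm rp g lam mu xm xp q c)"

definition admissible ::
  "(real \<Rightarrow> real) \<Rightarrow> real \<Rightarrow> (nat \<Rightarrow> real) \<Rightarrow> (nat \<Rightarrow> real) \<Rightarrow> (nat \<Rightarrow> real) \<Rightarrow> nat \<Rightarrow> real \<Rightarrow> bool" where
  "admissible g lam mu c1 c2 i c \<longleftrightarrow>
     0 < c \<and> c \<le> min (c1 i) (c1 (Suc i)) \<and>
     min (primitive g (- sqrt (2 * c / lam))) (primitive g (sqrt (2 * c / lam)))
       > max ((c2 i - c) / mu i) ((c2 (Suc i) - c) / mu (Suc i))"

text \<open>Transition times along the orbit of energy \<open>c\<close> of the linear system. The argument \<open>ck\<close> is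
  \<open>c1\<close> or \<open>c2\<close>; only the transitions II to I and IV to III are meaningful.\<close>

definition transition_time ::
  "(real \<Rightarrow> real) \<Rightarrow> ereal \<Rightarrow> ereal \<Rightarrow> (real \<Rightarrow> real) \<Rightarrow> real \<Rightarrow> (nat \<Rightarrow> real) \<Rightarrow> (nat \<Rightarrow> real)
   \<Rightarrow> nat \<Rightarrow> quadrant \<Rightarrow> quadrant \<Rightarrow> real \<Rightarrow> real" where
  "transition_time h rm rp g lam mu ck i p q c =
     (let xl = (\<lambda>j. G_inv_minus g ((ck j - c) / mu j));
          xr = (\<lambda>j. G_inv_plus g ((ck j - c) / mu j))
      in case (p, q) of
           (Q_II, Q_I) \<Rightarrow>
             (LBINT x=xl i..xr (Suc i). 1 / h (H_inv_plus h rp (c - lam / 2 * x\<^sup>2)))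
         | (Q_IV, Q_III) \<Rightarrow>
             (LBINT x=xl (Suc i)..xr i. 1 / (- h (H_inv_minus h rm (c - lam / 2 * x\<^sup>2))))
         | _ \<Rightarrow> undefined)"


section \<open>Nodal properties\<close>

text \<open>Every prescribed number of zeroes below is positive, so \<open>card\<close> also asserts finiteness.\<close>

definition nodal ::
  "nat \<Rightarrow> (nat \<Rightarrow> real) \<Rightarrow> (nat \<Rightarrow> real) \<Rightarrow> (nat \<Rightarrow> nat) \<Rightarrow> quadrant \<Rightarrow> (nat \<Rightarrow> quadrant)
   \<Rightarrow> (nat \<Rightarrow> nat) \<Rightarrow> (real \<Rightarrow> real) \<Rightarrow> (real \<Rightarrow> real) \<Rightarrow> bool" where
  "nodal m t s \<alpha> qL \<kappa> j x y \<longleftrightarrow>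
     (\<forall>i<m. \<kappa> (Suc i) = \<kappa> i \<longrightarrow>
        card {u\<in>{t i<..<s i}. x u = 0} = 2 * (\<alpha> i + j i) - 1 \<and>
        card {u\<in>{t i..s i}. y u = 0} = 2 * (\<alpha> i + j i)) \<and>
     (\<forall>i<m. \<kappa> (Suc i) \<noteq> \<kappa> i \<longrightarrow>
        card {u\<in>{t i<..<s i}. x u = 0} = 2 * (\<alpha> i + j i) \<and>
        card {u\<in>{t i..s i}. y u = 0} = 2 * (\<alpha> i + j i) + 1) \<and>
     (\<forall>i<m. (\<exists>!u. u \<in> {s i..t (Suc i)} \<and> x u = 0) \<and>
        (\<forall>u\<in>{s i..t (Suc i)}. y u \<noteq> 0)) \<and>
     (qL = q_pred (\<kappa> m) \<longrightarrow>
        card {u\<in>{t m<..<s m}. x u = 0} = 2 * (\<alpha> m + j m) - 1 \<and>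
        card {u\<in>{t m..s m}. y u = 0} = 2 * (\<alpha> m + j m)) \<and>
     (qL = q_succ (\<kappa> m) \<longrightarrow>
        card {u\<in>{t m<..<s m}. x u = 0} = 2 * (\<alpha> m + j m) \<and>
        card {u\<in>{t m..s m}. y u = 0} = 2 * (\<alpha> m + j m) + 1)"

end

theory Submission
  imports Defs "HOL-Complex_Analysis.Great_Picard"
begin

text \<open>
The weight is piecewise constant, so a solution is a chain of pieces of closed orbits: of
\<open>x' = h(y)\<close>, \<open>y' = -\<lambda> x - \<mu>\<^sub>i g(x)\<close> on \<open>[t\<^sub>i, s\<^sub>i]\<close> and of \<open>x' = h(y)\<close>, \<open>y' = -\<lambda> x\<close> on
\<open>[s\<^sub>i, t\<^sub>i\<^sub>+\<^sub>1]\<close>. The proof follows a whole arc of initial points through these stages and keeps,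
at each stage, a subarc whose image has been stretched across the next target.

\<^item> Suppose that at time \<open>t\<^sub>i\<close> the points form a path in quadrant I or III that joins the two boundaries
  of the annulus \<open>\<A>\<^sub>i\<close>. The inequalities on the quadrant times say that on the boundary of energy
  \<open>d\<^sub>i\<close> the points have not yet made \<open>4\<alpha>\<^sub>i + 3\<close> axis crossings when \<open>s\<^sub>i\<close> comes, and that on the
  other boundary they have already made \<open>4\<beta>\<^sub>i + 2\<close>. The time of the \<open>N\<close>-th axis crossing depends
  continuously on the initial point (\<open>hit_continuous\<close>). Hence for every odd \<open>N\<close> between
  \<open>4\<alpha>\<^sub>i + 3\<close> and \<open>4\<beta>\<^sub>i + 1\<close> some subpath is mapped into the quadrant between the \<open>N\<close>-th and the
  next crossing, from one axis to the other (\<open>twist_crossing\<close>). The admitted values are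
  \<open>N = 4(\<alpha>\<^sub>i + j) - 1\<close> and \<open>N = 4(\<alpha>\<^sub>i + j) + 1\<close> with \<open>1 \<le> j \<le> \<beta>\<^sub>i - \<alpha>\<^sub>i\<close>; they end in quadrants II and
  IV in one order or the other, and \<open>N\<close> determines the numbers of zeroes.
\<^item> Along such an image the energy \<open>\<E>\<close> of the system with \<open>a = 0\<close> is at least \<open>c\<^sub>1\<close> at the end on the
  \<open>y\<close>-axis and below every admissible level at the end on the \<open>x\<close>-axis. So the levels of \<open>\<E>\<close>
  that appear in the transition inequalities are both attained. These inequalities put the point of
  one level on or beyond the outer boundary of the next annulus at time \<open>t\<^sub>i\<^sub>+\<^sub>1\<close>, and the point of
  the other level on or before the inner boundary; a subpath in between crosses the annulus from boundary to
  boundary inside quadrant I or III (\<open>transition_crossing\<close>), and the argument starts again.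
\<^item> At the end the image joins the two axes inside a quadrant of \<open>\<A>\<^sub>m\<close> and the arc \<open>r\<^sub>L\<close> joins the two
  boundaries there. Two such paths meet, by Fashoda's theorem in a rectangle
  (\<open>sector_paths_meet\<close>).

Every choice of the quadrants \<open>\<kappa>\<^sub>1, \<dots>, \<kappa>\<^sub>m\<close> and of the numbers \<open>j\<^sub>0, \<dots>, j\<^sub>m\<close> yields a solution, and
the signs of \<open>y\<close> at the times \<open>t\<^sub>i\<close> together with the numbers of zeroes give the choice back
(\<open>itinerary_unique\<close>), so that different choices yield different solutions.

Two devices keep the analysis short. The quarter turn \<open>(x, y) \<mapsto> (-y, x)\<close> transforms a system
\<open>x' = h(y)\<close>, \<open>y' = -f(x)\<close> with restoring \<open>h\<close> and \<open>f\<close> into one of the same kind, so that only the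
first quadrant has to be studied (\<open>planar_rot\<close>). And \<open>h\<close> and \<open>g\<close> may be replaced by bounded
functions off the energies that occur (\<open>planar_oscillator\<close>); then solutions exist globally by
Peano's theorem and depend continuously on the initial point because they are unique.
\<close>

section \<open>Flows of bounded continuous vector fields\<close>

definition ode_sol :: "('a::euclidean_space \<Rightarrow> 'a) \<Rightarrow> real \<Rightarrow> (real \<Rightarrow> 'a) \<Rightarrow> bool" where
  "ode_sol V T z \<longleftrightarrow> (\<forall>t\<in>{0..T}. (z has_vector_derivative V (z t)) (at t within {0..T}))"

lemma ode_sol_continuous: "ode_sol V T z \<Longrightarrow> continuous_on {0..T} z"
  unfolding ode_sol_def continuous_on_eq_continuous_within
  using has_vector_derivative_continuous by blast

lemma ode_sol_mono: "ode_sol V T z \<Longrightarrow> S \<le> T \<Longrightarrow> ode_sol V S z"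
  unfolding ode_sol_def
  by (meson atLeastAtMost_iff atLeastatMost_subset_iff has_vector_derivative_within_subset order_refl order_trans)

lemma ode_sol_cong:
  assumes "ode_sol V T z" "\<And>t. t \<in> {0..T} \<Longrightarrow> z t = w t"
  shows "ode_sol V T w"
  using assms unfolding ode_sol_def
  by (metis has_vector_derivative_transform)

lemma ode_sol_shift:
  assumes "ode_sol V (s + T) z" "0 \<le> s"
  shows "ode_sol V T (\<lambda>u. z (s + u))"
  unfolding ode_sol_def
proof
  fix t assume t: "t \<in> {0..T}"
  have "(z has_vector_derivative V (z (s + t))) (at (s + t) within {0..s+T})"
    using assms t unfolding ode_sol_def by auto
  then have "(z has_vector_derivative V (z (s + t))) (at (s + t) within (\<lambda>u. s + u) ` {0..T})"
    by (rule has_vector_derivative_within_subset) (use assms in auto)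
  moreover have "((\<lambda>u. s + u) has_vector_derivative 1) (at t within {0..T})"
    by (auto intro!: derivative_eq_intros)
  ultimately show "((\<lambda>u. z (s + u)) has_vector_derivative V (z (s + t))) (at t within {0..T})"
    using vector_diff_chain_within[of "\<lambda>u. s + u" 1 t "{0..T}" z "V (z (s + t))"] by (simp add: o_def)
qed

lemma ode_sol_lipschitz:
  assumes "ode_sol V T z" and V: "\<And>x. norm (V x) \<le> M" and "s \<in> {0..T}" "t \<in> {0..T}"
  shows "norm (z s - z t) \<le> M * \<bar>s - t\<bar>"
proof -
  have M: "0 \<le> M" using V[of 0] norm_ge_zero order_trans by blast
  have *: "norm (r *\<^sub>R V x) \<le> M * \<bar>r\<bar>" for r x
    using mult_right_mono[OF V[of x] abs_ge_zero[of r]] by (simp add: mult.commute)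
  have "norm (z s - z t) \<le> M * norm (s - t)"
    by (rule differentiable_bound[of "{0..T}" z "\<lambda>x r. r *\<^sub>R V (z x)"])
      (use assms M in \<open>auto simp: ode_sol_def has_vector_derivative_def
           simp del: norm_scaleR intro!: onorm_bound *\<close>)
  then show ?thesis by simp
qed

lemma ode_sol_integral:
  assumes "ode_sol V T z" "continuous_on UNIV V" "t \<in> {0..T}"
  shows "z t = z 0 + integral {0..t} (\<lambda>s. V (z s))"
proof -
  have "((\<lambda>s. V (z s)) has_integral (z t - z 0)) {0..t}"
    by (rule fundamental_theorem_of_calculus)
      (use assms ode_sol_mono[OF assms(1), of t] in \<open>auto simp: ode_sol_def\<close>)
  then show ?thesis by (simp add: integral_unique)
qed

lemma ode_sol_of_integral:
  assumes "continuous_on {0..T} z" "continuous_on UNIV V"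
    and eq: "\<And>t. t \<in> {0..T} \<Longrightarrow> z t = p + integral {0..t} (\<lambda>s. V (z s))"
  shows "ode_sol V T z"
  unfolding ode_sol_def
proof
  fix t assume t: "t \<in> {0..T}"
  have "continuous_on {0..T} (\<lambda>s. V (z s))"
    using continuous_on_compose2[OF assms(2,1)] by auto
  from integral_has_vector_derivative[OF this t]
  have "((\<lambda>u. p + integral {0..u} (\<lambda>s. V (z s))) has_vector_derivative V (z t)) (at t within {0..T})"
    by (auto intro!: derivative_eq_intros)
  then show "(z has_vector_derivative V (z t)) (at t within {0..T})"
    by (rule has_vector_derivative_transform[OF t, rotated]) (use eq in auto)
qed

text \<open>Dominated convergence in the integral equation. The arguments \<open>w n\<close> of the field may differ from the
functions \<open>z n\<close>: for the existence of solutions they are delayed copies, for the dependence on the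
initial point they are the functions themselves.\<close>

lemma ode_sol_limit:
  fixes z w :: "nat \<Rightarrow> real \<Rightarrow> 'a::euclidean_space"
  assumes V: "continuous_on UNIV V" "\<And>x. norm (V x) \<le> M"
    and z: "\<And>n t. t \<in> {0..T} \<Longrightarrow> z n t = q n + integral {0..t} (\<lambda>s. V (w n s))"
    and w: "\<And>n. continuous_on {0..T} (w n)"
    and lim: "\<And>t. t \<in> {0..T} \<Longrightarrow> (\<lambda>n. z n t) \<longlonglongrightarrow> g t"
       "\<And>t. t \<in> {0..T} \<Longrightarrow> (\<lambda>n. w n t) \<longlonglongrightarrow> g t" "q \<longlonglongrightarrow> p"
    and g: "continuous_on {0..T} g"
  shows "ode_sol V T g"
proof (rule ode_sol_of_integral[OF g V(1)])
  fix t assume t: "t \<in> {0..T}"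
  have "(\<lambda>n. integral {0..t} (\<lambda>s. V (w n s))) \<longlonglongrightarrow> integral {0..t} (\<lambda>s. V (g s))"
  proof (rule dominated_convergence(2)[where h="\<lambda>_. M"])
    show "(\<lambda>s. V (w n s)) integrable_on {0..t}" for n
      using t by (intro integrable_continuous_real continuous_on_compose2[OF V(1)] continuous_on_subset[OF w]) auto
    show "(\<lambda>n. V (w n s)) \<longlonglongrightarrow> V (g s)" if "s \<in> {0..t}" for s
      using lim(2)[of s] that t V(1)
      by (metis UNIV_I atLeastAtMost_iff continuous_on_eq_continuous_at isCont_tendsto_compose open_UNIV order_trans)
  qed (use V in auto)
  then have "(\<lambda>n. q n + integral {0..t} (\<lambda>s. V (w n s))) \<longlonglongrightarrow> p + integral {0..t} (\<lambda>s. V (g s))"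
    using lim(3) by (intro tendsto_add)
  with lim(1)[OF t] z[OF t] show "g t = p + integral {0..t} (\<lambda>s. V (g s))"
    by (simp add: LIMSEQ_unique)
qed

text \<open>Tonelli's scheme: because of the delay the right-hand side at time \<open>t\<close> only involves the solution up to
\<open>t - \<delta>\<close>. For \<open>t < 0\<close> the integral is over the empty set, so the history is the constant \<open>p\<close>.\<close>

definition delayed_step :: "('a::euclidean_space \<Rightarrow> 'a) \<Rightarrow> real \<Rightarrow> 'a \<Rightarrow> (real \<Rightarrow> 'a) \<Rightarrow> real \<Rightarrow> 'a" where
  "delayed_step V \<delta> p u t = p + integral {0..t} (\<lambda>s. V (u (s - \<delta>)))"

lemma delayed_step_lipschitz:
  fixes V :: "'a::euclidean_space \<Rightarrow> 'a"
  assumes V: "continuous_on UNIV V" "\<And>x. norm (V x) \<le> M" and u: "continuous_on UNIV u"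
  shows "norm (delayed_step V \<delta> p u t - delayed_step V \<delta> p u t') \<le> M * \<bar>t - t'\<bar>"
proof -
  have M: "M \<ge> 0" using V(2)[of 0] norm_ge_zero order_trans by blast
  have c: "continuous_on S (\<lambda>s. V (u (s - \<delta>)))" for S
    by (rule continuous_on_compose2[OF V(1)], rule continuous_on_compose2[OF u]) (auto intro!: continuous_intros)
  have *: "norm (delayed_step V \<delta> p u b - delayed_step V \<delta> p u a) \<le> M * (b - a)" if "a \<le> b" for a b
  proof -
    consider "b < 0" | "a < 0" "0 \<le> b" | "0 \<le> a" by linarith
    then show ?thesis
    proof cases
      case 1 then show ?thesis using that M by (simp add: delayed_step_def)
    next
      case 2
      have "norm (integral {0..b} (\<lambda>s. V (u (s - \<delta>)))) \<le> M * (b - 0)"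
        using integral_bound[of 0 b "\<lambda>s. V (u (s - \<delta>))" M] c V 2 by auto
      also have "\<dots> \<le> M * (b - a)" using 2 M by (intro mult_left_mono) auto
      finally show ?thesis using 2 by (simp add: delayed_step_def)
    next
      case 3
      have "integral {0..a} (\<lambda>s. V (u (s - \<delta>))) + integral {a..b} (\<lambda>s. V (u (s - \<delta>)))
          = integral {0..b} (\<lambda>s. V (u (s - \<delta>)))"
        by (rule Henstock_Kurzweil_Integration.integral_combine) (use 3 that c integrable_continuous_real in auto)
      then have "delayed_step V \<delta> p u b - delayed_step V \<delta> p u a = integral {a..b} (\<lambda>s. V (u (s - \<delta>)))"
        by (simp add: delayed_step_def algebra_simps)
      then show ?thesis
        using integral_bound[of a b "\<lambda>s. V (u (s - \<delta>))" M] c V that by auto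
    qed
  qed
  show ?thesis
    using *[of t t'] *[of t' t] by (cases "t \<le> t'") (auto simp: norm_minus_commute abs_if)
qed

text \<open>Iterating the delayed step from the constant \<open>p\<close> settles the solution on one more interval of length
\<open>\<delta>\<close> each time, so after finitely many steps it no longer changes up to \<open>T\<close>.\<close>

lemma delayed_solution:
  fixes V :: "'a::euclidean_space \<Rightarrow> 'a"
  assumes V: "continuous_on UNIV V" "\<And>x. norm (V x) \<le> M" and \<delta>: "\<delta> > 0"
  shows "\<exists>z. (\<forall>t t'. norm (z t - z t') \<le> M * \<bar>t - t'\<bar>) \<and>
             (\<forall>t\<le>T. z t = p + integral {0..t} (\<lambda>s. V (z (s - \<delta>))))"
proof -
  define u where "u k = ((delayed_step V \<delta> p) ^^ k) (\<lambda>_. p)" for k :: nat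
  have M: "M \<ge> 0" using V(2)[of 0] norm_ge_zero order_trans by blast
  have uS: "u (Suc k) = delayed_step V \<delta> p (u k)" for k by (simp add: u_def)
  have lip_cont: "continuous_on UNIV w" if "\<forall>t t'. norm (w t - w t') \<le> M * \<bar>t - t'\<bar>" for w :: "real \<Rightarrow> 'a"
  proof -
    have "M-lipschitz_on UNIV w" using that M by (auto simp: lipschitz_on_def dist_norm)
    then show ?thesis by (rule lipschitz_on_continuous_on)
  qed
  have lip: "\<forall>t t'. norm (u k t - u k t') \<le> M * \<bar>t - t'\<bar>" for k
  proof (induction k)
    case 0 then show ?case using M by (simp add: u_def)
  next
    case (Suc k)
    show ?case unfolding uS using delayed_step_lipschitz[OF V lip_cont[OF Suc]] by blast
  qed
  have stab: "\<forall>t \<le> k * \<delta>. u (Suc k) t = u k t" for k :: nat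
  proof (induction k)
    case 0 show ?case
    proof (intro allI impI)
      fix t assume "t \<le> real 0 * \<delta>"
      then have "integral {0..t} (\<lambda>s. V (u 0 (s - \<delta>))) = 0" by (cases "t = 0") auto
      then show "u (Suc 0) t = u 0 t" by (simp add: uS delayed_step_def) (simp add: u_def)
    qed
  next
    case (Suc k)
    show ?case
    proof (intro allI impI)
      fix t assume t: "t \<le> real (Suc k) * \<delta>"
      have "u (Suc k) (s - \<delta>) = u k (s - \<delta>)" if "s \<in> {0..t}" for s
        using Suc[rule_format, of "s - \<delta>"] that t by (simp add: algebra_simps)
      then have "integral {0..t} (\<lambda>s. V (u (Suc k) (s - \<delta>))) = integral {0..t} (\<lambda>s. V (u k (s - \<delta>)))"
        by (intro integral_cong) simp
      then have "delayed_step V \<delta> p (u (Suc k)) t = delayed_step V \<delta> p (u k) t"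
        by (simp only: delayed_step_def)
      then show "u (Suc (Suc k)) t = u (Suc k) t" by (simp only: uS)
    qed
  qed
  obtain k :: nat where "T / \<delta> \<le> k" using real_arch_simple by blast
  then have k: "T \<le> k * \<delta>" using \<delta> by (simp add: field_simps)
  have "u k t = p + integral {0..t} (\<lambda>s. V (u k (s - \<delta>)))" if "t \<le> T" for t
    using stab[of k] that k uS[of k] by (simp add: delayed_step_def)
  then show ?thesis using lip by blast
qed

text \<open>The form of the Arzela-Ascoli theorem that suits solutions of one bounded field: a common Lipschitz
constant and bounded initial points.\<close>

lemma lipschitz_Arzela_Ascoli:
  fixes z :: "nat \<Rightarrow> real \<Rightarrow> 'a::euclidean_space"
  assumes lip: "\<And>n t t'. t \<in> {0..T} \<Longrightarrow> t' \<in> {0..T} \<Longrightarrow> norm (z n t - z n t') \<le> M * \<bar>t - t'\<bar>" and M: "M \<ge> 0"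
    and bnd: "\<And>n. norm (z n 0) \<le> K" and T: "T \<ge> 0"
  obtains g r where "continuous_on {0..T} g" "strict_mono (r::nat \<Rightarrow> nat)"
    "\<And>e. 0 < e \<Longrightarrow> \<exists>N. \<forall>n\<ge>N. \<forall>t\<in>{0..T}. norm (z (r n) t - g t) < e"
proof -
  have b: "norm (z n t) \<le> K + M * T" if "t \<in> {0..T}" for n t
  proof -
    have "norm (z n t) \<le> norm (z n t - z n 0) + norm (z n 0)"
      by (metis diff_add_cancel norm_triangle_ineq)
    also have "\<dots> \<le> M * \<bar>t - 0\<bar> + K" using lip[of t 0 n] bnd[of n] that T by (intro add_mono) auto
    also have "\<dots> \<le> M * T + K" using that M by (auto intro!: mult_left_mono)
    finally show ?thesis by simp
  qed
  have e: "\<exists>d>0. \<forall>n y. y \<in> {0..T} \<and> norm (x - y) < d \<longrightarrow> norm (z n x - z n y) < e"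
    if "x \<in> {0..T}" "0 < e" for x e
  proof (intro exI conjI allI impI)
    show "e / (M + 1) > 0" using that M by simp
    fix n y assume y: "y \<in> {0..T} \<and> norm (x - y) < e / (M + 1)"
    have "norm (z n x - z n y) \<le> M * \<bar>x - y\<bar>" using lip that y by auto
    also have "\<dots> \<le> (M + 1) * \<bar>x - y\<bar>" by (simp add: mult_right_mono)
    also have "\<dots> < (M + 1) * (e / (M + 1))" using y M by (intro mult_strict_left_mono) auto
    also have "\<dots> = e" using M by simp
    finally show "norm (z n x - z n y) < e" .
  qed
  obtain g r where gr: "continuous_on {0..T} g" "strict_mono (r::nat \<Rightarrow> nat)"
    "\<And>e. 0 < e \<Longrightarrow> \<exists>N. \<forall>n x. n \<ge> N \<and> x \<in> {0..T} \<longrightarrow> norm (z (r n) x - g x) < e"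
    using Arzela_Ascoli[of "{0..T}" z "K + M * T", OF _ b e] by (metis compact_Icc)
  show thesis
    by (rule that[OF gr(1,2)]) (use gr(3) in blast)
qed

text \<open>Delayed solutions for \<open>\<delta> = 1/(n+1)\<close> share the Lipschitz constant \<open>M\<close>; a uniform limit of a
subsequence solves the equation.\<close>

lemma peano_existence:
  fixes V :: "'a::euclidean_space \<Rightarrow> 'a"
  assumes V: "continuous_on UNIV V" "\<And>x. norm (V x) \<le> M" and T: "T \<ge> 0"
  shows "\<exists>z. ode_sol V T z \<and> z 0 = p"
proof -
  have M: "M \<ge> 0" using V(2)[of 0] norm_ge_zero order_trans by blast
  define \<delta> where "\<delta> n = inverse (real (Suc n))" for n
  have \<delta>: "\<delta> n > 0" for n by (simp add: \<delta>_def)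
  have "\<forall>n. \<exists>z. (\<forall>t t'. norm (z t - z t') \<le> M * \<bar>t - t'\<bar>) \<and>
             (\<forall>t\<le>T. z t = p + integral {0..t} (\<lambda>s. V (z (s - \<delta> n))))"
    using delayed_solution[OF V \<delta>] by blast
  then obtain z where z: "\<And>n t t'. norm (z n t - z n t') \<le> M * \<bar>t - t'\<bar>"
     "\<And>n t. t \<le> T \<Longrightarrow> z n t = p + integral {0..t} (\<lambda>s. V (z n (s - \<delta> n)))" by metis
  have z0: "z n 0 = p" for n using z(2)[of 0 n] T by simp
  obtain g r where g: "continuous_on {0..T} g" "strict_mono (r::nat \<Rightarrow> nat)"
    "\<And>e. 0 < e \<Longrightarrow> \<exists>N. \<forall>n\<ge>N. \<forall>t\<in>{0..T}. norm (z (r n) t - g t) < e"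
    using lipschitz_Arzela_Ascoli[of T z M "norm p"] z(1) M z0 T by auto
  have lim: "(\<lambda>n. z (r n) t) \<longlonglongrightarrow> g t" if "t \<in> {0..T}" for t
    unfolding LIMSEQ_iff using g(3) that by blast
  have "(\<lambda>n. \<delta> (r n)) \<longlonglongrightarrow> 0"
    using LIMSEQ_subseq_LIMSEQ[OF LIMSEQ_inverse_real_of_nat g(2)] by (simp add: \<delta>_def o_def)
  then have d0: "(\<lambda>n. M * \<delta> (r n)) \<longlonglongrightarrow> 0" using tendsto_mult_right_zero by blast
  have lim': "(\<lambda>n. z (r n) (t - \<delta> (r n))) \<longlonglongrightarrow> g t" if t: "t \<in> {0..T}" for t
  proof -
    have "(\<lambda>n. z (r n) (t - \<delta> (r n)) - z (r n) t) \<longlonglongrightarrow> 0"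
      by (rule Lim_null_comparison[OF _ d0])
        (use z(1) \<delta> in \<open>auto intro!: eventuallyI intro: order_trans[OF z(1)] simp: less_imp_le\<close>)
    from tendsto_add[OF this lim[OF t]] show ?thesis by simp
  qed
  have cont: "continuous_on {0..T} (\<lambda>t. z n (t - \<delta> n))" for n
  proof -
    have "M-lipschitz_on UNIV (z n)" using z(1) M by (auto simp: lipschitz_on_def dist_norm)
    then have "continuous_on UNIV (z n)" by (rule lipschitz_on_continuous_on)
    then show ?thesis by (rule continuous_on_compose2) (auto intro!: continuous_intros)
  qed
  have "ode_sol V T g"
    by (rule ode_sol_limit[OF V, of T "\<lambda>n. z (r n)" "\<lambda>_. p" "\<lambda>n t. z (r n) (t - \<delta> (r n))" g p])
      (use z(2) cont lim lim' g(1) in auto)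
  moreover have "g 0 = p" using lim[of 0] T z0 by (simp add: LIMSEQ_const_iff)
  ultimately show ?thesis by blast
qed

text \<open>The solution is chosen on \<open>[0, t]\<close> with \<open>t\<close> the time of evaluation; where solutions are unique the
choices for different \<open>t\<close> agree.\<close>

definition flow :: "('a::euclidean_space \<Rightarrow> 'a) \<Rightarrow> 'a \<Rightarrow> real \<Rightarrow> 'a" where
  "flow V p t = (SOME z. ode_sol V t z \<and> z 0 = p) t"

text \<open>Uniqueness is only required of solutions that start in an invariant set \<open>D\<close>: a clipped field inherits
it from the original equation only where both coincide.\<close>

locale ode_flow =
  fixes V :: "'a::euclidean_space \<Rightarrow> 'a" and M :: real and D :: "'a set"
  assumes field_cont: "continuous_on UNIV V" and field_bound: "norm (V x) \<le> M"
    and unique: "ode_sol V T z \<Longrightarrow> ode_sol V T w \<Longrightarrow> z 0 = w 0 \<Longrightarrow> z 0 \<in> D \<Longrightarrow> t \<in> {0..T} \<Longrightarrow> z t = w t"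
    and invariant: "ode_sol V T z \<Longrightarrow> z 0 \<in> D \<Longrightarrow> t \<in> {0..T} \<Longrightarrow> z t \<in> D"
begin

lemma flow_eq:
  assumes "ode_sol V T z" "z 0 \<in> D" "t \<in> {0..T}"
  shows "flow V (z 0) t = z t"
proof -
  have s: "ode_sol V t z" using assms ode_sol_mono by auto
  then have "\<exists>w. ode_sol V t w \<and> w 0 = z 0" by blast
  then have "ode_sol V t (SOME w. ode_sol V t w \<and> w 0 = z 0) \<and> (SOME w. ode_sol V t w \<and> w 0 = z 0) 0 = z 0"
    by (rule someI_ex)
  then show ?thesis unfolding flow_def using unique[OF _ s] assms by auto
qed

lemma flow_sol: assumes "p \<in> D" shows "ode_sol V T (flow V p)"
proof (cases "T \<ge> 0")
  case True
  obtain z where z: "ode_sol V T z" "z 0 = p" using peano_existence[OF field_cont field_bound True] by blast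
  show ?thesis by (rule ode_sol_cong[OF z(1)]) (use flow_eq[OF z(1)] z assms in auto)
qed (simp add: ode_sol_def)

lemma flow_0 [simp]: assumes "p \<in> D" shows "flow V p 0 = p"
proof -
  obtain z where z: "ode_sol V 0 z" "z 0 = p" using peano_existence[OF field_cont field_bound] by blast
  then show ?thesis using flow_eq[OF z(1)] assms by auto
qed

lemma flow_in: "p \<in> D \<Longrightarrow> t \<ge> 0 \<Longrightarrow> flow V p t \<in> D"
  using invariant[OF flow_sol, of p t t] by simp

lemma flow_add:
  assumes "p \<in> D" "s \<ge> 0" "t \<ge> 0"
  shows "flow V p (s + t) = flow V (flow V p s) t"
  using flow_eq[OF ode_sol_shift[OF flow_sol[OF assms(1)] assms(2)], of t t] assms flow_in by auto

lemma bound_nonneg: "M \<ge> 0"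
  using field_bound[of 0] norm_ge_zero order_trans by blast

lemma flow_lipschitz:
  assumes "p \<in> D" "0 \<le> s" "0 \<le> t"
  shows "norm (flow V p s - flow V p t) \<le> M * \<bar>s - t\<bar>"
  using ode_sol_lipschitz[OF flow_sol[OF assms(1)] field_bound, of s "max s t" t] assms by auto

text \<open>Kamke's argument: if initial points \<open>q n\<close> tending to \<open>p\<close> had solutions staying away from the one of
\<open>p\<close>, a uniformly convergent subsequence would have a second solution starting at \<open>p\<close> as its limit.\<close>

lemma flow_uniform_closeness:
  assumes p: "p \<in> D" and e: "e > 0"
  shows "\<exists>d>0. \<forall>q\<in>D. norm (q - p) < d \<longrightarrow> (\<forall>t\<in>{0..T}. norm (flow V q t - flow V p t) < e)"
proof (cases "T \<ge> 0")
  case T: True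
  show ?thesis
  proof (rule ccontr)
    assume "\<not> ?thesis"
    then have "\<forall>n. \<exists>q\<in>D. norm (q - p) < inverse (real (Suc n)) \<and> (\<exists>t\<in>{0..T}. norm (flow V q t - flow V p t) \<ge> e)"
      by (metis inverse_positive_iff_positive not_le of_nat_0_less_iff zero_less_Suc)
    then obtain q where q: "\<And>n. q n \<in> D" "\<And>n. norm (q n - p) < inverse (real (Suc n))"
      "\<And>n. \<exists>t\<in>{0..T}. norm (flow V (q n) t - flow V p t) \<ge> e" by metis
    have "norm (q n) \<le> norm p + 1" for n
    proof -
      have "inverse (real (Suc n)) \<le> 1" by (simp add: field_simps)
      then show ?thesis using q(2)[of n] norm_triangle_sub[of "q n" p] by linarith
    qed
    then have "norm (flow V (q n) 0) \<le> norm p + 1" for n by (simp add: q(1))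
    moreover have "norm (flow V (q n) t - flow V (q n) t') \<le> M * \<bar>t - t'\<bar>"
      if "t \<in> {0..T}" "t' \<in> {0..T}" for n t t' using flow_lipschitz[OF q(1)] that by auto
    ultimately obtain g r where g: "continuous_on {0..T} g" "strict_mono (r::nat \<Rightarrow> nat)"
      "\<And>e. 0 < e \<Longrightarrow> \<exists>N. \<forall>n\<ge>N. \<forall>t\<in>{0..T}. norm (flow V (q (r n)) t - g t) < e"
      using lipschitz_Arzela_Ascoli[of T "\<lambda>n. flow V (q n)" M "norm p + 1"] bound_nonneg T by metis
    have "(\<lambda>n. q n - p) \<longlonglongrightarrow> 0"
      by (rule Lim_null_comparison[OF _ LIMSEQ_inverse_real_of_nat]) (use q(2) in \<open>auto simp: less_imp_le\<close>)
    from tendsto_add[OF this tendsto_const[of p]] have "q \<longlonglongrightarrow> p" by simp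
    then have qp: "(\<lambda>n. q (r n)) \<longlonglongrightarrow> p" using LIMSEQ_subseq_LIMSEQ[OF _ g(2)] by (simp add: o_def)
    have lim: "(\<lambda>n. flow V (q (r n)) t) \<longlonglongrightarrow> g t" if "t \<in> {0..T}" for t
      unfolding LIMSEQ_iff using g(3) that by blast
    have sol: "ode_sol V T g"
      by (rule ode_sol_limit[OF field_cont field_bound, of T "\<lambda>n. flow V (q (r n))" "\<lambda>n. q (r n)" "\<lambda>n. flow V (q (r n))" g p])
       (use lim g(1) qp ode_sol_integral[OF flow_sol[OF q(1)] field_cont] ode_sol_continuous[OF flow_sol[OF q(1)]] q(1) in auto)
    have "g 0 = p" using lim[of 0] T q(1) qp LIMSEQ_unique by fastforce
    then have "flow V p t = g t" if "t \<in> {0..T}" for t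
      using flow_eq[OF sol _ that] p by simp
    then obtain N where "\<forall>n\<ge>N. \<forall>t\<in>{0..T}. norm (flow V (q (r n)) t - flow V p t) < e"
      using g(3)[OF e] by fastforce
    then show False using q(3)[of "r N"] by (meson le_refl not_le)
  qed
qed (auto intro!: exI[of _ 1])

lemma continuous_on_flow:
  assumes "continuous_on S p" "continuous_on S \<tau>" "\<And>x. x \<in> S \<Longrightarrow> p x \<in> D" "\<And>x. x \<in> S \<Longrightarrow> \<tau> x \<ge> 0"
  shows "continuous_on S (\<lambda>x. flow V (p x) (\<tau> x))"
proof -
  have "continuous_on (D \<times> {0..}) (\<lambda>(p, t). flow V p t)"
    unfolding continuous_on_iff
  proof (intro ballI allI impI)
    fix a :: "'a \<times> real" and e :: real
    assume a: "a \<in> D \<times> {0..}" and e: "0 < e"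
    obtain p t where pt: "a = (p, t)" "p \<in> D" "t \<ge> 0" using a by auto
    obtain d where d: "d > 0"
      "\<And>q s. q \<in> D \<Longrightarrow> norm (q - p) < d \<Longrightarrow> s \<in> {0..t+1} \<Longrightarrow> norm (flow V q s - flow V p s) < e / 2"
      using flow_uniform_closeness[OF pt(2), of "e/2" "t+1"] e by auto
    define d' where "d' = min d (min 1 (e / (2 * (M + 1))))"
    have d': "d' > 0" using d e bound_nonneg by (simp add: d'_def)
    have "dist (flow V q s) (flow V p t) < e" if "q \<in> D" "s \<ge> 0" "dist (q, s) (p, t) < d'" for q s
    proof -
      have "dist q p < d'" "dist s t < d'"
        using that(3) dist_fst_le[of "(q,s)" "(p,t)"] dist_snd_le[of "(q,s)" "(p,t)"] by auto
      then have 1: "norm (q - p) < d" "\<bar>s - t\<bar> < 1" "\<bar>s - t\<bar> < e / (2 * (M + 1))"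
        by (auto simp: d'_def dist_norm)
      have "norm (flow V q s - flow V p s) < e / 2" using d(2) that 1 by auto
      moreover have "norm (flow V p s - flow V p t) \<le> e / 2"
      proof -
        have "norm (flow V p s - flow V p t) \<le> M * \<bar>s - t\<bar>" using flow_lipschitz that pt by auto
        also have "\<dots> \<le> (M + 1) * \<bar>s - t\<bar>" by (simp add: mult_right_mono)
        also have "\<dots> \<le> (M + 1) * (e / (2 * (M + 1)))" using 1 bound_nonneg by (intro mult_left_mono) auto
        also have "\<dots> = e / 2" using bound_nonneg by (simp add: field_simps)
        finally show ?thesis .
      qed
      ultimately show ?thesis
        unfolding dist_norm by norm
    qed
    then show "\<exists>d>0. \<forall>x'\<in>D \<times> {0..}. dist x' a < d \<longrightarrow> dist (case x' of (p, t) \<Rightarrow> flow V p t) (case a of (p, t) \<Rightarrow> flow V p t) < e"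
      using d' pt by auto
  qed
  from continuous_on_compose2[OF this, of S "\<lambda>x. (p x, \<tau> x)"] show ?thesis
    using assms by (auto intro!: continuous_intros)
qed

end

section \<open>Planar systems around a centre\<close>

text \<open>Reflection in the origin turns the system of \<open>h\<close>, \<open>f\<close> into that of \<open>flip h\<close>, \<open>flip f\<close>.\<close>

definition flip :: "(real \<Rightarrow> real) \<Rightarrow> real \<Rightarrow> real" where
  "flip h x = - h (- x)"

definition field :: "(real \<Rightarrow> real) \<Rightarrow> (real \<Rightarrow> real) \<Rightarrow> real \<times> real \<Rightarrow> real \<times> real" where
  "field h f p = (h (snd p), - f (fst p))"

definition energy :: "(real \<Rightarrow> real) \<Rightarrow> (real \<Rightarrow> real) \<Rightarrow> real \<times> real \<Rightarrow> real" where
  "energy H F p = H (snd p) + F (fst p)"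

text \<open>The quarter turn opposite to the clockwise motion of the orbits: it brings quadrant IV, which is entered
after quadrant I, back to quadrant I.\<close>

definition rot :: "real \<times> real \<Rightarrow> real \<times> real" where
  "rot p = (- snd p, fst p)"

definition region :: "(real \<Rightarrow> real) \<Rightarrow> (real \<Rightarrow> real) \<Rightarrow> real \<Rightarrow> (real \<times> real) set" where
  "region H F C = {p. 0 < energy H F p \<and> energy H F p \<le> C}"

definition sector :: "(real \<Rightarrow> real) \<Rightarrow> (real \<Rightarrow> real) \<Rightarrow> real \<Rightarrow> (real \<times> real) set" where
  "sector H F C = {p \<in> region H F C. 0 \<le> fst p \<and> 0 \<le> snd p}"

text \<open>For \<open>p\<close> in the first quadrant, the time at which the orbit reaches the positive \<open>x\<close>-axis.\<close>

definition exit_time :: "(real \<Rightarrow> real) \<Rightarrow> (real \<Rightarrow> real) \<Rightarrow> real \<times> real \<Rightarrow> real" where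
  "exit_time h f p = (SOME B. 0 \<le> B \<and> snd (flow (field h f) p B) = 0 \<and>
     (\<forall>t\<in>{0..<B}. 0 < snd (flow (field h f) p t)))"

lemma flip_flip [simp]: "flip (flip h) = h" by (simp add: flip_def fun_eq_iff)

lemma energy_rot [simp]: "energy F (\<lambda>x. H (- x)) (rot p) = energy H F p"
  by (simp add: energy_def rot_def)

lemma rot_region [simp]: "rot p \<in> region F (\<lambda>x. H (- x)) C \<longleftrightarrow> p \<in> region H F C"
  by (simp add: region_def)

lemma bounded_linear_rot: "bounded_linear rot"
  unfolding rot_def
  by (intro bounded_linear_Pair bounded_linear_minus bounded_linear_fst bounded_linear_snd)

lemma continuous_on_rot [continuous_intros]: "continuous_on S p \<Longrightarrow> continuous_on S (\<lambda>x. rot (p x))"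
  by (rule bounded_linear.continuous_on[OF bounded_linear_rot])

lemma rot_field: "rot (field h f p) = field f (flip h) (rot p)"
  by (simp add: rot_def field_def flip_def)

lemma ode_sol_rot:
  assumes "ode_sol (field h f) T z"
  shows "ode_sol (field f (flip h)) T (\<lambda>t. rot (z t))"
  using assms bounded_linear.has_vector_derivative[OF bounded_linear_rot]
  unfolding ode_sol_def rot_field[symmetric] by blast

lemma rot4 [simp]: "rot (rot (rot (rot p))) = p"
  by (simp add: rot_def)

lemma ode_sol_planar:
  assumes "ode_sol (field h f) T z" "t \<in> {0..T}"
  shows "((\<lambda>t. fst (z t)) has_real_derivative h (snd (z t))) (at t within {0..T})"
    "((\<lambda>t. snd (z t)) has_real_derivative - f (fst (z t))) (at t within {0..T})"
  using assms bounded_linear.has_vector_derivative[OF bounded_linear_fst, of z "field h f (z t)"]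
    bounded_linear.has_vector_derivative[OF bounded_linear_snd, of z "field h f (z t)"]
  unfolding ode_sol_def has_real_derivative_iff_has_vector_derivative
  by (auto simp: field_def)

lemma energy_conserved:
  assumes H: "\<And>x. (H has_real_derivative h x) (at x)" and F: "\<And>x. (F has_real_derivative f x) (at x)"
    and z: "ode_sol (field h f) T z" and t: "t \<in> {0..T}"
  shows "energy H F (z t) = energy H F (z 0)"
proof -
  have "((\<lambda>t. energy H F (z t)) has_real_derivative 0) (at s within {0..T})" if "s \<in> {0..T}" for s
    unfolding energy_def
    by (rule derivative_eq_intros DERIV_chain2[OF H] DERIV_chain2[OF F] ode_sol_planar[OF z that] refl)+ simp
  then obtain c where "\<forall>s\<in>{0..T}. energy H F (z s) = c"
    using has_field_derivative_zero_constant[of "{0..T}" "\<lambda>t. energy H F (z t)"] by auto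
  then show ?thesis using t by auto
qed

text \<open>The potentials \<open>H\<close> and \<open>F\<close> are parameters, not integrals, so that the rotated system is literally
another instance with the roles of \<open>H\<close> and \<open>F\<close> exchanged. The origin is kept out of \<open>region H F C\<close>
because its energy is \<open>0\<close>.\<close>

locale planar =
  fixes h f H F :: "real \<Rightarrow> real" and C M R :: real
  assumes h_cont: "continuous_on UNIV h" and f_cont: "continuous_on UNIV f"
    and h_0: "h 0 = 0" and f_0: "f 0 = 0"
    and h_sign: "x \<noteq> 0 \<Longrightarrow> 0 < x * h x" and f_sign: "x \<noteq> 0 \<Longrightarrow> 0 < x * f x"
    and h_bound: "\<bar>h x\<bar> \<le> M" and f_bound: "\<bar>f x\<bar> \<le> M"
    and H_deriv: "(H has_real_derivative h x) (at x)" and F_deriv: "(F has_real_derivative f x) (at x)"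
    and H_0: "H 0 = 0" and F_0: "F 0 = 0"
    and H_proper: "H x \<le> C \<Longrightarrow> \<bar>x\<bar> \<le> R" and F_proper: "F x \<le> C \<Longrightarrow> \<bar>x\<bar> \<le> R"
    and planar_unique: "ode_sol (field h f) T z \<Longrightarrow> ode_sol (field h f) T w \<Longrightarrow> z 0 = w 0 \<Longrightarrow>
        z 0 \<in> region H F C \<Longrightarrow> t \<in> {0..T} \<Longrightarrow> z t = w t"

text \<open>With \<open>X = -y\<close>, \<open>Y = x\<close> the equations become \<open>X' = f(Y)\<close>, \<open>Y' = h(-X)\<close>. Everything proved about
the first quadrant therefore holds in the other three.\<close>

lemma planar_rot:
  assumes "planar h f H F C M R"
  shows "planar f (flip h) F (\<lambda>x. H (- x)) C M R"
proof -
  interpret planar h f H F C M R by fact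
  show ?thesis
  proof
    fix x
    show "continuous_on UNIV (flip h)"
      unfolding flip_def by (intro continuous_intros continuous_on_compose2[OF h_cont]) auto
    show "x \<noteq> 0 \<Longrightarrow> 0 < x * flip h x" using h_sign[of "-x"] by (simp add: flip_def)
    show "((\<lambda>x. H (- x)) has_real_derivative flip h x) (at x)"
      using DERIV_chain2[OF H_deriv[of "-x"] DERIV_minus[OF DERIV_ident]] by (simp add: flip_def)
    show "H (- x) \<le> C \<Longrightarrow> \<bar>x\<bar> \<le> R" using H_proper[of "-x"] by simp
  next
    fix T z w t
    assume z: "ode_sol (field f (flip h)) T z" and w: "ode_sol (field f (flip h)) T w"
      and *: "z 0 = w 0" "z 0 \<in> region F (\<lambda>x. H (- x)) C" "t \<in> {0..T}"
    let ?r = "\<lambda>z t. rot (rot (rot (z t)))"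
    have "ode_sol (field h f) T (?r v)" if "ode_sol (field f (flip h)) T v" for v
      using ode_sol_rot[OF ode_sol_rot[OF ode_sol_rot[OF that]]] by simp
    from this[OF z] this[OF w] have "?r z t = ?r w t"
    proof (rule planar_unique)
      show "?r z 0 \<in> region H F C" using *(2) by (simp add: region_def energy_def rot_def)
    qed (use * in simp_all)
    then show "z t = w t" by (metis rot4)
  qed (use f_cont h_0 f_0 f_sign h_bound f_bound H_0 F_0 F_deriv F_proper in \<open>auto simp: flip_def\<close>)
qed

context planar
begin

abbreviation "V \<equiv> field h f"
abbreviation "D \<equiv> region H F C"
abbreviation "X p t \<equiv> fst (flow V p t)"
abbreviation "Y p t \<equiv> snd (flow V p t)"

lemma h_pos: "x > 0 \<Longrightarrow> h x > 0" and h_neg: "x < 0 \<Longrightarrow> h x < 0"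
  and f_pos: "x > 0 \<Longrightarrow> f x > 0" and f_neg: "x < 0 \<Longrightarrow> f x < 0"
  using h_sign[of x] f_sign[of x] by (auto simp: zero_less_mult_iff)

lemma H_continuous: "continuous_on S H" and F_continuous: "continuous_on S F"
  using H_deriv F_deriv by (meson DERIV_isCont continuous_at_imp_continuous_on)+

lemma energy_continuous: "continuous_on S p \<Longrightarrow> continuous_on S (\<lambda>x. energy H F (p x))"
  unfolding energy_def
  by (intro continuous_intros continuous_on_compose2[OF H_continuous[of UNIV]] continuous_on_compose2[OF F_continuous[of UNIV]]) auto

lemma H_mono: "0 \<le> x \<Longrightarrow> x < y \<Longrightarrow> H x < H y"
  by (rule DERIV_pos_imp_increasing_open[of x y H]) (use H_deriv h_pos H_continuous in force)+

lemma H_pos: "x \<noteq> 0 \<Longrightarrow> 0 < H x"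
proof (cases "x > 0")
  case True then show ?thesis using H_mono[of 0 x] H_0 by simp
next
  case False
  assume "x \<noteq> 0"
  with False have "x < 0" by simp
  then have "H 0 < H x"
    by (intro DERIV_neg_imp_decreasing_open[of x 0 H]) (use H_deriv h_neg H_continuous in force)+
  then show ?thesis using H_0 by simp
qed

end

context planar begin

lemma rotated: "planar f (flip h) F (\<lambda>x. H (- x)) C M R"
  using planar_rot planar_axioms by blast

lemma F_mono: "0 \<le> x \<Longrightarrow> x < y \<Longrightarrow> F x < F y"
  using planar.H_mono[OF rotated] .

lemma F_pos: "x \<noteq> 0 \<Longrightarrow> 0 < F x"
  using planar.H_pos[OF rotated] .

lemma H_nonneg: "0 \<le> H x" and F_nonneg: "0 \<le> F x"
  using H_pos[of x] F_pos[of x] H_0 F_0 by (cases "x = 0"; force)+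

lemma H_inj: "0 \<le> x \<Longrightarrow> 0 \<le> y \<Longrightarrow> H x = H y \<Longrightarrow> x = y"
  using H_mono[of x y] H_mono[of y x] by (cases x y rule: linorder_cases) auto

lemma region_iff: "p \<in> D \<longleftrightarrow> p \<noteq> 0 \<and> energy H F p \<le> C"
proof -
  have "0 < energy H F p \<longleftrightarrow> p \<noteq> 0"
    using H_pos[of "snd p"] F_pos[of "fst p"] H_nonneg[of "snd p"] F_nonneg[of "fst p"] H_0 F_0
    by (cases p) (auto simp: energy_def zero_prod_def; smt (verit))
  then show ?thesis by (simp add: region_def)
qed

lemma region_bounded: assumes "p \<in> D" shows "\<bar>fst p\<bar> \<le> R" "\<bar>snd p\<bar> \<le> R"
  using assms H_proper[of "snd p"] F_proper[of "fst p"] H_nonneg[of "snd p"] F_nonneg[of "fst p"]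
  by (auto simp: region_def energy_def)

lemma energy_constant: "ode_sol V T z \<Longrightarrow> t \<in> {0..T} \<Longrightarrow> energy H F (z t) = energy H F (z 0)"
  by (rule energy_conserved[OF H_deriv F_deriv])

sublocale ode_flow V "2 * M" D
proof
  have "continuous_on UNIV (\<lambda>p. (h (snd p), - f (fst p)))"
    by (intro continuous_intros continuous_on_compose2[OF h_cont] continuous_on_compose2[OF f_cont]) auto
  then show "continuous_on UNIV V" by (simp add: field_def[abs_def])
  show "norm (V x) \<le> 2 * M" for x
    using norm_Pair_le[of "h (snd x)" "- f (fst x)"] h_bound[of "snd x"] f_bound[of "fst x"]
    by (simp add: field_def)
  show "z t \<in> D" if "ode_sol V T z" "z 0 \<in> D" "t \<in> {0..T}" for T z t
    using energy_constant[OF that(1,3)] that(2) by (simp add: region_def)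
qed (rule planar_unique)

lemma flow_energy: "p \<in> D \<Longrightarrow> 0 \<le> t \<Longrightarrow> energy H F (flow V p t) = energy H F p"
  using energy_constant[OF flow_sol, of p t t] by simp

lemma flow_rot:
  assumes "p \<in> D" "0 \<le> t"
  shows "flow (field f (flip h)) (rot p) t = rot (flow V p t)"
proof -
  interpret r: planar f "flip h" F "\<lambda>x. H (- x)" C M R by (rule rotated)
  show ?thesis
    using r.flow_eq[OF ode_sol_rot[OF flow_sol[OF assms(1)]], of t t] assms by simp
qed

lemma flow_deriv:
  assumes "p \<in> D" "t \<in> {0..T}"
  shows "(X p has_real_derivative h (Y p t)) (at t within {0..T})"
    "(Y p has_real_derivative - f (X p t)) (at t within {0..T})"
  using ode_sol_planar[OF flow_sol[OF assms(1)] assms(2)] by auto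

lemma flow_deriv_at:
  assumes "p \<in> D" "t > 0"
  shows "(X p has_real_derivative h (Y p t)) (at t)" "(Y p has_real_derivative - f (X p t)) (at t)"
proof -
  have "at t within {0..t+1} = at t" using assms by (intro at_within_interior) auto
  then show "(X p has_real_derivative h (Y p t)) (at t)" "(Y p has_real_derivative - f (X p t)) (at t)"
    using flow_deriv[OF assms(1), of t "t + 1"] assms(2) by simp_all
qed

lemma flow_continuous: assumes "p \<in> D" shows "continuous_on {0..} (X p)" "continuous_on {0..} (Y p)"
proof -
  have "continuous_on {0..} (flow V p)"
    by (rule continuous_on_flow) (use assms in \<open>simp_all add: continuous_on_id\<close>)
  then show "continuous_on {0..} (X p)" "continuous_on {0..} (Y p)"
    by (rule continuous_on_fst continuous_on_snd)+
qed

lemma X_increasing: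
  assumes "p \<in> D" "0 \<le> a" "a < b" "\<And>t. a < t \<Longrightarrow> t < b \<Longrightarrow> 0 < Y p t"
  shows "X p a < X p b"
proof (rule DERIV_pos_imp_increasing_open[OF assms(3)])
  show "\<exists>y. (X p has_real_derivative y) (at t) \<and> 0 < y" if "a < t" "t < b" for t
    using flow_deriv_at(1)[OF assms(1), of t] h_pos[OF assms(4)[OF that]] assms(2) that by force
qed (use assms(2) in \<open>auto intro: continuous_on_subset[OF flow_continuous(1)[OF assms(1)]]\<close>)

text \<open>While \<open>y > 0\<close>, \<open>x\<close> increases; after time \<open>1\<close> it lies in a compact interval of positive numbers,
where \<open>y' = -f(x)\<close> is bounded away from \<open>0\<close>.\<close>

lemma Y_reaches_zero:
  assumes p: "p \<in> sector H F C"
  shows "\<exists>t\<ge>0. Y p t \<le> 0"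
proof (rule ccontr)
  assume "\<not> ?thesis"
  then have pos: "Y p t > 0" if "t \<ge> 0" for t using that by (meson not_le)
  have pD: "p \<in> D" and p0: "0 \<le> fst p" using p by (auto simp: sector_def)
  have "X p 0 < X p 1" by (rule X_increasing) (use pD pos in auto)
  then have X1: "0 < X p 1" using p0 pD by simp
  have Xge: "X p 1 \<le> X p t" if "1 \<le> t" for t
    using X_increasing[OF pD, of 1 t] pos that by (cases "t = 1") (auto simp: less_imp_le)
  have XR: "X p t \<le> R" if "0 \<le> t" for t using region_bounded[OF flow_in[OF pD that]] by simp
  have "X p 1 \<le> R" using XR by simp
  then obtain a where a: "a \<in> {X p 1..R}" "\<And>x. x \<in> {X p 1..R} \<Longrightarrow> f a \<le> f x"
    using continuous_attains_inf[of "{X p 1..R}" f] continuous_on_subset[OF f_cont] by auto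
  have fa: "f a > 0" using a(1) X1 f_pos by auto
  \<comment> \<open>a time by which decreasing at rate at least \<open>f a\<close> would have used up \<open>Y p 1\<close>\<close>
  define T where "T = 1 + Y p 1 / f a"
  have T: "T > 1" using pos[of 1] fa by (simp add: T_def)
  obtain \<xi> where \<xi>: "1 < \<xi>" "\<xi> < T" "Y p T - Y p 1 = (T - 1) * (- f (X p \<xi>))"
    using MVT2[of 1 T "Y p" "\<lambda>t. - f (X p t)"] flow_deriv_at(2)[OF pD] T by auto
  have "f a \<le> f (X p \<xi>)" using a(2) Xge XR \<xi> by auto
  then have "(T - 1) * f a \<le> (T - 1) * f (X p \<xi>)" using T by (intro mult_left_mono) auto
  then have "Y p T \<le> 0" using \<xi>(3) fa by (simp add: T_def)
  then show False using pos[of T] T by simp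
qed

lemma exit_time_eq:
  assumes "0 \<le> B" "Y p B = 0" "\<And>t. 0 \<le> t \<Longrightarrow> t < B \<Longrightarrow> 0 < Y p t"
  shows "exit_time h f p = B"
  unfolding exit_time_def
proof (rule some_equality)
  fix B' assume "0 \<le> B' \<and> Y p B' = 0 \<and> (\<forall>t\<in>{0..<B'}. 0 < Y p t)"
  then show "B' = B" using assms by (cases B' B rule: linorder_cases) force+
qed (use assms in auto)

lemma exit_time:
  assumes p: "p \<in> sector H F C"
  shows "0 \<le> exit_time h f p" "Y p (exit_time h f p) = 0"
    "\<And>t. 0 \<le> t \<Longrightarrow> t < exit_time h f p \<Longrightarrow> 0 < Y p t"
proof -
  have pD: "p \<in> D" and p0: "0 \<le> fst p" "0 \<le> snd p" using p by (auto simp: sector_def)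
  obtain t0 where t0: "t0 \<ge> 0" "Y p t0 \<le> 0" using Y_reaches_zero[OF p] by blast
  let ?Z = "{0..t0} \<inter> Y p -` {0}"
  have c: "continuous_on {0..t} (Y p)" for t using continuous_on_subset[OF flow_continuous(2)[OF pD]] by auto
  have "closed ?Z" by (rule continuous_closed_preimage[OF c]) auto
  then have "compact ?Z" by (metis Int_commute compact_Icc closed_Int_compact inf_assoc inf_idem)
  moreover have "?Z \<noteq> {}"
    using IVT2'[of "Y p" t0 0 0] t0 c pD p0 by auto
  ultimately obtain B where B: "B \<in> ?Z" "\<And>t. t \<in> ?Z \<Longrightarrow> B \<le> t" using compact_attains_inf by metis
  have "0 < Y p t" if t: "0 \<le> t" "t < B" for t
  proof (rule ccontr)
    assume "\<not> ?thesis"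
    then obtain s where "0 \<le> s" "s \<le> t" "Y p s = 0" using IVT2'[of "Y p" t 0 0] t c pD p0 by auto
    then show False using B(2)[of s] B(1) t by auto
  qed
  then have "exit_time h f p = B" "0 \<le> B" "Y p B = 0" "\<And>t. 0 \<le> t \<Longrightarrow> t < B \<Longrightarrow> 0 < Y p t"
    using B exit_time_eq[of B p] by auto
  then show "0 \<le> exit_time h f p" "Y p (exit_time h f p) = 0"
    "\<And>t. 0 \<le> t \<Longrightarrow> t < exit_time h f p \<Longrightarrow> 0 < Y p t" by auto
qed

lemma X_pos_in_sector:
  assumes p: "p \<in> sector H F C" and t: "0 < t" "t \<le> exit_time h f p"
  shows "0 < X p t"
  using X_increasing[of p 0 t] exit_time[OF p] assms by (auto simp: sector_def)

lemma X_nonneg_in_sector: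
  assumes p: "p \<in> sector H F C" and t: "0 \<le> t" "t \<le> exit_time h f p"
  shows "0 \<le> X p t"
  using X_pos_in_sector[OF p, of t] assms by (cases "t = 0") (auto simp: sector_def)

lemma exit_X_pos:
  assumes p: "p \<in> sector H F C"
  shows "0 < X p (exit_time h f p)"
proof -
  let ?B = "exit_time h f p"
  have "energy H F (flow V p ?B) > 0" 
    using flow_in[of p ?B] p exit_time[OF p] by (auto simp: sector_def region_def)
  then have "X p ?B \<noteq> 0" using exit_time(2)[OF p] H_0 F_0 by (auto simp: energy_def)
  then show ?thesis using X_nonneg_in_sector[OF p, of ?B] exit_time[OF p] by auto
qed

lemma Y_nonneg_in_sector: "p \<in> sector H F C \<Longrightarrow> 0 \<le> t \<Longrightarrow> t \<le> exit_time h f p \<Longrightarrow> 0 \<le> Y p t"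
  using exit_time(2,3)[of p] by (cases "t = exit_time h f p") (auto simp: less_imp_le)

lemma flow_in_sector:
  "p \<in> sector H F C \<Longrightarrow> 0 \<le> t \<Longrightarrow> t \<le> exit_time h f p \<Longrightarrow> flow V p t \<in> sector H F C"
  using flow_in X_nonneg_in_sector Y_nonneg_in_sector by (auto simp: sector_def)

lemma exit_time_after:
  assumes p: "p \<in> sector H F C" and t: "0 \<le> t" "t \<le> exit_time h f p"
  shows "exit_time h f (flow V p t) = exit_time h f p - t"
proof (rule exit_time_eq)
  have pD: "p \<in> D" using p by (auto simp: sector_def)
  show "Y (flow V p t) (exit_time h f p - t) = 0"
    using flow_add[OF pD, of t "exit_time h f p - t"] exit_time[OF p] t by simp
  show "0 < Y (flow V p t) s" if "0 \<le> s" "s < exit_time h f p - t" for s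
    using flow_add[OF pD, of t s] exit_time(3)[OF p, of "t + s"] that t by simp
qed (use t in simp)

lemma Y_neg_after_exit:
  assumes p: "p \<in> sector H F C"
  shows "\<exists>d>0. \<forall>s. exit_time h f p < s \<longrightarrow> s < exit_time h f p + d \<longrightarrow> Y p s < 0"
proof -
  let ?B = "exit_time h f p"
  have pD: "p \<in> D" using p by (auto simp: sector_def)
  obtain d where d: "d > 0" "\<forall>s>0. ?B + s \<in> {0..?B+1} \<longrightarrow> s < d \<longrightarrow> Y p ?B > Y p (?B + s)"
    using has_real_derivative_neg_dec_right[OF flow_deriv(2)[OF pD, of ?B "?B + 1"]]
      exit_X_pos[OF p] f_pos exit_time(1)[OF p] by auto
  have "Y p s < 0" if "?B < s" "s < ?B + min d 1" for s
    using d(2)[rule_format, of "s - ?B"] exit_time[OF p] that by auto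
  then show ?thesis using d(1) by (intro exI[of _ "min d 1"]) auto
qed

text \<open>On the orbit of \<open>p\<close>, \<open>y\<close> is bounded below by a positive constant until shortly before the exit and
is negative shortly after it. Both properties persist for orbits that start near \<open>p\<close>, so their exit
times are squeezed.\<close>

lemma exit_time_continuous: "continuous_on (sector H F C) (exit_time h f)"
  unfolding continuous_on_iff
proof (intro ballI allI impI)
  fix p and e :: real assume p: "p \<in> sector H F C" and e: "e > 0"
  let ?B = "exit_time h f p"
  have pD: "p \<in> D" using p by (auto simp: sector_def)
  note B = exit_time[OF p]
  obtain d where d: "d > 0" "\<And>s. ?B < s \<Longrightarrow> s < ?B + d \<Longrightarrow> Y p s < 0" using Y_neg_after_exit[OF p] by blast
  define s where "s = ?B + min d e / 2"
  have s: "?B < s" "s < ?B + e" "Y p s < 0" using d e by (auto simp: s_def intro!: d(2))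
  obtain \<eta> where \<eta>: "\<eta> > 0" "\<And>t. 0 \<le> t \<Longrightarrow> t \<le> ?B - e / 2 \<Longrightarrow> \<eta> \<le> Y p t"
  proof (cases "?B - e / 2 \<ge> 0")
    case True
    have "continuous_on {0..?B - e/2} (Y p)" using continuous_on_subset[OF flow_continuous(2)[OF pD]] by auto
    then obtain a where "a \<in> {0..?B - e/2}" "\<forall>t\<in>{0..?B - e/2}. Y p a \<le> Y p t"
      using continuous_attains_inf[of "{0..?B - e/2}" "Y p"] True by auto
    then show ?thesis using that[of "Y p a"] B(3)[of a] e by auto
  qed (use that[of 1] in auto)
  obtain \<delta> where \<delta>: "\<delta> > 0" "\<And>q t. q \<in> D \<Longrightarrow> norm (q - p) < \<delta> \<Longrightarrow> t \<in> {0..s} \<Longrightarrow>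
      norm (flow V q t - flow V p t) < min \<eta> (- Y p s)"
    using flow_uniform_closeness[OF pD, of "min \<eta> (- Y p s)" s] \<eta> s by auto
  have "dist (exit_time h f q) ?B < e" if q: "q \<in> sector H F C" "dist q p < \<delta>" for q
  proof -
    have qD: "q \<in> D" using q by (auto simp: sector_def)
    note B' = exit_time[OF q(1)]
    have close: "\<bar>Y q t - Y p t\<bar> < min \<eta> (- Y p s)" if "t \<in> {0..s}" for t
      using norm_snd_le[of "Y q t - Y p t" "X q t - X p t"] \<delta>(2)[OF qD _ that] q(2)
      by (simp add: dist_norm minus_prod_def)
    have "Y q s < 0" using close[of s] s B(1) by auto
    then have "\<not> s < exit_time h f q" using B'(3)[of s] s B(1) by force
    moreover have "\<not> exit_time h f q \<le> ?B - e / 2"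
    proof
      assume *: "exit_time h f q \<le> ?B - e / 2"
      then have "\<eta> \<le> Y p (exit_time h f q)" using \<eta>(2) B'(1) by auto
      moreover have "exit_time h f q \<in> {0..s}" using * B'(1) s e by auto
      ultimately show False using close[of "exit_time h f q"] B'(2) by auto
    qed
    ultimately show ?thesis using s e by (auto simp: dist_real_def)
  qed
  then show "\<exists>d>0. \<forall>q\<in>sector H F C. dist q p < d \<longrightarrow> dist (exit_time h f q) ?B < e"
    using \<delta>(1) by blast
qed

end

section \<open>Successive axis crossings\<close>

lemma compact_Icc_preimage:
  fixes f :: "real \<Rightarrow> real"
  assumes "continuous_on {a..b} f" "closed S"
  shows "compact ({a..b} \<inter> f -` S)"
  unfolding compact_eq_bounded_closed
  using continuous_closed_preimage[OF assms(1) closed_atLeastAtMost assms(2)]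
  by (simp add: bounded_Int)

text \<open>Take the first point where \<open>f\<close> has reached \<open>B\<close>, then the last point before it where \<open>f\<close> is at
most \<open>A\<close>. The disjunctions leave the orientation of the path open, since each stage may reverse it.\<close>

lemma crossing_subinterval:
  fixes f :: "real \<Rightarrow> real"
  assumes f: "continuous_on {u..v} f" and uv: "u \<le> v" and AB: "A < B"
    and ends: "f u \<le> A \<and> B \<le> f v \<or> B \<le> f u \<and> f v \<le> A"
  obtains u' v' where "u \<le> u'" "u' \<le> v'" "v' \<le> v" "\<And>x. x \<in> {u'..v'} \<Longrightarrow> A \<le> f x \<and> f x \<le> B"
    "f u' = A \<and> f v' = B \<or> f u' = B \<and> f v' = A"
proof -
  have *: "\<exists>u' v'. u \<le> u' \<and> u' \<le> v' \<and> v' \<le> v \<and> (\<forall>x\<in>{u'..v'}. A \<le> f x \<and> f x \<le> B) \<and> f u' = A \<and> f v' = B"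
    if f: "continuous_on {u..v} f" and AB: "A < B" and "f u \<le> A" "B \<le> f v" for f :: "real \<Rightarrow> real" and A B
  proof -
    let ?P = "{u..v} \<inter> f -` {B..}"
    have "compact ?P" by (rule compact_Icc_preimage[OF f]) auto
    moreover have "v \<in> ?P" using that uv by auto
    ultimately obtain v' where v': "v' \<in> ?P" "\<And>x. x \<in> ?P \<Longrightarrow> v' \<le> x"
      using compact_attains_inf[of ?P] by blast
    have lt: "f x < B" if "u \<le> x" "x < v'" for x using v'(2)[of x] v'(1) that by force
    let ?Q = "{u..v'} \<inter> f -` {..A}"
    have fc: "continuous_on {u..v'} f" by (rule continuous_on_subset[OF f]) (use v' in auto)
    have "compact ?Q" by (rule compact_Icc_preimage[OF fc]) auto
    moreover have "u \<in> ?Q" using that v' by auto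
    ultimately obtain u' where u': "u' \<in> ?Q" "\<And>x. x \<in> ?Q \<Longrightarrow> x \<le> u'"
      using compact_attains_sup[of ?Q] by blast
    have gt: "A < f x" if "u' < x" "x \<le> v'" for x using u'(2)[of x] u'(1) that by force
    have uv': "u' < v'" using u' v' AB by (cases "u' = v'") auto
    have fc': "continuous_on {u'..v'} f" by (rule continuous_on_subset[OF fc]) (use u' in auto)
    have "f v' = B"
    proof (rule ccontr)
      assume "f v' \<noteq> B"
      then obtain x where "u' \<le> x" "x \<le> v'" "f x = B"
        using IVT'[of f u' B v'] fc' uv' u' v' AB by auto
      then show False using lt[of x] u' \<open>f v' \<noteq> B\<close> by (cases "x = v'") auto
    qed
    moreover have "f u' = A"
    proof (rule ccontr)
      assume "f u' \<noteq> A"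
      then obtain x where "u' \<le> x" "x \<le> v'" "f x = A"
        using IVT'[of f u' A v'] fc' uv' u' v' AB by auto
      then show False using gt[of x] u' \<open>f u' \<noteq> A\<close> by (cases "x = u'") auto
    qed
    moreover have "A \<le> f x \<and> f x \<le> B" if "x \<in> {u'..v'}" for x
      using lt[of x] gt[of x] that u' calculation AB by (cases "x = u'"; cases "x = v'") (auto simp: less_imp_le)
    ultimately show ?thesis using u' v' uv' by (intro exI[of _ u'] exI[of _ v']) auto
  qed
  show thesis
  proof (cases "f u \<le> A \<and> B \<le> f v")
    case True
    then show ?thesis using *[OF f AB] that by metis
  next
    case False
    have "continuous_on {u..v} (\<lambda>x. - f x)" by (intro continuous_intros f)
    from *[OF this, of "- B" "- A"] False ends AB
    show ?thesis using that by (smt (verit) atLeastAtMost_iff)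
  qed
qed

text \<open>The time of the \<open>k\<close>-th axis crossing of an orbit that starts in the first quadrant, for \<open>k \<ge> 1\<close>; \<open>hit 0\<close>
is the start. After each crossing the picture is rotated, so that the orbit is again in the first quadrant.\<close>

fun hit :: "nat \<Rightarrow> (real \<Rightarrow> real) \<Rightarrow> (real \<Rightarrow> real) \<Rightarrow> real \<times> real \<Rightarrow> real" where
  "hit 0 h f p = 0"
| "hit (Suc k) h f p =
     exit_time h f p + hit k f (flip h) (rot (flow (field h f) p (exit_time h f p)))"

text \<open>The time that the orbit of energy \<open>c\<close> spends in the \<open>k\<close>-th quadrant, counted clockwise from
quadrant I as number \<open>0\<close>.\<close>

fun quarter :: "nat \<Rightarrow> (real \<Rightarrow> real) \<Rightarrow> (real \<Rightarrow> real) \<Rightarrow> (real \<Rightarrow> real) \<Rightarrow> (real \<Rightarrow> real) \<Rightarrow> real \<Rightarrow> real" where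
  "quarter 0 h f H F c = exit_time h f (0, the_inv_into {0..} H c)"
| "quarter (Suc k) h f H F c = quarter k f (flip h) F (\<lambda>x. H (- x)) c"

context planar
begin

lemma R_nonneg: "0 < C \<Longrightarrow> 0 \<le> R"
  using H_proper[of 0] H_0 by simp

lemma level_point:
  assumes "0 < c" "c \<le> C"
  obtains y where "y > 0" "H y = c" "the_inv_into {0..} H c = y"
proof -
  have "H (R + 1) > C" using H_proper[of "R + 1"] R_nonneg assms by force
  then obtain y where y: "0 \<le> y" "H y = c"
    using IVT'[of H 0 c "R + 1"] H_0 assms R_nonneg H_continuous by auto
  then have "y > 0" using assms H_0 by (cases "y = 0") auto
  moreover have "the_inv_into {0..} H c = y"
    by (rule the_inv_into_f_eq) (use y H_inj in \<open>auto simp: inj_on_def\<close>)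
  ultimately show thesis using that y by auto
qed

text \<open>In the closed first quadrant an energy level is a graph over the \<open>x\<close>-axis and \<open>x\<close> increases along the
orbit; by the intermediate value theorem the orbit of \<open>p\<close> passes through every point further right.\<close>

lemma sector_orbit:
  assumes p: "p \<in> sector H F C" and q: "q \<in> sector H F C"
    and e: "energy H F p = energy H F q" and le: "fst p \<le> fst q"
  shows "\<exists>s\<ge>0. s \<le> exit_time h f p \<and> flow V p s = q"
proof -
  let ?B = "exit_time h f p"
  have pD: "p \<in> D" using p by (auto simp: sector_def)
  note B = exit_time[OF p]
  have "F (X p ?B) = energy H F q"
    using flow_energy[OF pD B(1)] B(2) H_0 e by (simp add: energy_def)
  then have "F (fst q) \<le> F (X p ?B)" using H_nonneg[of "snd q"] by (simp add: energy_def)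
  then have "fst q \<le> X p ?B" using F_mono[of "X p ?B" "fst q"] exit_X_pos[OF p] by force
  then obtain s where s: "0 \<le> s" "s \<le> ?B" "X p s = fst q"
    using IVT'[of "X p" 0 "fst q" ?B] le pD B(1) continuous_on_subset[OF flow_continuous(1)[OF pD], of "{0..?B}"] by auto
  have "H (Y p s) = H (snd q)" using flow_energy[OF pD s(1)] e s(3) by (simp add: energy_def)
  then have "Y p s = snd q"
    using H_inj Y_nonneg_in_sector[OF p s(1,2)] q by (auto simp: sector_def)
  then show ?thesis using s by (intro exI[of _ s]) (auto simp: prod_eq_iff)
qed

lemma exit_time_pos:
  assumes p: "p \<in> sector H F C" and "fst p = 0" shows "0 < exit_time h f p"
  using exit_X_pos[OF p] exit_time(1)[OF p] assms(2) p by (cases "exit_time h f p = 0") (auto simp: sector_def)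

lemma level_point_sector:
  assumes "0 < c" "c \<le> C"
  shows "(0, the_inv_into {0..} H c) \<in> sector H F C" "energy H F (0, the_inv_into {0..} H c) = c"
proof -
  obtain y where "y > 0" "H y = c" "the_inv_into {0..} H c = y" using level_point[OF assms] by blast
  then show "(0, the_inv_into {0..} H c) \<in> sector H F C" "energy H F (0, the_inv_into {0..} H c) = c"
    using assms F_0 by (auto simp: sector_def region_def energy_def)
qed

text \<open>The orbit that starts on the positive \<open>y\<close>-axis passes through \<open>p\<close>, and its remaining time from there
is the exit time of \<open>p\<close>.\<close>

lemma exit_time_le_quarter:
  assumes p: "p \<in> sector H F C"
  shows "exit_time h f p \<le> quarter 0 h f H F (energy H F p)"
    and "fst p = 0 \<Longrightarrow> exit_time h f p = quarter 0 h f H F (energy H F p)"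
proof -
  define c where "c = energy H F p"
  have c: "0 < c" "c \<le> C" using p by (auto simp: c_def sector_def region_def)
  define q :: "real \<times> real" where "q = (0, the_inv_into {0..} H c)"
  have q: "q \<in> sector H F C" "energy H F q = c" unfolding q_def using level_point_sector[OF c] by auto
  obtain s where s: "s \<ge> 0" "s \<le> exit_time h f q" "flow V q s = p"
    using sector_orbit[OF q(1) p] p q(2) by (auto simp: c_def q_def sector_def)
  have 1: "exit_time h f p = exit_time h f q - s" using exit_time_after[OF q(1) s(1,2)] s by simp
  then show "exit_time h f p \<le> quarter 0 h f H F (energy H F p)" using s by (simp add: q_def c_def)
  assume "fst p = 0"
  then have "s = 0" using X_pos_in_sector[OF q(1), of s] s by fastforce
  then show "exit_time h f p = quarter 0 h f H F (energy H F p)" using 1 by (simp add: q_def c_def)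
qed

lemma next_sector:
  assumes p: "p \<in> sector H F C"
  shows "rot (flow V p (exit_time h f p)) \<in> sector F (\<lambda>x. H (- x)) C"
    "fst (rot (flow V p (exit_time h f p))) = 0"
    "energy F (\<lambda>x. H (- x)) (rot (flow V p (exit_time h f p))) = energy H F p"
proof -
  let ?q = "flow V p (exit_time h f p)"
  have q: "?q \<in> sector H F C" using flow_in_sector[OF p, of "exit_time h f p"] exit_time[OF p] by auto
  have y: "snd ?q = 0" using exit_time(2)[OF p] .
  show 1: "fst (rot ?q) = 0" by (simp add: rot_def y)
  have "snd (rot ?q) = fst ?q" by (simp add: rot_def)
  then show "rot ?q \<in> sector F (\<lambda>x. H (- x)) C" using q 1 by (simp add: sector_def)
  show "energy F (\<lambda>x. H (- x)) (rot ?q) = energy H F p"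
    using flow_energy[of p "exit_time h f p"] exit_time(1)[OF p] p by (simp add: sector_def)
qed

end

lemma hit_from_axis:
  assumes "planar h f H F C M R" "p \<in> sector H F C" "fst p = 0"
  shows "hit k h f p = (\<Sum>j<k. quarter j h f H F (energy H F p))"
  using assms
proof (induction k arbitrary: h f H F p)
  case (Suc k)
  interpret planar h f H F C M R by fact
  show ?case
    using Suc.IH[OF rotated next_sector(1,2)[OF Suc.prems(2)]] exit_time_le_quarter(2)[OF Suc.prems(2,3)]
      next_sector(3)[OF Suc.prems(2)]
    by (simp add: sum.lessThan_Suc_shift del: sum.lessThan_Suc)
qed simp

lemma hit_Suc_sum:
  assumes "planar h f H F C M R" "p \<in> sector H F C"
  shows "hit (Suc k) h f p = exit_time h f p + (\<Sum>j<k. quarter (Suc j) h f H F (energy H F p))"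
proof -
  interpret planar h f H F C M R by fact
  show ?thesis
    using hit_from_axis[OF rotated next_sector(1,2)[OF assms(2)]] next_sector(3)[OF assms(2)] by simp
qed

lemma hit_continuous:
  assumes "planar h f H F C M R"
  shows "continuous_on (sector H F C) (hit k h f)"
  using assms
proof (induction k arbitrary: h f H F)
  case (Suc k)
  interpret planar h f H F C M R by fact
  have 1: "continuous_on (sector H F C) (\<lambda>p. rot (flow V p (exit_time h f p)))"
    by (intro continuous_intros continuous_on_flow exit_time_continuous exit_time) (auto simp: sector_def continuous_on_id)
  show ?case
    by (simp, intro continuous_intros exit_time_continuous continuous_on_compose2[OF Suc.IH[OF rotated] 1])
      (auto intro: next_sector)
qed (simp add: continuous_on_const)

lemma hit_nonneg: "planar h f H F C M R \<Longrightarrow> p \<in> sector H F C \<Longrightarrow> 0 \<le> hit k h f p"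
proof (induction k arbitrary: h f H F p)
  case (Suc k)
  interpret planar h f H F C M R by fact
  show ?case using Suc.IH[OF rotated next_sector(1)[OF Suc.prems(2)]] exit_time(1)[OF Suc.prems(2)] by simp
qed simp

text \<open>The first crossing may happen at time \<open>0\<close>, namely for \<open>p\<close> on the \<open>x\<close>-axis; all later crossings are
strictly separated.\<close>

lemma hit_less_Suc:
  assumes "planar h f H F C M R" "p \<in> sector H F C" "k \<ge> 1 \<or> fst p = 0"
  shows "hit k h f p < hit (Suc k) h f p"
  using assms
proof (induction k arbitrary: h f H F p)
  case 0
  interpret planar h f H F C M R by fact
  show ?case using exit_time_pos[OF 0(2)] 0 by simp
next
  case (Suc k)
  interpret planar h f H F C M R by fact
  have "hit k f (flip h) (rot (flow V p (exit_time h f p))) < hit (Suc k) f (flip h) (rot (flow V p (exit_time h f p)))"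
    by (rule Suc.IH[OF rotated]) (use next_sector[OF Suc.prems(2)] in auto)
  then show ?case by simp
qed

lemma hit_strict_mono:
  assumes "planar h f H F C M R" "p \<in> sector H F C" "1 \<le> k" "k < l"
  shows "hit k h f p < hit l h f p"
  using assms(4,3) by (induction k l rule: less_Suc_induct) (use hit_less_Suc[OF assms(1,2)] in auto)

lemma hit_mono:
  assumes "planar h f H F C M R" "p \<in> sector H F C" "k \<le> l"
  shows "hit k h f p \<le> hit l h f p"
  using hit_strict_mono[OF assms(1,2), of k l] hit_nonneg[OF assms(1,2), of l] assms(3)
  by (cases "k = 0"; cases "k = l") (auto simp: less_imp_le)

declare hit.simps(2) [simp del]

text \<open>Between two crossings the rotated orbit is in the first quadrant and meets its boundary only at the
crossings themselves. For \<open>k = 0\<close> the orbit may start off the \<open>y\<close>-axis, which is why the last clause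
carries a condition.\<close>

lemma position_between_hits:
  assumes "planar h f H F C M R" "p \<in> sector H F C" "hit k h f p \<le> u" "u \<le> hit (Suc k) h f p"
  shows "0 \<le> fst ((rot ^^ k) (flow (field h f) p u)) \<and> 0 \<le> snd ((rot ^^ k) (flow (field h f) p u)) \<and>
    (snd ((rot ^^ k) (flow (field h f) p u)) = 0 \<longleftrightarrow> u = hit (Suc k) h f p) \<and>
    (fst ((rot ^^ k) (flow (field h f) p u)) = 0 \<longrightarrow> u = hit k h f p) \<and>
    (k \<ge> 1 \<or> fst p = 0 \<longrightarrow> u = hit k h f p \<longrightarrow> fst ((rot ^^ k) (flow (field h f) p u)) = 0)"
  using assms
proof (induction k arbitrary: h f H F p u)
  case 0
  interpret planar h f H F C M R by fact
  note p = 0(2)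
  have hit1: "hit (Suc 0) h f p = exit_time h f p" by (simp add: hit.simps)
  then have u: "0 \<le> u" "u \<le> exit_time h f p" using 0 by auto
  have pD: "p \<in> D" using p by (auto simp: sector_def)
  show ?case
    using X_nonneg_in_sector[OF p u] Y_nonneg_in_sector[OF p u] exit_time(2,3)[OF p] u
      X_pos_in_sector[OF p, of u] pD unfolding hit1 by (cases "u = 0"; cases "u = exit_time h f p") force+
next
  case (Suc k)
  interpret planar h f H F C M R by fact
  note p = Suc.prems(2)
  have pD: "p \<in> D" using p by (auto simp: sector_def)
  let ?B = "exit_time h f p" and ?p = "rot (flow V p (exit_time h f p))"
  define w where "w = u - ?B"
  have w: "hit k f (flip h) ?p \<le> w" "w \<le> hit (Suc k) f (flip h) ?p" using Suc.prems by (auto simp: w_def hit.simps(2)[of _ h f p])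
  have w0: "0 \<le> w" using w hit_nonneg[OF rotated next_sector(1)[OF p], of k] by simp
  have fl: "flow (field f (flip h)) ?p w = rot (flow V p u)"
    using flow_rot[OF flow_in[OF pD exit_time(1)[OF p]] w0] flow_add[OF pD exit_time(1)[OF p] w0]
    by (simp add: w_def)
  have eqs: "u = hit (Suc (Suc k)) h f p \<longleftrightarrow> w = hit (Suc k) f (flip h) ?p"
    "u = hit (Suc k) h f p \<longleftrightarrow> w = hit k f (flip h) ?p" by (auto simp: w_def hit.simps(2)[of _ h f p])
  show ?case
    using Suc.IH[OF rotated next_sector(1)[OF p] w] next_sector(2)[OF p] unfolding fl eqs
    by (simp only: funpow_Suc_right o_def) blast
qed

lemma rot_funpow_zero:
  "(fst ((rot ^^ k) z) = 0 \<longleftrightarrow> (if even k then fst z = 0 else snd z = 0))"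
  "(snd ((rot ^^ k) z) = 0 \<longleftrightarrow> (if even k then snd z = 0 else fst z = 0))"
  by (induction k) (auto simp: rot_def)

lemma axis_crossings_between_hits:
  assumes "planar h f H F C M R" "p \<in> sector H F C" "hit k h f p \<le> u" "u \<le> hit (Suc k) h f p"
  shows "even k \<Longrightarrow> snd (flow (field h f) p u) = 0 \<longleftrightarrow> u = hit (Suc k) h f p"
    "even k \<Longrightarrow> fst (flow (field h f) p u) = 0 \<Longrightarrow> u = hit k h f p"
    "odd k \<Longrightarrow> fst (flow (field h f) p u) = 0 \<longleftrightarrow> u = hit (Suc k) h f p"
    "odd k \<Longrightarrow> snd (flow (field h f) p u) = 0 \<Longrightarrow> u = hit k h f p"
  using position_between_hits[OF assms] by (simp_all add: rot_funpow_zero)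

lemma hit_bracket:
  assumes "planar h f H F C M R" "p \<in> sector H F C" "0 \<le> u" "u \<le> hit (Suc N) h f p"
  obtains k where "k \<le> N" "hit k h f p \<le> u" "u \<le> hit (Suc k) h f p"
proof -
  have "\<exists>k\<le>N. hit k h f p \<le> u \<and> u \<le> hit (Suc k) h f p" using assms(4)
  proof (induction N)
    case 0 then show ?case using assms(3) by auto
  next
    case (Suc N)
    then show ?case by (metis le_SucI linear)
  qed
  then show thesis using that by blast
qed

text \<open>Zeroes of \<open>y\<close> are the crossings of odd number, zeroes of \<open>x\<close> those of even number. At a time between
the crossings \<open>2n + 1\<close> and \<open>2n + 2\<close> the crossings \<open>1, 3, \<dots>, 2n + 1\<close> have happened, a crossing at
either end of the time interval included.\<close>

lemma zeros_of_Y: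
  assumes "planar h f H F C M R" "p \<in> sector H F C"
    and t: "hit (2*n+1) h f p \<le> t" "t \<le> hit (2*n+2) h f p"
  shows "card {u\<in>{0..t}. snd (flow (field h f) p u) = 0} = n + 1"
proof -
  note m = hit_mono[OF assms(1,2)] and pos = axis_crossings_between_hits[OF assms(1,2)]
  have "{u\<in>{0..t}. snd (flow (field h f) p u) = 0} = (\<lambda>j. hit (2*j+1) h f p) ` {..n}" (is "?A = ?B")
  proof
    show "?A \<subseteq> ?B"
    proof
      fix u assume "u \<in> ?A"
      then have u: "0 \<le> u" "u \<le> t" "snd (flow (field h f) p u) = 0" by auto
      obtain k where k: "k \<le> 2*n+1" "hit k h f p \<le> u" "u \<le> hit (Suc k) h f p"
        using hit_bracket[OF assms(1,2) u(1), of "2*n+1"] u t by auto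
      show "u \<in> ?B"
      proof (cases "even k")
        case True
        then obtain j where j: "k = 2 * j" by blast
        have "u = hit (2 * j + 1) h f p" using pos(1)[OF k(2,3) True] u(3) j by simp
        then show ?thesis using k(1) j by auto
      next
        case False
        then obtain j where j: "k = 2 * j + 1" using oddE by blast
        have "u = hit (2 * j + 1) h f p" using pos(4)[OF k(2,3) False] u(3) j by simp
        then show ?thesis using k(1) j by auto
      qed
    qed
    show "?B \<subseteq> ?A"
    proof
      fix u assume "u \<in> ?B"
      then obtain j where j: "j \<le> n" "u = hit (2*j+1) h f p" by auto
      have "hit (2*j) h f p \<le> u" "u \<le> hit (Suc (2*j)) h f p" using m[of "2*j" "2*j+1"] j by auto
      from pos(1)[OF this] have "snd (flow (field h f) p u) = 0" using j(2) by simp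
      moreover have "u \<le> t" using m[of "2*j+1" "2*n+1"] j t by auto
      moreover have "0 \<le> u" using hit_nonneg[OF assms(1,2)] j by auto
      ultimately show "u \<in> ?A" by auto
    qed
  qed
  moreover have "inj_on (\<lambda>j. hit (2*j+1) h f p) {..n}"
  proof (rule linorder_inj_onI)
    show "hit (2*i+1) h f p \<noteq> hit (2*j+1) h f p" if "i < j" for i j
      using hit_strict_mono[OF assms(1,2), of "2*i+1" "2*j+1"] that by simp
  qed auto
  ultimately show ?thesis by (simp add: card_image)
qed

text \<open>Here both end times are excluded: the orbit may start on the \<open>y\<close>-axis, and it may arrive there with
crossing number \<open>2n + 2\<close>. What remains are the crossings \<open>2, 4, \<dots>, 2n\<close>.\<close>

lemma zeros_of_X:
  assumes "planar h f H F C M R" "p \<in> sector H F C"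
    and t: "hit (2*n+1) h f p \<le> t" "t \<le> hit (2*n+2) h f p"
  shows "card {u\<in>{0<..<t}. fst (flow (field h f) p u) = 0} = n"
proof -
  note m = hit_mono[OF assms(1,2)] and pos = axis_crossings_between_hits[OF assms(1,2)]
    and sm = hit_strict_mono[OF assms(1,2)]
  have "{u\<in>{0<..<t}. fst (flow (field h f) p u) = 0} = (\<lambda>j. hit (2*j+2) h f p) ` {..<n}" (is "?A = ?B")
  proof
    show "?A \<subseteq> ?B"
    proof
      fix u assume "u \<in> ?A"
      then have u: "0 < u" "u < t" "fst (flow (field h f) p u) = 0" by auto
      obtain k where k: "k \<le> 2*n+1" "hit k h f p \<le> u" "u \<le> hit (Suc k) h f p"
        using hit_bracket[OF assms(1,2), of u "2*n+1"] u t by auto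
      show "u \<in> ?B"
      proof (cases "even k")
        case True
        then obtain j where j: "k = 2 * j" by blast
        have "u = hit k h f p" using pos(2)[OF k(2,3) True] u(3) by simp
        moreover from this have "j \<noteq> 0" using u j by (intro notI) simp
        then obtain i where "j = Suc i" by (cases j) auto
        ultimately show ?thesis using j k(1) by auto
      next
        case False
        then obtain j where j: "k = 2 * j + 1" using oddE by blast
        have "u = hit (Suc k) h f p" using pos(3)[OF k(2,3) False] u(3) by simp
        then show ?thesis using j k(1) u t by (cases "j = n") auto
      qed
    qed
    show "?B \<subseteq> ?A"
    proof
      fix u assume "u \<in> ?B"
      then obtain j where j: "j < n" "u = hit (2*j+2) h f p" by auto
      have *: "hit (2*j+1) h f p \<le> u" "u \<le> hit (Suc (2*j+1)) h f p" using m[of "2*j+1" "2*j+2"] j by auto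
      from pos(3)[OF *] have "fst (flow (field h f) p u) = 0" using j(2) by simp
      moreover have "u < t" using sm[of "2*j+2" "2*n+1"] j t by auto
      moreover have "0 < u" using hit_nonneg[OF assms(1,2), of "2*j+1"] sm[of "2*j+1" "2*j+2"] j by auto
      ultimately show "u \<in> ?A" by auto
    qed
  qed
  moreover have "inj_on (\<lambda>j. hit (2*j+2) h f p) {..<n}"
  proof (rule linorder_inj_onI)
    show "hit (2*i+2) h f p \<noteq> hit (2*j+2) h f p" if "i < j" for i j
      using sm[of "2*i+2" "2*j+2"] that by simp
  qed auto
  ultimately show ?thesis by (simp add: card_image)
qed

lemma quarter_periodic: "quarter (k + 4) h f H F c = quarter k h f H F c"
  by (simp add: numeral_eq_Suc)

text \<open>Four consecutive quarters make up one period, wherever one starts to count.\<close>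

lemma quarter_sum_periods:
  "(\<Sum>j<k + 4 * n. quarter (Suc j) h f H F c) =
   (\<Sum>j<k. quarter (Suc j) h f H F c) + real n * (\<Sum>j<4. quarter j h f H F c)"
proof -
  let ?q = "\<lambda>j. quarter j h f H F c"
  have four: "?q j + ?q (j+1) + ?q (j+2) + ?q (j+3) = (\<Sum>j<4. ?q j)" for j
  proof (induction j)
    case 0 show ?case by (simp add: numeral_eq_Suc)
  next
    case (Suc j)
    then show ?case using quarter_periodic[of j h f H F c] by (simp add: eval_nat_numeral del: quarter.simps)
  qed
  show ?thesis
  proof (induction n)
    case (Suc n)
    have "(\<Sum>j<k + 4 * Suc n. ?q (Suc j)) = (\<Sum>j<k + 4 * n. ?q (Suc j)) +
       (?q (k + 4*n + 1) + ?q (k + 4*n + 1 + 1) + ?q (k + 4*n + 1 + 2) + ?q (k+4*n+1+3))"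
      by (simp add: eval_nat_numeral del: quarter.simps)
    also have "\<dots> = (\<Sum>j<k + 4 * n. ?q (Suc j)) + (\<Sum>j<4. ?q j)" by (simp only: four)
    finally show ?case using Suc by (simp add: algebra_simps)
  qed simp
qed

text \<open>The first crossing comes after a time between \<open>0\<close> and a full quarter. With the lower bound, the assumption
on \<open>d\<close> puts crossing number \<open>3 + 4\<alpha>\<close> after \<open>\<tau>\<close> at the end of energy \<open>d\<close>; with the upper bound, the
assumption on \<open>e\<close> puts crossing number \<open>2 + 4\<beta>\<close> before \<open>\<tau>\<close> at the other end. In between, \<open>\<tau>\<close> moves from before the \<open>N\<close>-th crossing to
after the next one.\<close>

lemma twist_crossing:
  fixes p :: "real \<Rightarrow> real \<times> real"
  assumes "planar h f H F C M R"
    and p: "continuous_on {u..v} p" "\<And>\<sigma>. \<sigma> \<in> {u..v} \<Longrightarrow> p \<sigma> \<in> sector H F C" and uv: "u \<le> v"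
    and ends: "energy H F (p u) = d \<and> energy H F (p v) = e \<or> energy H F (p u) = e \<and> energy H F (p v) = d"
    and d: "\<tau> < quarter 1 h f H F d + quarter 2 h f H F d + real \<alpha> * (\<Sum>j<4. quarter j h f H F d)"
    and e: "quarter 0 h f H F e + quarter 1 h f H F e + real \<beta> * (\<Sum>j<4. quarter j h f H F e) < \<tau>"
    and N: "3 + 4 * \<alpha> \<le> N" "N \<le> 4 * \<beta> + 1"
  obtains u' v' where "u \<le> u'" "u' \<le> v'" "v' \<le> v"
    "\<And>\<sigma>. \<sigma> \<in> {u'..v'} \<Longrightarrow> hit N h f (p \<sigma>) \<le> \<tau> \<and> \<tau> \<le> hit (Suc N) h f (p \<sigma>)"
    "\<tau> = hit N h f (p u') \<and> \<tau> = hit (Suc N) h f (p v') \<or> \<tau> = hit (Suc N) h f (p u') \<and> \<tau> = hit N h f (p v')"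
proof -
  interpret planar h f H F C M R by fact
  \<comment> \<open>the position of \<open>\<tau>\<close> between the crossings, normalised to \<open>[0, 1]\<close>\<close>
  define D where "D \<sigma> = (\<tau> - hit N h f (p \<sigma>)) / (hit (Suc N) h f (p \<sigma>) - hit N h f (p \<sigma>))" for \<sigma>
  have pos: "hit N h f (p \<sigma>) < hit (Suc N) h f (p \<sigma>)" if "\<sigma> \<in> {u..v}" for \<sigma>
    using hit_less_Suc[OF assms(1) p(2)[OF that]] N by auto
  have c: "continuous_on {u..v} (\<lambda>\<sigma>. hit k h f (p \<sigma>))" for k
    by (rule continuous_on_compose2[OF hit_continuous[OF assms(1)] p(1)]) (use p in auto)
  have cont: "continuous_on {u..v} D"
  proof -
    have "hit (Suc N) h f (p \<sigma>) - hit N h f (p \<sigma>) \<noteq> 0" if "\<sigma> \<in> {u..v}" for \<sigma>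
      using pos[OF that] by simp
    with c show ?thesis unfolding D_def by (intro continuous_intros) auto
  qed
  have at_d: "D \<sigma> \<le> 0" if s: "\<sigma> \<in> {u..v}" "energy H F (p \<sigma>) = d" for \<sigma>
  proof -
    have "hit (3 + 4 * \<alpha>) h f (p \<sigma>) = exit_time h f (p \<sigma>) + (\<Sum>j<2 + 4 * \<alpha>. quarter (Suc j) h f H F d)"
      using hit_Suc_sum[OF assms(1) p(2)[OF s(1)], of "2 + 4 * \<alpha>"] s(2) by (simp add: numeral_eq_Suc)
    also have "\<dots> \<ge> \<tau>"
      unfolding quarter_sum_periods using d exit_time(1)[OF p(2)[OF s(1)]] by (simp add: numeral_eq_Suc)
    finally have "\<tau> \<le> hit N h f (p \<sigma>)" using hit_mono[OF assms(1) p(2)[OF s(1)] N(1)] by simp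
    then show ?thesis using pos[OF s(1)] by (auto simp: D_def divide_le_0_iff)
  qed
  have at_e: "1 \<le> D \<sigma>" if s: "\<sigma> \<in> {u..v}" "energy H F (p \<sigma>) = e" for \<sigma>
  proof -
    have "hit (2 + 4 * \<beta>) h f (p \<sigma>) = exit_time h f (p \<sigma>) + (\<Sum>j<1 + 4 * \<beta>. quarter (Suc j) h f H F e)"
      using hit_Suc_sum[OF assms(1) p(2)[OF s(1)], of "1 + 4 * \<beta>"] s(2) by (simp add: numeral_eq_Suc)
    also have "\<dots> \<le> \<tau>"
      unfolding quarter_sum_periods using e exit_time_le_quarter(1)[OF p(2)[OF s(1)]] s(2)
      by (simp del: quarter.simps add: lessThan_Suc eval_nat_numeral)
    finally have "hit (Suc N) h f (p \<sigma>) \<le> \<tau>" using hit_mono[OF assms(1) p(2)[OF s(1)], of "Suc N" "2 + 4*\<beta>"] N by simp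
    then show ?thesis using pos[OF s(1)] by (simp add: D_def le_divide_eq del: hit.simps)
  qed
  have "D u \<le> 0 \<and> 1 \<le> D v \<or> 1 \<le> D u \<and> D v \<le> 0" using ends at_d at_e uv by auto
  then obtain u' v' where uv': "u \<le> u'" "u' \<le> v'" "v' \<le> v"
    "\<And>x. x \<in> {u'..v'} \<Longrightarrow> 0 \<le> D x \<and> D x \<le> 1" "D u' = 0 \<and> D v' = 1 \<or> D u' = 1 \<and> D v' = 0"
    using crossing_subinterval[OF cont uv, of 0 1] by (metis zero_less_one)
  have conv: "(0 \<le> D x \<longleftrightarrow> hit N h f (p x) \<le> \<tau>) \<and> (D x \<le> 1 \<longleftrightarrow> \<tau> \<le> hit (Suc N) h f (p x)) \<and>
      (D x = 0 \<longleftrightarrow> \<tau> = hit N h f (p x)) \<and> (D x = 1 \<longleftrightarrow> \<tau> = hit (Suc N) h f (p x))" if "x \<in> {u'..v'}" for x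
    using pos[of x] that uv' by (auto simp: D_def zero_le_divide_iff divide_le_eq simp del: hit.simps)
  show thesis
    by (rule that[OF uv'(1-3)]) (use uv'(2,4,5) conv[of u'] conv[of v'] conv in auto)
qed

section \<open>Paths across a quadrant\<close>

lemma sector_fst_snd_pos: "planar h f H F C M R \<Longrightarrow> p \<in> sector H F C \<Longrightarrow> 0 < fst p + snd p"
proof -
  assume pl: "planar h f H F C M R" and p: "p \<in> sector H F C"
  interpret planar h f H F C M R by fact
  have "p \<noteq> 0" using p region_iff by (auto simp: sector_def)
  then show "0 < fst p + snd p" using p by (cases p) (auto simp: sector_def zero_prod_def)
qed

text \<open>The energy is strictly increasing along rays from the origin, so in a quadrant the direction and the energy
are coordinates.\<close>

lemma sector_eqI:
  assumes "planar h f H F C M R" and p: "p \<in> sector H F C" and q: "q \<in> sector H F C"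
    and r: "fst p / (fst p + snd p) = fst q / (fst q + snd q)" and e: "energy H F p = energy H F q"
  shows "p = q"
proof -
  interpret planar h f H F C M R by fact
  have le: False if p: "p \<in> sector H F C" and q: "q \<in> sector H F C" and r: "fst p * snd q = fst q * snd p"
    and e: "energy H F p = energy H F q" and less: "fst p < fst q" for p q
  proof -
    have nn: "0 \<le> fst p" "0 \<le> snd p" "0 \<le> snd q" using p q by (auto simp: sector_def)
    have "fst q * snd p \<le> fst q * snd q" using r mult_right_mono[of "fst p" "fst q" "snd q"] less nn by simp
    then have "snd p \<le> snd q" using less nn by simp
    then have "H (snd p) \<le> H (snd q)" using H_mono[of "snd p" "snd q"] nn by (cases "snd p = snd q") auto
    then show False using F_mono[of "fst p" "fst q"] nn less e by (simp add: energy_def)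
  qed
  have "fst p * (fst q + snd q) = fst q * (fst p + snd p)"
    using r sector_fst_snd_pos[OF assms(1)] p q by (simp add: frac_eq_eq less_imp_neq[symmetric])
  then have r': "fst p * snd q = fst q * snd p" by (simp add: algebra_simps)
  have "fst p = fst q"
    using le[OF p q r' e] le[OF q p r'[symmetric] e[symmetric]] by (metis linorder_neqE_linordered_idom)
  moreover from this have "snd p = snd q" using e H_inj p q by (auto simp: energy_def sector_def)
  ultimately show ?thesis by (simp add: prod_eq_iff)
qed

text \<open>In the coordinates direction and energy the part of a quadrant between two energy levels is a rectangle.
The path \<open>w\<close> joins its vertical sides and \<open>\<gamma>\<close> its horizontal sides, so Fashoda's theorem applies.\<close>

lemma sector_paths_meet:
  fixes w \<gamma> :: "real \<Rightarrow> real \<times> real"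
  assumes "planar h f H F C M R"
    and w: "continuous_on {u..v} w" "u \<le> v" "\<And>\<sigma>. \<sigma> \<in> {u..v} \<Longrightarrow> w \<sigma> \<in> sector H F C \<and> energy H F (w \<sigma>) \<in> {c1..c2}"
      "fst (w u) = 0 \<and> snd (w v) = 0 \<or> snd (w u) = 0 \<and> fst (w v) = 0"
    and \<gamma>: "path \<gamma>" "\<And>s. s \<in> {0..1} \<Longrightarrow> \<gamma> s \<in> sector H F C \<and> energy H F (\<gamma> s) \<in> {c1..c2}"
      "energy H F (pathstart \<gamma>) = c1" "energy H F (pathfinish \<gamma>) = c2"
  obtains \<sigma> s where "\<sigma> \<in> {u..v}" "s \<in> {0..1}" "w \<sigma> = \<gamma> s"
proof -
  note meet = that
  interpret planar h f H F C M R by fact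
  define \<rho> where "\<rho> p = fst p / (fst p + snd p)" for p :: "real \<times> real"
  define A :: "real \<times> real \<Rightarrow> real^2" where "A p = (\<chi> i. if i = 1 then \<rho> p else energy H F p)" for p
  have A: "A p $ 1 = \<rho> p" "A p $ 2 = energy H F p" for p by (simp_all add: A_def)
  have pos: "0 < fst p + snd p" if "p \<in> sector H F C" for p using sector_fst_snd_pos[OF assms(1) that] .
  have ne: "fst p + snd p \<noteq> 0" if "p \<in> sector H F C" for p using pos[OF that] by simp
  have cont: "continuous_on S (\<lambda>x. A (q x))" if "continuous_on S q" "\<And>x. x \<in> S \<Longrightarrow> q x \<in> sector H F C" for S and q :: "real \<Rightarrow> _"
  proof -
    have 1: "continuous_on S (\<lambda>x. \<rho> (q x))" unfolding \<rho>_def using that ne by (intro continuous_intros) auto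
    have "continuous_on S (\<lambda>x. if i = 1 then \<rho> (q x) else energy H F (q x))" for i :: 2
      using 1 energy_continuous[OF that(1)] by (cases "i = 1") auto
    then show ?thesis unfolding A_def by (intro continuous_on_vec_lambda)
  qed
  define a b :: "real^2" where "a = (\<chi> i. if i = 1 then 0 else c1)" and "b = (\<chi> i. if i = 1 then 1 else c2)"
  have ab: "a $ 1 = 0" "a $ 2 = c1" "b $ 1 = 1" "b $ 2 = c2" by (simp_all add: a_def b_def)
  have box: "A p \<in> cbox a b" if "p \<in> sector H F C" "energy H F p \<in> {c1..c2}" for p
    using that pos[OF that(1)] by (auto simp: mem_box_cart forall_2 A ab \<rho>_def sector_def divide_le_eq zero_le_divide_iff)
  have main: thesis if lin: "continuous_on {0..1} l" "l ` {0..1} \<subseteq> {u..v}" "fst (w (l 0)) = 0" "snd (w (l 1)) = 0"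
    for l :: "real \<Rightarrow> real"
  proof -
    have "continuous_on {0..1} (\<lambda>t. w (l t))"
      by (rule continuous_on_compose2[OF w(1) lin(1)]) (use lin in auto)
    then have 1: "path (\<lambda>t. A (w (l t)))" unfolding path_def by (rule cont) (use w(3) lin in blast)
    have 2: "path (\<lambda>t. A (\<gamma> t))" using \<gamma> unfolding path_def by (intro cont) auto
    have "l 0 \<in> {u..v}" "l 1 \<in> {u..v}" using lin(2) by (auto simp: image_subset_iff)
    then have l01: "w (l 0) \<in> sector H F C" "w (l 1) \<in> sector H F C" using w(3) by auto
    have e: "pathstart (\<lambda>t. A (w (l t))) $ 1 = a $ 1" "pathfinish (\<lambda>t. A (w (l t))) $ 1 = b $ 1"
      using lin(3,4) l01 ne[OF l01(2)] by (auto simp: pathstart_def pathfinish_def A ab \<rho>_def)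
    have e': "pathstart (\<lambda>t. A (\<gamma> t)) $ 2 = a $ 2" "pathfinish (\<lambda>t. A (\<gamma> t)) $ 2 = b $ 2"
      using \<gamma> by (auto simp: pathstart_def pathfinish_def A ab)
    have i: "path_image (\<lambda>t. A (w (l t))) \<subseteq> cbox a b" "path_image (\<lambda>t. A (\<gamma> t)) \<subseteq> cbox a b"
      unfolding path_image_def using w(3) lin(2) \<gamma>(2) by (auto intro!: box)
    obtain z where "z \<in> path_image (\<lambda>t. A (w (l t)))" "z \<in> path_image (\<lambda>t. A (\<gamma> t))"
      by (rule fashoda[OF 1 2 i e e'])
    then obtain t s where ts: "t \<in> {0..1}" "s \<in> {0..1}" "A (w (l t)) = A (\<gamma> s)" unfolding path_image_def by auto
    have lt: "l t \<in> {u..v}" using lin(2) ts(1) by blast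
    have "w (l t) = \<gamma> s"
    proof (rule sector_eqI[OF assms(1)])
      show "fst (w (l t)) / (fst (w (l t)) + snd (w (l t))) = fst (\<gamma> s) / (fst (\<gamma> s) + snd (\<gamma> s))"
        "energy H F (w (l t)) = energy H F (\<gamma> s)"
        using arg_cong[OF ts(3), of "\<lambda>x. x $ 1"] arg_cong[OF ts(3), of "\<lambda>x. x $ 2"] by (simp_all add: A \<rho>_def)
    qed (use w(3)[OF lt] \<gamma>(2)[OF ts(2)] in auto)
    then show thesis by (rule meet[OF lt ts(2)])
  qed
  have r: "u \<le> u + (v - u) * t" "u + (v - u) * t \<le> v" "u \<le> v - (v - u) * t" "v - (v - u) * t \<le> v"
    if "t \<in> {0..1}" for t
  proof -
    have "0 \<le> (v - u) * t" "(v - u) * t \<le> (v - u) * 1" using that w(2) by (intro mult_nonneg_nonneg mult_left_mono; simp)+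
    then show "u \<le> u + (v - u) * t" "u + (v - u) * t \<le> v" "u \<le> v - (v - u) * t" "v - (v - u) * t \<le> v" by simp_all
  qed
  show thesis
    using w(4)
  proof
    assume *: "fst (w u) = 0 \<and> snd (w v) = 0"
    show thesis
    proof (rule main)
      show "continuous_on {0..1} (\<lambda>t. u + (v - u) * t)" by (intro continuous_intros)
      show "(\<lambda>t. u + (v - u) * t) ` {0..1} \<subseteq> {u..v}" using r(1,2) by (simp add: image_subset_iff)
    qed (use * in simp_all)
  next
    assume *: "snd (w u) = 0 \<and> fst (w v) = 0"
    show thesis
    proof (rule main)
      show "continuous_on {0..1} (\<lambda>t. v - (v - u) * t)" by (intro continuous_intros)
      show "(\<lambda>t. v - (v - u) * t) ` {0..1} \<subseteq> {u..v}" using r(3,4) by (simp add: image_subset_iff)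
    qed (use * in simp_all)
  qed
qed

section \<open>Crossing the upper half plane\<close>

text \<open>
Three quarter turns carry quadrant II to quadrant I; the second crossing from there is the arrival at the
positive \<open>x\<close>-axis after the passage through quadrants II and I.\<close>

definition upper_exit :: "(real \<Rightarrow> real) \<Rightarrow> (real \<Rightarrow> real) \<Rightarrow> real \<times> real \<Rightarrow> real" where
  "upper_exit h f p = hit 2 (flip f) h (rot (rot (rot p)))"

definition upper_left :: "(real \<Rightarrow> real) \<Rightarrow> (real \<Rightarrow> real) \<Rightarrow> real \<Rightarrow> (real \<times> real) set" where
  "upper_left H F C = {p \<in> region H F C. fst p \<le> 0 \<and> 0 < snd p}"

context planar
begin

lemma rotated3: "planar (flip f) h (\<lambda>x. F (- x)) H C M R"
  using planar_rot[OF planar_rot[OF rotated]] by simp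

lemma rot3_sector: "p \<in> upper_left H F C \<Longrightarrow> rot (rot (rot p)) \<in> sector (\<lambda>x. F (- x)) H C"
  by (auto simp: upper_left_def sector_def region_def energy_def rot_def)

lemma flow_rot3:
  assumes "p \<in> D" "0 \<le> t"
  shows "flow (field (flip f) h) (rot (rot (rot p))) t = rot (rot (rot (flow V p t)))"
proof -
  interpret r1: planar f "flip h" F "\<lambda>x. H (- x)" C M R by (rule rotated)
  interpret r2: planar "flip h" "flip f" "\<lambda>x. H (- x)" "\<lambda>x. F (- x)" C M R by (rule r1.rotated)
  have 1: "rot p \<in> region F (\<lambda>x. H (- x)) C" using assms by simp
  then have "rot (rot p) \<in> region (\<lambda>x. H (- x)) (\<lambda>x. F (- x)) C" by simp
  from r2.flow_rot[OF this assms(2)] r1.flow_rot[OF 1 assms(2)] flow_rot[OF assms] show ?thesis by simp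
qed

lemma upper_exit:
  assumes p: "p \<in> upper_left H F C"
  shows "0 < upper_exit h f p" "Y p (upper_exit h f p) = 0" "0 < X p (upper_exit h f p)"
    "\<And>t. 0 \<le> t \<Longrightarrow> t < upper_exit h f p \<Longrightarrow> 0 < Y p t"
proof -
  note pl = rotated3
  let ?p = "rot (rot (rot p))" let ?h = "\<lambda>k. hit k (flip f) h ?p"
  note s = rot3_sector[OF p]
  have pD: "p \<in> D" using p by (auto simp: upper_left_def)
  have B: "upper_exit h f p = ?h 2" by (simp add: upper_exit_def)
  have h1: "0 \<le> ?h 1" "?h 1 < ?h 2" using hit_nonneg[OF pl s] hit_strict_mono[OF pl s, of 1 2] by auto
  then show pos: "0 < upper_exit h f p" by (simp add: B)
  have 0: "0 \<le> Y p t" "Y p t = 0 \<Longrightarrow> t = 0" if "0 \<le> t" "t \<le> ?h 1" for t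
    using position_between_hits[OF pl s, of 0 t] that flow_rot3[OF pD that(1)] by (auto simp: rot_def)
  have 1: "0 \<le> Y p t" "0 \<le> X p t" "Y p t = 0 \<longleftrightarrow> t = ?h 2" "X p t = 0 \<Longrightarrow> t = ?h 1" if "?h 1 \<le> t" "t \<le> ?h 2" for t
    using position_between_hits[OF pl s, of 1 t] that flow_rot3[OF pD, of t] h1(1) by (auto simp: numeral_2_eq_2)
  show "Y p (upper_exit h f p) = 0" using 1(3)[of "?h 2"] h1 by (simp add: B)
  show "0 < X p (upper_exit h f p)" using 1(2,4)[of "?h 2"] h1 by (force simp: B)
  show "0 < Y p t" if "0 \<le> t" "t < upper_exit h f p" for t
  proof (cases "t \<le> ?h 1")
    case True
    have "Y p t \<noteq> 0" using 0(2)[OF that(1) True] p pD by (auto simp: upper_left_def)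
    then show ?thesis using 0(1)[OF that(1) True] by simp
  next
    case False
    then show ?thesis using 1(1,3)[of t] that by (force simp: B)
  qed
qed

lemma upper_exit_continuous: "continuous_on (upper_left H F C) (upper_exit h f)"
  unfolding upper_exit_def
  by (rule continuous_on_compose2[OF hit_continuous[OF rotated3]])
    (auto intro!: continuous_intros continuous_on_id rot3_sector)

lemma X_mono_upper:
  assumes p: "p \<in> upper_left H F C" and "0 \<le> s" "s \<le> t" "t \<le> upper_exit h f p"
  shows "X p s \<le> X p t"
  using X_increasing[of p s t] upper_exit(4)[OF p] assms by (cases "s = t") (auto simp: upper_left_def less_imp_le)

lemma upper_orbit:
  assumes p: "p \<in> upper_left H F C" and q: "0 \<le> snd q"
    and e: "energy H F p = energy H F q" and le: "fst p \<le> fst q"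
  shows "\<exists>s\<ge>0. s \<le> upper_exit h f p \<and> flow V p s = q"
proof -
  let ?B = "upper_exit h f p"
  have pD: "p \<in> D" using p by (auto simp: upper_left_def)
  note B = upper_exit[OF p]
  have "F (X p ?B) = energy H F q"
    using flow_energy[OF pD, of ?B] B(1,2) H_0 e by (simp add: energy_def)
  then have "F (fst q) \<le> F (X p ?B)" using H_nonneg[of "snd q"] by (simp add: energy_def)
  then have "fst q \<le> X p ?B" using F_mono[of "X p ?B" "fst q"] B(3) by force
  then obtain s where s: "0 \<le> s" "s \<le> ?B" "X p s = fst q"
    using IVT'[of "X p" 0 "fst q" ?B] le pD B(1) continuous_on_subset[OF flow_continuous(1)[OF pD], of "{0..?B}"] by auto
  have "0 \<le> Y p s" using B(2) B(4)[of s] s by (cases "s = ?B") auto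
  moreover have "H (Y p s) = H (snd q)" using flow_energy[OF pD s(1)] e s(3) by (simp add: energy_def)
  ultimately have "Y p s = snd q" using H_inj q by auto
  then show ?thesis using s by (intro exI[of _ s]) (auto simp: prod_eq_iff)
qed

text \<open>The path \<open>p\<close> lies in quadrant II and its energy passes through the levels \<open>\<delta>\<close> and \<open>\<epsilon>\<close>. The function
\<open>energy H F + \<Phi> \<circ> x\<close> is the energy of the target annulus where \<open>x \<ge> 0\<close>. A point of energy \<open>\<epsilon>\<close>
starts to the right of \<open>q2\<close> and so after time \<open>\<sigma>0\<close> is to the right of the place that \<open>q2\<close> reaches after
the shorter time \<open>S2\<close>, on or beyond the outer boundary. In the same way a point of energy \<open>\<delta>\<close> has not
passed the place that \<open>q1\<close> reaches after time \<open>S1\<close>, on or inside the inner boundary. The image is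
continuous in between and crosses the annulus.\<close>

lemma transition_crossing:
  fixes \<Phi> :: "real \<Rightarrow> real" and p :: "real \<Rightarrow> real \<times> real"
  assumes p: "continuous_on {u..v} p" "\<And>\<sigma>. \<sigma> \<in> {u..v} \<Longrightarrow> p \<sigma> \<in> D \<and> fst (p \<sigma>) \<le> 0 \<and> 0 \<le> snd (p \<sigma>)" and uv: "u \<le> v"
    and de: "\<delta> \<noteq> \<epsilon>" "max \<delta> \<epsilon> \<le> c1" "c1 < c2"
    and ends: "energy H F (p u) \<le> min \<delta> \<epsilon> \<and> max \<delta> \<epsilon> \<le> energy H F (p v) \<or>
       max \<delta> \<epsilon> \<le> energy H F (p u) \<and> energy H F (p v) \<le> min \<delta> \<epsilon>"
    and above: "\<And>\<sigma>. \<sigma> \<in> {u..v} \<Longrightarrow> min \<delta> \<epsilon> \<le> energy H F (p \<sigma>) \<Longrightarrow> 0 < snd (p \<sigma>)"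
    and \<Phi>: "continuous_on UNIV \<Phi>" "strict_mono \<Phi>" "\<Phi> 0 = 0"
    and far: "\<And>x. 0 \<le> x \<Longrightarrow> min \<delta> \<epsilon> \<le> F x \<Longrightarrow> F x \<le> max \<delta> \<epsilon> \<Longrightarrow> c2 < F x + \<Phi> x"
    and \<epsilon>: "q2 \<in> upper_left H F C" "energy H F q2 = \<epsilon>" "0 \<le> S2" "S2 \<le> \<sigma>0" "c2 \<le> \<epsilon> + \<Phi> (X q2 S2)"
      "\<And>t. 0 \<le> t \<Longrightarrow> t \<le> S2 \<Longrightarrow> 0 < Y q2 t"
      "\<And>\<sigma>. \<sigma> \<in> {u..v} \<Longrightarrow> energy H F (p \<sigma>) = \<epsilon> \<Longrightarrow> fst q2 \<le> fst (p \<sigma>)"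
    and \<delta>: "q1 \<in> upper_left H F C" "energy H F q1 = \<delta>" "\<sigma>0 \<le> S1" "\<delta> + \<Phi> (X q1 S1) \<le> c1"
      "\<And>t. 0 \<le> t \<Longrightarrow> t \<le> S1 \<Longrightarrow> 0 < Y q1 t"
      "\<And>\<sigma>. \<sigma> \<in> {u..v} \<Longrightarrow> energy H F (p \<sigma>) = \<delta> \<Longrightarrow> fst (p \<sigma>) \<le> fst q1"
  obtains u' v' where "u \<le> u'" "u' \<le> v'" "v' \<le> v"
    "\<And>\<sigma>. \<sigma> \<in> {u'..v'} \<Longrightarrow> (\<forall>t\<in>{0..\<sigma>0}. 0 < Y (p \<sigma>) t) \<and> 0 \<le> X (p \<sigma>) \<sigma>0 \<and>
        energy H F (p \<sigma>) + \<Phi> (X (p \<sigma>) \<sigma>0) \<in> {c1..c2}"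
    "energy H F (p u') + \<Phi> (X (p u') \<sigma>0) = c1 \<and> energy H F (p v') + \<Phi> (X (p v') \<sigma>0) = c2 \<or>
     energy H F (p u') + \<Phi> (X (p u') \<sigma>0) = c2 \<and> energy H F (p v') + \<Phi> (X (p v') \<sigma>0) = c1"
proof -
  have s0: "0 \<le> \<sigma>0" using \<epsilon> by simp
  have "min \<delta> \<epsilon> < max \<delta> \<epsilon>" using de(1) by (auto simp: min_def max_def)
  from crossing_subinterval[OF energy_continuous[OF p(1)] uv this ends]
  obtain u1 v1 where uv1: "u \<le> u1" "u1 \<le> v1" "v1 \<le> v"
    "\<And>\<sigma>. \<sigma> \<in> {u1..v1} \<Longrightarrow> min \<delta> \<epsilon> \<le> energy H F (p \<sigma>) \<and> energy H F (p \<sigma>) \<le> max \<delta> \<epsilon>"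
    "energy H F (p u1) = min \<delta> \<epsilon> \<and> energy H F (p v1) = max \<delta> \<epsilon> \<or>
     energy H F (p u1) = max \<delta> \<epsilon> \<and> energy H F (p v1) = min \<delta> \<epsilon>" by metis
  have sub: "\<sigma> \<in> {u..v}" if "\<sigma> \<in> {u1..v1}" for \<sigma> using that uv1 by auto
  have ul: "p \<sigma> \<in> upper_left H F C" if "\<sigma> \<in> {u1..v1}" for \<sigma>
    using p(2)[OF sub[OF that]] above[OF sub[OF that]] uv1(4)[OF that] by (auto simp: upper_left_def)
  \<comment> \<open>the orbits are stopped when they leave the upper half plane;
    a stopped orbit is beyond the annulus by assumption \<open>far\<close>, hence is not in the final subpath\<close>
  define \<tau> where "\<tau> \<sigma> = min \<sigma>0 (upper_exit h f (p \<sigma>))" for \<sigma>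
  define A where "A \<sigma> = energy H F (p \<sigma>) + \<Phi> (X (p \<sigma>) (\<tau> \<sigma>))" for \<sigma>
  have pc: "continuous_on {u1..v1} p" by (rule continuous_on_subset[OF p(1)]) (use uv1 in auto)
  have \<tau>c: "continuous_on {u1..v1} \<tau>"
    unfolding \<tau>_def
    by (intro continuous_intros continuous_on_compose2[OF upper_exit_continuous pc]) (use ul in auto)
  have \<tau>0: "0 \<le> \<tau> \<sigma>" if "\<sigma> \<in> {u1..v1}" for \<sigma> using upper_exit(1)[OF ul[OF that]] s0 by (simp add: \<tau>_def)
  have "continuous_on {u1..v1} (\<lambda>\<sigma>. flow V (p \<sigma>) (\<tau> \<sigma>))"
    by (rule continuous_on_flow[OF pc \<tau>c]) (use ul \<tau>0 in \<open>auto simp: upper_left_def\<close>)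
  then have "continuous_on {u1..v1} (\<lambda>\<sigma>. \<Phi> (X (p \<sigma>) (\<tau> \<sigma>)))"
    by (intro continuous_on_compose2[OF \<Phi>(1)] continuous_on_fst) auto
  then have Ac: "continuous_on {u1..v1} A"
    unfolding A_def by (intro continuous_intros energy_continuous pc)
  have late: "c2 < A \<sigma>" if s: "\<sigma> \<in> {u1..v1}" and "upper_exit h f (p \<sigma>) \<le> \<sigma>0" for \<sigma>
  proof -
    note B = upper_exit[OF ul[OF s]]
    have "F (X (p \<sigma>) (upper_exit h f (p \<sigma>))) = energy H F (p \<sigma>)"
      using flow_energy[of "p \<sigma>" "upper_exit h f (p \<sigma>)"] B H_0 ul[OF s] by (simp add: energy_def upper_left_def)
    then show ?thesis
      using far[of "X (p \<sigma>) (upper_exit h f (p \<sigma>))"] B(3) uv1(4)[OF s] that by (simp add: A_def \<tau>_def min_absorb2)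
  qed
  have at_\<epsilon>: "c2 \<le> A \<sigma>" if s: "\<sigma> \<in> {u1..v1}" and en: "energy H F (p \<sigma>) = \<epsilon>" for \<sigma>
  proof (cases "upper_exit h f (p \<sigma>) \<le> \<sigma>0")
    case True then show ?thesis using late[OF s] by simp
  next
    case False
    note B = upper_exit[OF ul[OF s]] and Bq = upper_exit[OF \<epsilon>(1)]
    have qD: "q2 \<in> D" using \<epsilon>(1) by (auto simp: upper_left_def)
    have pD: "p \<sigma> \<in> D" using p(2)[OF sub[OF s]] by simp
    obtain r where r: "r \<ge> 0" "r \<le> upper_exit h f q2" "flow V q2 r = p \<sigma>"
      using upper_orbit[OF \<epsilon>(1), of "p \<sigma>"] p(2)[OF sub[OF s]] \<epsilon>(2,7) en sub[OF s] by auto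
    have "X q2 S2 \<le> X (p \<sigma>) \<sigma>0"
    proof (cases "S2 \<le> r")
      case True
      then have "X q2 S2 \<le> X q2 r" using X_mono_upper[OF \<epsilon>(1) \<epsilon>(3) True r(2)] by simp
      also have "\<dots> = X (p \<sigma>) 0" using r pD by simp
      also have "\<dots> \<le> X (p \<sigma>) \<sigma>0" using X_mono_upper[OF ul[OF s], of 0 \<sigma>0] False s0 by auto
      finally show ?thesis .
    next
      case less: False
      have "X q2 S2 = X (p \<sigma>) (S2 - r)" using flow_add[OF qD r(1), of "S2 - r"] r(3) less by simp
      also have "\<dots> \<le> X (p \<sigma>) \<sigma>0" using X_mono_upper[OF ul[OF s], of "S2 - r" \<sigma>0] False less r(1) \<epsilon>(4) by auto
      finally show ?thesis .
    qed
    then have "\<Phi> (X q2 S2) \<le> \<Phi> (X (p \<sigma>) \<sigma>0)" using \<Phi>(2) by (simp add: strict_mono_less_eq)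
    then show ?thesis using \<epsilon>(5) en False by (simp add: A_def \<tau>_def)
  qed
  have at_\<delta>: "A \<sigma> \<le> c1" if s: "\<sigma> \<in> {u1..v1}" and en: "energy H F (p \<sigma>) = \<delta>" for \<sigma>
  proof -
    note B = upper_exit[OF ul[OF s]]
    have pD: "p \<sigma> \<in> D" using p(2)[OF sub[OF s]] by simp
    have qD: "q1 \<in> D" "0 < snd q1" using \<delta>(1) by (auto simp: upper_left_def)
    obtain r where r: "r \<ge> 0" "r \<le> upper_exit h f (p \<sigma>)" "flow V (p \<sigma>) r = q1"
      using upper_orbit[OF ul[OF s], of q1] qD \<delta>(2,6) en sub[OF s] by auto
    have lt: "r + S1 < upper_exit h f (p \<sigma>)"
    proof (rule ccontr)
      assume "\<not> ?thesis"
      then have "0 < Y q1 (upper_exit h f (p \<sigma>) - r)" using \<delta>(5) r by auto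
      moreover have "Y q1 (upper_exit h f (p \<sigma>) - r) = Y (p \<sigma>) (upper_exit h f (p \<sigma>))"
        using flow_add[OF pD r(1), of "upper_exit h f (p \<sigma>) - r"] r by simp
      ultimately show False using B(2) by simp
    qed
    have "X (p \<sigma>) \<sigma>0 \<le> X (p \<sigma>) (r + S1)" using X_mono_upper[OF ul[OF s] s0, of "r + S1"] lt r \<delta>(3) by auto
    also have "\<dots> = X q1 S1" using flow_add[OF pD r(1), of S1] r(3) s0 \<delta>(3) by simp
    finally have "\<Phi> (X (p \<sigma>) \<sigma>0) \<le> \<Phi> (X q1 S1)" using \<Phi>(2) by (simp add: strict_mono_less_eq)
    moreover have "\<tau> \<sigma> = \<sigma>0" using lt r \<delta>(3) by (simp add: \<tau>_def)
    ultimately show ?thesis using \<delta>(4) en by (simp add: A_def)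
  qed
  have "{min \<delta> \<epsilon>, max \<delta> \<epsilon>} = {\<delta>, \<epsilon>}" by (auto simp: min_def max_def)
  then have "energy H F (p u1) = \<delta> \<and> energy H F (p v1) = \<epsilon> \<or> energy H F (p u1) = \<epsilon> \<and> energy H F (p v1) = \<delta>"
    using uv1(5) by (auto simp: min_def max_def split: if_splits)
  then have "A u1 \<le> c1 \<and> c2 \<le> A v1 \<or> c2 \<le> A u1 \<and> A v1 \<le> c1" using at_\<epsilon> at_\<delta> uv1(2) by auto
  from crossing_subinterval[OF Ac uv1(2) de(3) this]
  obtain u' v' where uv': "u1 \<le> u'" "u' \<le> v'" "v' \<le> v1" "\<And>\<sigma>. \<sigma> \<in> {u'..v'} \<Longrightarrow> c1 \<le> A \<sigma> \<and> A \<sigma> \<le> c2"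
    "A u' = c1 \<and> A v' = c2 \<or> A u' = c2 \<and> A v' = c1" by metis
  have in1: "\<sigma> \<in> {u1..v1}" if "\<sigma> \<in> {u'..v'}" for \<sigma> using that uv' by auto
  have early: "\<sigma>0 < upper_exit h f (p \<sigma>)" if "\<sigma> \<in> {u'..v'}" for \<sigma>
    using late[OF in1[OF that]] uv'(4)[OF that] by force
  then have A: "A \<sigma> = energy H F (p \<sigma>) + \<Phi> (X (p \<sigma>) \<sigma>0)" if "\<sigma> \<in> {u'..v'}" for \<sigma>
    using that by (simp add: A_def \<tau>_def min_absorb1 less_imp_le)
  show thesis
  proof (rule that[of u' v'])
    fix \<sigma> assume s: "\<sigma> \<in> {u'..v'}"
    \<comment> \<open>the energy is at most \<open>c1\<close> along the path, so only \<open>x \<ge> 0\<close> can lift the sum to the annulus\<close>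
    have "\<Phi> 0 \<le> \<Phi> (X (p \<sigma>) \<sigma>0)" using uv'(4)[OF s] A[OF s] uv1(4)[OF in1[OF s]] de(2) \<Phi>(3) by auto
    then have "0 \<le> X (p \<sigma>) \<sigma>0" using \<Phi>(2) by (simp add: strict_mono_less_eq)
    then show "(\<forall>t\<in>{0..\<sigma>0}. 0 < Y (p \<sigma>) t) \<and> 0 \<le> X (p \<sigma>) \<sigma>0 \<and>
        energy H F (p \<sigma>) + \<Phi> (X (p \<sigma>) \<sigma>0) \<in> {c1..c2}"
      using uv'(4)[OF s] A[OF s] upper_exit(4)[OF ul[OF in1[OF s]]] early[OF s] by auto
  qed (use uv' uv1 A[of u'] A[of v'] in auto)
qed

end

section \<open>Traversal times as integrals\<close>

text \<open>
Substitution \<open>u = x(t)\<close> in the time integral, where the speed is a function \<open>w\<close> of the position. The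
speed may vanish at the ends, so the integral may be improper. Continuity of \<open>w\<close> inside follows from
that of the speed and of the inverse of \<open>x\<close>.\<close>

lemma traversal_time_increasing:
  fixes x v w :: "real \<Rightarrow> real"
  assumes ab: "a < b" and xc: "continuous_on {a..b} x"
    and xd: "\<And>t. a < t \<Longrightarrow> t < b \<Longrightarrow> (x has_real_derivative v t) (at t)"
    and vpos: "\<And>t. a < t \<Longrightarrow> t < b \<Longrightarrow> 0 < v t" and vnn: "\<And>t. a \<le> t \<Longrightarrow> t \<le> b \<Longrightarrow> 0 \<le> v t"
    and vc: "\<And>t. a < t \<Longrightarrow> t < b \<Longrightarrow> isCont v t"
    and w: "\<And>t. a < t \<Longrightarrow> t < b \<Longrightarrow> w (x t) = v t"
  shows "(LBINT u=x a..x b. 1 / w u) = b - a"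
proof -
  have inc: "x s < x t" if "a \<le> s" "s < t" "t \<le> b" for s t
  proof (rule DERIV_pos_imp_increasing_open[OF that(2)])
    show "\<exists>y. (x has_real_derivative y) (at r) \<and> 0 < y" if "s < r" "r < t" for r
      using xd[of r] vpos[of r] that \<open>a \<le> s\<close> \<open>t \<le> b\<close> by auto
  qed (use that in \<open>auto intro: continuous_on_subset[OF xc]\<close>)
  have inj: "inj_on x {a<..<b}"
  proof (rule linorder_inj_onI)
    show "x s \<noteq> x t" if "s < t" "s \<in> {a<..<b}" "t \<in> {a<..<b}" for s t using inc[of s t] that by auto
  qed auto
  have "continuous_on {a<..<b} x" by (rule continuous_on_subset[OF xc]) auto
  from injective_into_1d_imp_open_map_UNIV[OF _ this inj order_refl]
  have op: "open (x ` {a<..<b})" by auto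
  define g where "g = the_inv_into {a<..<b} x"
  have g: "g (x t) = t" if "t \<in> {a<..<b}" for t unfolding g_def by (rule the_inv_into_f_f[OF inj that])
  have wc: "isCont w (x t)" if t: "a < t" "t < b" for t
  proof -
    define d where "d = min (t - a) (b - t) / 2"
    have d: "0 < d" using t by (simp add: d_def)
    have "d < t - a" "d < b - t" using t by (auto simp: d_def)
    then have d2: "a < z \<and> z < b" if "\<bar>z - t\<bar> \<le> d" for z using that by linarith
    have "isCont g (x t)"
      by (rule isCont_inverse_function[OF d]) (use d2 g xd in \<open>auto intro: DERIV_isCont\<close>)
    then have 1: "isCont (\<lambda>u. v (g u)) (x t)"
      by (rule isCont_o2) (use g t vc in auto)
    have "\<forall>\<^sub>F u in nhds (x t). u \<in> x ` {a<..<b}" using op t by (intro eventually_nhds_in_open) auto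
    then have "\<forall>\<^sub>F u in nhds (x t). v (g u) = w u" by (rule eventually_mono) (use g w in auto)
    from isCont_cong[OF this] show ?thesis using 1 by simp
  qed
  have lim_a: "((ereal \<circ> x \<circ> real_of_ereal) \<longlongrightarrow> ereal (x a)) (at_right (ereal a))"
    unfolding at_right_ereal filterlim_filtermap o_def real_of_ereal.simps
  proof (intro tendsto_intros)
    have "(x \<longlongrightarrow> x a) (at a within {a..b})" using xc ab by (simp add: continuous_on)
    then show "(x \<longlongrightarrow> x a) (at_right a)" using ab by (simp add: at_within_Icc_at_right)
  qed
  have lim_b: "((ereal \<circ> x \<circ> real_of_ereal) \<longlongrightarrow> ereal (x b)) (at_left (ereal b))"
    unfolding at_left_ereal filterlim_filtermap o_def real_of_ereal.simps
  proof (intro tendsto_intros)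
    have "(x \<longlongrightarrow> x b) (at b within {a..b})" using xc ab by (simp add: continuous_on)
    then show "(x \<longlongrightarrow> x b) (at_left b)" using ab by (simp add: at_within_Icc_at_left)
  qed
  have one: "1 / w (x t) * v t = 1" if "t \<in> einterval a b" for t
    using that w[of t] vpos[of t] by auto
  have int: "set_integrable lborel (einterval a b) (\<lambda>t. 1 / w (x t) * v t)"
  proof -
    have "set_integrable lborel (einterval a b) (\<lambda>t. 1 / w (x t) * v t) \<longleftrightarrow> set_integrable lborel (einterval a b) (\<lambda>_. 1::real)"
      by (rule set_integrable_cong[OF refl refl one])
    then show ?thesis using ab by (simp add: set_integrable_def)
  qed
  have "(LBINT u=x a..x b. 1 / w u) = (LBINT t=a..b. (1 / w (x t)) * v t)"
  proof (rule interval_integral_substitution_nonneg(2)[OF _ _ _ _ _ _ lim_a lim_b int])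
    fix t assume "ereal a < ereal t" "ereal t < ereal b"
    then have t: "a < t" "t < b" by auto
    show "(x has_real_derivative v t) (at t)" "isCont v t" using t xd vc by auto
    show "isCont (\<lambda>u. 1 / w u) (x t)"
      using wc[OF t] w[OF t] vpos[OF t] by (intro continuous_intros) auto
    show "0 \<le> 1 / w (x t)" using w[OF t] vpos[OF t] by simp
  qed (use ab vnn in auto)
  also have "\<dots> = (LBINT t=a..b. 1)"
  proof (rule interval_integral_cong)
    fix t assume "t \<in> einterval (min (ereal a) (ereal b)) (max (ereal a) (ereal b))"
    then have "t \<in> einterval a b" using ab by (simp add: min_def max_def)
    then show "1 / w (x t) * v t = 1" by (rule one)
  qed
  also have "\<dots> = b - a" using ab by simp
  finally show ?thesis .
qed

lemma traversal_time_decreasing: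
  fixes x v w :: "real \<Rightarrow> real"
  assumes ab: "a < b" and xc: "continuous_on {a..b} x"
    and xd: "\<And>t. a < t \<Longrightarrow> t < b \<Longrightarrow> (x has_real_derivative - v t) (at t)"
    and vpos: "\<And>t. a < t \<Longrightarrow> t < b \<Longrightarrow> 0 < v t" and vnn: "\<And>t. a \<le> t \<Longrightarrow> t \<le> b \<Longrightarrow> 0 \<le> v t"
    and vc: "\<And>t. a < t \<Longrightarrow> t < b \<Longrightarrow> isCont v t"
    and w: "\<And>t. a < t \<Longrightarrow> t < b \<Longrightarrow> w (x t) = v t"
  shows "(LBINT u=x b..x a. 1 / w u) = b - a"
proof -
  have "(LBINT u=x (- (- b))..x (- (- a)). 1 / w u) = - a - - b"
  proof (rule traversal_time_increasing[where x="\<lambda>t. x (- t)" and v="\<lambda>t. v (- t)"])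
    show "continuous_on {- b..- a} (\<lambda>t. x (- t))"
      by (rule continuous_on_compose2[OF xc]) (auto intro!: continuous_intros)
    show "((\<lambda>t. x (- t)) has_real_derivative v (- t)) (at t)" if "- b < t" "t < - a" for t
      using DERIV_chain2[OF xd[of "-t"] DERIV_minus[OF DERIV_ident]] that by simp
    show "isCont (\<lambda>t. v (- t)) t" if "- b < t" "t < - a" for t
      using isCont_o2[of t uminus v] vc[of "-t"] that by simp
  qed (use ab vpos vnn w in auto)
  then show ?thesis by simp
qed

section \<open>Primitives, and gluing of solutions\<close>

lemma primitive_deriv:
  assumes f: "continuous_on {a..b} f" and "a < x" "x < b" "a \<le> 0" "0 \<le> b"
  shows "(primitive f has_real_derivative f x) (at x)"
proof -
  have "((\<lambda>u. LBINT y=ereal 0..ereal u. f y) has_vector_derivative f x) (at x within {a..b})"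
    by (rule interval_integral_FTC2) (use assms in auto)
  then have "(primitive f has_real_derivative f x) (at x within {a..b})"
    by (simp add: primitive_def[abs_def] zero_ereal_def has_real_derivative_iff_has_vector_derivative)
  moreover have "at x within {a..b} = at x" using assms by (intro at_within_interior) auto
  ultimately show ?thesis by simp
qed

lemma primitive_deriv_UNIV:
  assumes "continuous_on UNIV f"
  shows "(primitive f has_real_derivative f x) (at x)"
  by (rule primitive_deriv[of "- \<bar>x\<bar> - 1" "\<bar>x\<bar> + 1"]) (use continuous_on_subset[OF assms] in auto)

lemma primitive_0 [simp]: "primitive f 0 = 0"
  by (simp add: primitive_def flip: zero_ereal_def)

lemma primitive_cong:
  assumes "\<And>u. min 0 x < u \<Longrightarrow> u < max 0 x \<Longrightarrow> f u = f' u"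
  shows "primitive f x = primitive f' x"
  unfolding primitive_def zero_ereal_def
  by (rule interval_integral_cong) (use assms in \<open>auto simp: min_def max_def split: if_splits\<close>)

lemma lipschitz_abs_continuous:
  assumes "\<And>s t. s \<in> {a..b} \<Longrightarrow> t \<in> {a..b} \<Longrightarrow> \<bar>f s - f t\<bar> \<le> K * \<bar>s - t\<bar>"
  shows "abs_continuous_on_Icc a b f"
  unfolding abs_continuous_on_Icc_def
proof (intro allI impI)
  fix \<epsilon> :: real assume e: "0 < \<epsilon>"
  define K' where "K' = \<bar>K\<bar> + 1"
  have K': "0 < K'" "K \<le> K'" by (auto simp: K'_def)
  show "\<exists>\<delta>>0. \<forall>(n::nat) u v.
        (\<forall>k<n. a \<le> u k \<and> u k \<le> v k \<and> v k \<le> b) \<and>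
        (\<forall>k<n. \<forall>l<n. k \<noteq> l \<longrightarrow> {u k<..<v k} \<inter> {u l<..<v l} = {}) \<and>
        (\<Sum>k<n. v k - u k) < \<delta> \<longrightarrow> (\<Sum>k<n. \<bar>f (v k) - f (u k)\<bar>) < \<epsilon>"
  proof (intro exI[of _ "\<epsilon> / K'"] conjI allI impI)
    show "0 < \<epsilon> / K'" using e K' by simp
    fix n :: nat and u v :: "nat \<Rightarrow> real"
    assume *: "(\<forall>k<n. a \<le> u k \<and> u k \<le> v k \<and> v k \<le> b) \<and>
        (\<forall>k<n. \<forall>l<n. k \<noteq> l \<longrightarrow> {u k<..<v k} \<inter> {u l<..<v l} = {}) \<and>
        (\<Sum>k<n. v k - u k) < \<epsilon> / K'"
    have "(\<Sum>k<n. \<bar>f (v k) - f (u k)\<bar>) \<le> (\<Sum>k<n. K' * (v k - u k))"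
    proof (rule sum_mono)
      fix k assume "k \<in> {..<n}"
      then have k: "a \<le> u k" "u k \<le> v k" "v k \<le> b" using * by auto
      have "\<bar>f (v k) - f (u k)\<bar> \<le> K * (v k - u k)" using assms[of "v k" "u k"] k by auto
      also have "\<dots> \<le> K' * (v k - u k)" using K' k by (intro mult_right_mono) auto
      finally show "\<bar>f (v k) - f (u k)\<bar> \<le> K' * (v k - u k)" .
    qed
    also have "\<dots> < \<epsilon>" using * K' by (simp add: sum_distrib_left[symmetric] pos_less_divide_eq mult.commute)
    finally show "(\<Sum>k<n. \<bar>f (v k) - f (u k)\<bar>) < \<epsilon>" .
  qed
qed

text \<open>A class of Caratheodory solutions that is closed under gluing by inspection: Lipschitz functions with
finitely many exceptional times, among them the times at which the weight jumps.\<close>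

definition seg_sol ::
  "(real \<Rightarrow> real) \<Rightarrow> ereal \<Rightarrow> ereal \<Rightarrow> (real \<Rightarrow> real) \<Rightarrow> real \<Rightarrow> (real \<Rightarrow> real)
   \<Rightarrow> real \<Rightarrow> real \<Rightarrow> (real \<Rightarrow> real) \<Rightarrow> (real \<Rightarrow> real) \<Rightarrow> bool" where
  "seg_sol h rm rp g lam w a b x y \<longleftrightarrow>
     (\<exists>K. \<forall>s\<in>{a..b}. \<forall>t\<in>{a..b}. \<bar>x s - x t\<bar> \<le> K * \<bar>s - t\<bar> \<and> \<bar>y s - y t\<bar> \<le> K * \<bar>s - t\<bar>) \<and>
     (\<forall>t\<in>{a..b}. y t \<in> open_interval rm rp) \<and>
     (\<exists>S. finite S \<and> (\<forall>t\<in>{a..b} - S. (x has_real_derivative h (y t)) (at t) \<and>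
        (y has_real_derivative (- lam * x t - w t * g (x t))) (at t)))"

lemma seg_solI:
  assumes "\<forall>s\<in>{a..b}. \<forall>t\<in>{a..b}. \<bar>x s - x t\<bar> \<le> K * \<bar>s - t\<bar> \<and> \<bar>y s - y t\<bar> \<le> K * \<bar>s - t\<bar>"
    and "\<forall>t\<in>{a..b}. y t \<in> open_interval rm rp" and "finite S"
    and "\<forall>t\<in>{a..b} - S. (x has_real_derivative h (y t)) (at t) \<and>
        (y has_real_derivative (- lam * x t - w t * g (x t))) (at t)"
  shows "seg_sol h rm rp g lam w a b x y"
  using assms unfolding seg_sol_def by (intro conjI exI[of _ K] exI[of _ S])

lemma derivatives_cong_interior:
  assumes "(x has_real_derivative D) (at t)" "(y has_real_derivative D') (at t)" "a < t" "t < b"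
    "\<And>s. a < s \<Longrightarrow> s < b \<Longrightarrow> x s = x' s \<and> y s = y' s"
  shows "(x' has_real_derivative D) (at t) \<and> (y' has_real_derivative D') (at t)"
  using has_field_derivative_transform_within_open[OF assms(1), of "{a<..<b}" x']
    has_field_derivative_transform_within_open[OF assms(2), of "{a<..<b}" y'] assms by simp

lemma seg_sol_cong:
  assumes "seg_sol h rm rp g lam w a b x y" "finite S" "\<And>t. t \<in> {a..b} \<Longrightarrow> t \<notin> S \<Longrightarrow> w t = w' t"
    "\<And>t. t \<in> {a..b} \<Longrightarrow> x t = x' t" "\<And>t. t \<in> {a..b} \<Longrightarrow> y t = y' t"
  shows "seg_sol h rm rp g lam w' a b x' y'"
proof -
  obtain K S' where K: "\<forall>s\<in>{a..b}. \<forall>t\<in>{a..b}. \<bar>x s - x t\<bar> \<le> K * \<bar>s - t\<bar> \<and> \<bar>y s - y t\<bar> \<le> K * \<bar>s - t\<bar>"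
    and y: "\<forall>t\<in>{a..b}. y t \<in> open_interval rm rp"
    and S': "finite S'" "\<forall>t\<in>{a..b} - S'. (x has_real_derivative h (y t)) (at t) \<and>
        (y has_real_derivative (- lam * x t - w t * g (x t))) (at t)"
    using assms(1) unfolding seg_sol_def by blast
  have "\<forall>t\<in>{a..b} - (S \<union> S' \<union> {a, b}). (x' has_real_derivative h (y' t)) (at t) \<and>
        (y' has_real_derivative (- lam * x' t - w' t * g (x' t))) (at t)"
  proof
    fix t assume t: "t \<in> {a..b} - (S \<union> S' \<union> {a, b})"
    then have *: "a < t" "t < b" "t \<in> {a..b}" "t \<notin> S" "t \<in> {a..b} - S'" by auto
    have "(x has_real_derivative h (y t)) (at t)" "(y has_real_derivative (- lam * x t - w t * g (x t))) (at t)"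
      using bspec[OF S'(2) *(5)] by auto
    from derivatives_cong_interior[OF this *(1,2), of x' y']
    have "(x' has_real_derivative h (y t)) (at t) \<and> (y' has_real_derivative (- lam * x t - w t * g (x t))) (at t)"
      using assms(4,5) by simp
    then show "(x' has_real_derivative h (y' t)) (at t) \<and>
        (y' has_real_derivative (- lam * x' t - w' t * g (x' t))) (at t)"
      using assms(3)[OF *(3,4)] assms(4,5)[OF *(3)] by simp
  qed
  moreover have "finite (S \<union> S' \<union> {a, b})" using S' assms(2) by simp
  moreover have "\<forall>s\<in>{a..b}. \<forall>t\<in>{a..b}. \<bar>x' s - x' t\<bar> \<le> K * \<bar>s - t\<bar> \<and> \<bar>y' s - y' t\<bar> \<le> K * \<bar>s - t\<bar>"
    using K by (simp add: assms(4,5)[symmetric])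
  moreover have "\<forall>t\<in>{a..b}. y' t \<in> open_interval rm rp" using y by (simp add: assms(5)[symmetric])
  ultimately show ?thesis by (intro seg_solI)
qed

lemma lipschitz_glue:
  fixes f f' :: "real \<Rightarrow> real"
  assumes f1: "\<forall>s\<in>{a..b}. \<forall>t\<in>{a..b}. \<bar>f s - f t\<bar> \<le> K1 * \<bar>s - t\<bar>"
    and f2: "\<forall>s\<in>{b..c}. \<forall>t\<in>{b..c}. \<bar>f' s - f' t\<bar> \<le> K2 * \<bar>s - t\<bar>" and fb: "f b = f' b"
    and st: "s \<in> {a..c}" "t \<in> {a..c}"
  shows "\<bar>(if s \<le> b then f s else f' s) - (if t \<le> b then f t else f' t)\<bar> \<le> max K1 K2 * \<bar>s - t\<bar>"
proof -
  let ?f = "\<lambda>t. if t \<le> b then f t else f' t"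
  have le: "\<bar>?f s - ?f t\<bar> \<le> max K1 K2 * (t - s)" if "s \<le> t" "s \<in> {a..c}" "t \<in> {a..c}" for s t
  proof -
    have m1: "K1 * r \<le> max K1 K2 * r" "K2 * r \<le> max K1 K2 * r" if "0 \<le> r" for r
      using that by (auto intro!: mult_right_mono)
    consider "t \<le> b" | "s \<le> b" "b < t" | "b < s" by linarith
    then show ?thesis
    proof cases
      case 1
      then have "\<bar>f s - f t\<bar> \<le> K1 * (t - s)" using f1[rule_format, of s t] that by simp
      then show ?thesis using m1(1)[of "t - s"] 1 that by simp
    next
      case 2
      have "\<bar>f s - f b\<bar> \<le> K1 * (b - s)" "\<bar>f' b - f' t\<bar> \<le> K2 * (t - b)"
        using f1[rule_format, of s b] f2[rule_format, of b t] that 2 by simp_all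
      then have "\<bar>f s - f' t\<bar> \<le> max K1 K2 * (b - s) + max K1 K2 * (t - b)"
        using m1(1)[of "b - s"] m1(2)[of "t - b"] 2 fb by linarith
      then show ?thesis using 2 that by (simp add: algebra_simps)
    next
      case 3
      then have "\<bar>f' s - f' t\<bar> \<le> K2 * (t - s)" using f2[rule_format, of s t] that by simp
      then show ?thesis using m1(2)[of "t - s"] 3 that by simp
    qed
  qed
  show ?thesis using le[of s t] le[of t s] st by (cases "s \<le> t") (auto simp: abs_minus_commute)
qed

lemma seg_sol_glue:
  assumes 1: "seg_sol h rm rp g lam w a b x y" and 2: "seg_sol h rm rp g lam w b c x' y'"
    and m: "x b = x' b" "y b = y' b" and abc: "a \<le> b" "b \<le> c"
  shows "seg_sol h rm rp g lam w a c (\<lambda>t. if t \<le> b then x t else x' t) (\<lambda>t. if t \<le> b then y t else y' t)"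
proof -
  obtain K1 S1 where K1: "\<forall>s\<in>{a..b}. \<forall>t\<in>{a..b}. \<bar>x s - x t\<bar> \<le> K1 * \<bar>s - t\<bar> \<and> \<bar>y s - y t\<bar> \<le> K1 * \<bar>s - t\<bar>"
    and y1: "\<forall>t\<in>{a..b}. y t \<in> open_interval rm rp"
    and S1: "finite S1" "\<forall>t\<in>{a..b} - S1. (x has_real_derivative h (y t)) (at t) \<and>
        (y has_real_derivative (- lam * x t - w t * g (x t))) (at t)"
    using 1 unfolding seg_sol_def by blast
  obtain K2 S2 where K2: "\<forall>s\<in>{b..c}. \<forall>t\<in>{b..c}. \<bar>x' s - x' t\<bar> \<le> K2 * \<bar>s - t\<bar> \<and> \<bar>y' s - y' t\<bar> \<le> K2 * \<bar>s - t\<bar>"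
    and y2: "\<forall>t\<in>{b..c}. y' t \<in> open_interval rm rp"
    and S2: "finite S2" "\<forall>t\<in>{b..c} - S2. (x' has_real_derivative h (y' t)) (at t) \<and>
        (y' has_real_derivative (- lam * x' t - w t * g (x' t))) (at t)"
    using 2 unfolding seg_sol_def by blast
  let ?x = "\<lambda>t. if t \<le> b then x t else x' t" and ?y = "\<lambda>t. if t \<le> b then y t else y' t"
  have "\<forall>s\<in>{a..c}. \<forall>t\<in>{a..c}. \<bar>?x s - ?x t\<bar> \<le> max K1 K2 * \<bar>s - t\<bar> \<and> \<bar>?y s - ?y t\<bar> \<le> max K1 K2 * \<bar>s - t\<bar>"
    using lipschitz_glue[of a b x K1 c x' K2] lipschitz_glue[of a b y K1 c y' K2] K1 K2 m by blast
  moreover have "\<forall>t\<in>{a..c}. ?y t \<in> open_interval rm rp" using y1 y2 by auto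
  moreover have "\<forall>t\<in>{a..c} - (S1 \<union> S2 \<union> {a, b, c}). (?x has_real_derivative h (?y t)) (at t) \<and>
        (?y has_real_derivative (- lam * ?x t - w t * g (?x t))) (at t)"
  proof
    fix t assume t: "t \<in> {a..c} - (S1 \<union> S2 \<union> {a, b, c})"
    show "(?x has_real_derivative h (?y t)) (at t) \<and> (?y has_real_derivative (- lam * ?x t - w t * g (?x t))) (at t)"
    proof (cases "t < b")
      case True
      then have "(x has_real_derivative h (y t)) (at t)" "(y has_real_derivative (- lam * x t - w t * g (x t))) (at t)"
        using S1(2) t by auto
      then have "(?x has_real_derivative h (y t)) (at t) \<and> (?y has_real_derivative (- lam * x t - w t * g (x t))) (at t)"
        by (rule derivatives_cong_interior[of _ _ t _ _ a b]) (use True t in auto)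
      then show ?thesis using True by simp
    next
      case False
      then have "(x' has_real_derivative h (y' t)) (at t)" "(y' has_real_derivative (- lam * x' t - w t * g (x' t))) (at t)"
        using S2(2) t by auto
      then have "(?x has_real_derivative h (y' t)) (at t) \<and> (?y has_real_derivative (- lam * x' t - w t * g (x' t))) (at t)"
        by (rule derivatives_cong_interior[of _ _ t _ _ b c]) (use False t in auto)
      then show ?thesis using False t by simp
    qed
  qed
  moreover have "finite (S1 \<union> S2 \<union> {a, b, c})" using S1 S2 by simp
  ultimately show ?thesis by (intro seg_solI)
qed

lemma seg_sol_caratheodory:
  assumes "seg_sol h rm rp g lam w a b x y"
  shows "caratheodory_solution h rm rp g lam w a b x y"
proof -
  obtain K S where K: "\<forall>s\<in>{a..b}. \<forall>t\<in>{a..b}. \<bar>x s - x t\<bar> \<le> K * \<bar>s - t\<bar> \<and> \<bar>y s - y t\<bar> \<le> K * \<bar>s - t\<bar>"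
    and y: "\<forall>t\<in>{a..b}. y t \<in> open_interval rm rp"
    and S: "finite S" "\<forall>t\<in>{a..b} - S. (x has_real_derivative h (y t)) (at t) \<and>
        (y has_real_derivative (- lam * x t - w t * g (x t))) (at t)"
    using assms unfolding seg_sol_def by blast
  have "S \<in> null_sets lebesgue" using S(1) by (simp add: negligible_finite flip: negligible_iff_null_sets)
  then have "AE t in lebesgue. t \<notin> S" by (rule AE_not_in)
  then have "AE t in lebesgue. t \<in> {a..b} \<longrightarrow>
        (x has_real_derivative h (y t)) (at t within {a..b}) \<and>
        (y has_real_derivative (- lam * x t - w t * g (x t))) (at t within {a..b})"
  proof (rule AE_mp, intro AE_I2 impI)
    fix t assume "t \<notin> S" "t \<in> {a..b}"
    then show "(x has_real_derivative h (y t)) (at t within {a..b}) \<and>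
        (y has_real_derivative (- lam * x t - w t * g (x t))) (at t within {a..b})"
      using S(2) by (auto intro: has_field_derivative_at_within)
  qed
  then show ?thesis
    unfolding caratheodory_solution_def using K y by (auto intro!: lipschitz_abs_continuous)
qed

section \<open>Reflection in the origin\<close>

text \<open>A sign \<open>s\<close> instead of two cases: quadrants I and III, and the transitions into them, are treated together
with \<open>s = 1\<close> and \<open>s = -1\<close>.\<close>

definition reflect :: "real \<Rightarrow> (real \<Rightarrow> real) \<Rightarrow> real \<Rightarrow> real" where
  "reflect s f x = s * f (s * x)"

lemma reflect_1 [simp]: "reflect 1 f = f" and reflect_minus_1 [simp]: "reflect (-1) f = flip f"
  by (auto simp: reflect_def flip_def)

lemma rot_rot: "rot (rot p) = - p" by (cases p) (simp add: rot_def)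

lemma planar_reflect:
  assumes "planar h f H F C M R" "s = 1 \<or> s = -1"
  shows "planar (reflect s h) (reflect s f) (\<lambda>x. H (s * x)) (\<lambda>x. F (s * x)) C M R"
  using assms planar_rot[OF planar_rot[OF assms(1)]] by auto

lemma region_reflect:
  assumes "s = 1 \<or> s = -1"
  shows "s *\<^sub>R p \<in> region (\<lambda>x. H (s * x)) (\<lambda>x. F (s * x)) C \<longleftrightarrow> p \<in> region H F C"
    "energy (\<lambda>x. H (s * x)) (\<lambda>x. F (s * x)) (s *\<^sub>R p) = energy H F p"
  using assms by (auto simp: region_def energy_def)

lemma flow_reflect:
  assumes pl: "planar h f H F C M R" and s: "s = 1 \<or> s = -1" and p: "p \<in> region H F C" and t: "0 \<le> t"
  shows "flow (field (reflect s h) (reflect s f)) (s *\<^sub>R p) t = s *\<^sub>R flow (field h f) p t"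
proof -
  interpret planar h f H F C M R by fact
  interpret r1: planar f "flip h" F "\<lambda>x. H (- x)" C M R by (rule rotated)
  have "rot p \<in> region F (\<lambda>x. H (- x)) C" using p by simp
  from r1.flow_rot[OF this t] flow_rot[OF p t]
  have "flow (field (flip h) (flip f)) (- p) t = - flow (field h f) p t" by (simp add: rot_rot)
  then show ?thesis using s by auto
qed

section \<open>The clipped oscillator\<close>

locale restoring =
  fixes k :: "real \<Rightarrow> real"
  assumes cont: "continuous_on UNIV k" and sign: "x \<noteq> 0 \<Longrightarrow> 0 < x * k x"
begin

lemma deriv: "(primitive k has_real_derivative k x) (at x)"
  by (rule primitive_deriv_UNIV[OF cont])

lemma primitive_continuous: "continuous_on S (primitive k)"
  using deriv by (meson DERIV_isCont continuous_at_imp_continuous_on)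

lemma primitive_less: assumes "0 \<le> x" "x < y" shows "primitive k x < primitive k y"
proof (rule DERIV_pos_imp_increasing_open[OF assms(2)])
  show "\<exists>D. (primitive k has_real_derivative D) (at z) \<and> 0 < D" if "x < z" for z
    using deriv[of z] sign[of z] that assms by (auto simp: zero_less_mult_iff)
qed (rule primitive_continuous)

lemma primitive_less_neg: assumes "x < y" "y \<le> 0" shows "primitive k y < primitive k x"
proof (rule DERIV_neg_imp_decreasing_open[OF assms(1)])
  show "\<exists>D. (primitive k has_real_derivative D) (at z) \<and> D < 0" if "z < y" for z
    using deriv[of z] sign[of z] that assms by (auto simp: zero_less_mult_iff)
qed (rule primitive_continuous)

lemma primitive_le: "0 \<le> x \<Longrightarrow> x \<le> y \<Longrightarrow> primitive k x \<le> primitive k y"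
  using primitive_less[of x y] by (cases "x = y") auto

lemma primitive_le_neg: "x \<le> y \<Longrightarrow> y \<le> 0 \<Longrightarrow> primitive k y \<le> primitive k x"
  using primitive_less_neg[of x y] by (cases "x = y") auto

lemma primitive_nonneg: "0 \<le> primitive k x"
  using primitive_le[of 0 x] primitive_le_neg[of x 0] by (cases "0 \<le> x") auto

lemma primitive_inj: "0 \<le> x \<Longrightarrow> 0 \<le> y \<Longrightarrow> primitive k x = primitive k y \<Longrightarrow> x = y"
  using primitive_less[of x y] primitive_less[of y x] by (cases x y rule: linorder_cases) auto

lemma primitive_inj_neg: "x \<le> 0 \<Longrightarrow> y \<le> 0 \<Longrightarrow> primitive k x = primitive k y \<Longrightarrow> x = y"
  using primitive_less_neg[of x y] primitive_less_neg[of y x] by (cases x y rule: linorder_cases) auto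

end

definition clip :: "real \<Rightarrow> real \<Rightarrow> real \<Rightarrow> real" where
  "clip a b x = max a (min b x)"

lemma clip_id [simp]: "a \<le> x \<Longrightarrow> x \<le> b \<Longrightarrow> clip a b x = x"
  by (simp add: clip_def)

lemma clip_in: "a \<le> b \<Longrightarrow> clip a b x \<in> {a..b}"
  by (auto simp: clip_def)

lemma clip_sign: "a < 0 \<Longrightarrow> 0 < b \<Longrightarrow> 0 < x \<Longrightarrow> 0 < clip a b x" "a < 0 \<Longrightarrow> 0 < b \<Longrightarrow> x < 0 \<Longrightarrow> clip a b x < 0"
  by (auto simp: clip_def)

lemma continuous_clip: "continuous_on S (clip a b)"
  unfolding clip_def by (intro continuous_intros)

lemma continuous_compose_clip:
  assumes "continuous_on {a..b} k" "a \<le> b"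
  shows "continuous_on UNIV (\<lambda>x. k (clip a b x))"
  by (rule continuous_on_compose2[OF assms(1) continuous_clip]) (use clip_in[OF assms(2)] in auto)

lemma bounded_compose_clip:
  fixes k :: "real \<Rightarrow> real"
  assumes "continuous_on {a..b} k" "a \<le> b"
  obtains B where "\<And>x. \<bar>k (clip a b x)\<bar> \<le> B"
proof -
  have "bounded (k ` {a..b})" using compact_imp_bounded[OF compact_continuous_image[OF assms(1)]] by simp
  then obtain B where "\<forall>x\<in>{a..b}. \<bar>k x\<bar> \<le> B" by (auto simp: bounded_iff)
  then show thesis using that clip_in[OF assms(2)] by blast
qed

lemma open_intervalI:
  assumes "rm < ereal a" "ereal b < rp" "a \<le> z" "z \<le> b"
  shows "z \<in> open_interval rm rp"
proof -
  have "ereal a \<le> ereal z" "ereal z \<le> ereal b" using assms(3,4) by (simp_all only: ereal_less_eq(3))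
  then show ?thesis
    using less_le_trans[OF assms(1)] le_less_trans[OF _ assms(2)] unfolding open_interval_def by simp
qed

locale momentum =
  fixes h :: "real \<Rightarrow> real" and rm rp :: ereal
  assumes h_cont: "continuous_on (open_interval rm rp) h" and h_mono: "strict_mono_on (open_interval rm rp) h"
    and h_0: "h 0 = 0" and rm: "rm < 0" and rp: "0 < rp"
begin

lemma zero_in_range: "0 \<in> open_interval rm rp"
  using rm rp by (simp add: open_interval_def flip: zero_ereal_def)

lemma h_pos: "y \<in> open_interval rm rp \<Longrightarrow> 0 < y \<Longrightarrow> 0 < h y"
  and h_neg: "y \<in> open_interval rm rp \<Longrightarrow> y < 0 \<Longrightarrow> h y < 0"
  using strict_mono_onD[OF h_mono zero_in_range, of y] strict_mono_onD[OF h_mono _ zero_in_range, of y] h_0 by auto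

lemma H_deriv:
  assumes "y \<in> open_interval rm rp"
  shows "(primitive h has_real_derivative h y) (at y)"
proof -
  have "rm < ereal (min y 0)" "ereal (max y 0) < rp"
    using assms zero_in_range by (auto simp: open_interval_def min_def max_def zero_ereal_def)
  then obtain a b where ab: "rm < ereal a" "ereal a < ereal (min y 0)" "ereal (max y 0) < ereal b" "ereal b < rp"
    using ereal_dense2 by metis
  have "{a..b} \<subseteq> open_interval rm rp"
    using open_intervalI[OF ab(1,4)] by auto
  then have "continuous_on {a..b} h" by (rule continuous_on_subset[OF h_cont])
  then show ?thesis by (rule primitive_deriv) (use ab in auto)
qed

lemma H_less:
  assumes "0 \<le> x" "x < y" "ereal y < rp"
  shows "primitive h x < primitive h y"
proof (rule DERIV_pos_imp_increasing_open[OF assms(2)])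
  have oi: "z \<in> open_interval rm rp" if "0 \<le> z" "z \<le> y" for z
    by (rule open_intervalI[of _ 0 y]) (use that assms(3) zero_in_range in \<open>auto simp: open_interval_def\<close>)
  show "\<exists>D. (primitive h has_real_derivative D) (at z) \<and> 0 < D" if "x < z" "z < y" for z
    using H_deriv[OF oi] h_pos[OF oi] that assms(1) by (meson less_imp_le order_le_less_trans)
  show "continuous_on {x..y} (primitive h)"
    using DERIV_isCont[OF H_deriv[OF oi]] assms(1) by (intro continuous_at_imp_continuous_on ballI) auto
qed

lemma H_less_neg:
  assumes "x < y" "y \<le> 0" "rm < ereal x"
  shows "primitive h y < primitive h x"
proof (rule DERIV_neg_imp_decreasing_open[OF assms(1)])
  have oi: "z \<in> open_interval rm rp" if "x \<le> z" "z \<le> 0" for z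
    by (rule open_intervalI[of _ x 0]) (use that assms(3) zero_in_range in \<open>auto simp: open_interval_def\<close>)
  show "\<exists>D. (primitive h has_real_derivative D) (at z) \<and> D < 0" if "x < z" "z < y" for z
    using H_deriv[OF oi] h_neg[OF oi] that assms(2) by (meson less_imp_le order_less_le_trans)
  show "continuous_on {x..y} (primitive h)"
    using DERIV_isCont[OF H_deriv[OF oi]] assms(2) by (intro continuous_at_imp_continuous_on ballI) auto
qed

lemma H_inv_plus_eq:
  assumes "0 \<le> y" "ereal y < rp" shows "H_inv_plus h rp (primitive h y) = y"
  unfolding H_inv_plus_def
proof (rule the_inv_into_f_f)
  show "inj_on (primitive h) {y. 0 \<le> y \<and> ereal y < rp}"
  proof (rule linorder_inj_onI)
    show "primitive h x \<noteq> primitive h z" if "x < z" "x \<in> {y. 0 \<le> y \<and> ereal y < rp}" "z \<in> {y. 0 \<le> y \<and> ereal y < rp}" for x z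
      using H_less[of x z] that by auto
  qed auto
qed (use assms in auto)

lemma H_inv_minus_eq:
  assumes "y \<le> 0" "rm < ereal y" shows "H_inv_minus h rm (primitive h y) = y"
  unfolding H_inv_minus_def
proof (rule the_inv_into_f_f)
  show "inj_on (primitive h) {y. rm < ereal y \<and> y \<le> 0}"
  proof (rule linorder_inj_onI)
    show "primitive h x \<noteq> primitive h z" if "x < z" "x \<in> {y. rm < ereal y \<and> y \<le> 0}" "z \<in> {y. rm < ereal y \<and> y \<le> 0}" for x z
      using H_less_neg[of x z] that by auto
  qed auto
qed (use assms in auto)

end

text \<open>The box \<open>[ym, yp] \<times> [-R, R]\<close> contains all points of energy at most \<open>C\<close>, for every \<open>\<mu> \<ge> 0\<close>, in its
interior. Clipping the arguments of \<open>h\<close> and \<open>g\<close> to the box leaves the orbits of these energies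
unchanged, and makes the field bounded and defined everywhere.\<close>

locale oscillator = momentum h rm rp for h rm rp +
  fixes g :: "real \<Rightarrow> real" and lam C ym yp R :: real
  assumes g_cont: "continuous_on UNIV g" and g_0: "g 0 = 0"
    and g_sign: "z \<noteq> 0 \<Longrightarrow> g z * z > 0"
    and lam: "lam > 0" and C: "C > 0"
    and ym: "rm < ereal ym" "ym < 0" and yp: "0 < yp" "ereal yp < rp"
    and box: "C < primitive h ym" "C < primitive h yp" "0 < R" "C < lam / 2 * R\<^sup>2"
begin

definition hh :: "real \<Rightarrow> real" where "hh y = h (clip ym yp y)"
definition ff :: "real \<Rightarrow> real \<Rightarrow> real" where "ff mu x = lam * clip (- R) R x + mu * g (clip (- R) R x)"
definition HH :: "real \<Rightarrow> real" where "HH = primitive hh"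
definition FF :: "real \<Rightarrow> real \<Rightarrow> real" where "FF mu = primitive (ff mu)"
definition RR :: real where "RR = max R (max yp (- ym))"

lemma range_Icc: "{ym..yp} \<subseteq> open_interval rm rp"
  using open_intervalI[OF ym(1) yp(2)] by auto

sublocale hh: restoring hh
proof
  have "continuous_on {ym..yp} h" by (rule continuous_on_subset[OF h_cont range_Icc])
  then show "continuous_on UNIV hh"
    unfolding hh_def using ym yp by (intro continuous_compose_clip) auto
  fix x :: real assume "x \<noteq> 0"
  have c: "clip ym yp x \<in> open_interval rm rp" using clip_in[of ym yp x] range_Icc ym yp by auto
  show "0 < x * hh x"
    unfolding hh_def using h_pos[OF c] h_neg[OF c] clip_sign[of ym yp x] ym(2) yp(1) \<open>x \<noteq> 0\<close>
    by (cases "0 < x") (auto simp: zero_less_mult_iff)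
qed

sublocale g: restoring g
  by standard (use g_cont g_sign in \<open>auto simp: mult.commute\<close>)

lemma restoring_ff: assumes "0 \<le> mu" shows "restoring (ff mu)"
proof
  have c: "continuous_on UNIV (\<lambda>x. g (clip (- R) R x))"
    by (intro continuous_compose_clip continuous_on_subset[OF g_cont]) (use box in auto)
  show "continuous_on UNIV (ff mu)" unfolding ff_def by (intro continuous_intros c continuous_clip)
  fix x :: real assume x: "x \<noteq> 0"
  let ?c = "clip (- R) R x"
  consider "0 < x" | "x < 0" using x by linarith
  then show "0 < x * ff mu x"
  proof cases
    case 1
    then have "0 < ?c" using clip_sign box by auto
    moreover from this have "0 < g ?c" using g_sign[of ?c] by (auto simp: zero_less_mult_iff)
    ultimately have "0 < ff mu x" unfolding ff_def using lam assms by (intro add_pos_nonneg) auto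
    then show ?thesis using 1 by simp
  next
    case 2
    then have "?c < 0" using clip_sign box by auto
    moreover from this have "g ?c < 0" using g_sign[of ?c] by (auto simp: zero_less_mult_iff)
    ultimately have "ff mu x < 0" unfolding ff_def using lam assms
      by (intro add_neg_nonpos mult_pos_neg mult_nonneg_nonpos) auto
    then show ?thesis using 2 by (simp add: mult_neg_neg)
  qed
qed

lemma HH_eq: "ym \<le> y \<Longrightarrow> y \<le> yp \<Longrightarrow> HH y = primitive h y"
  unfolding HH_def by (rule primitive_cong) (use ym yp in \<open>auto simp: hh_def min_def max_def split: if_splits\<close>)

lemma hh_eq: "ym \<le> y \<Longrightarrow> y \<le> yp \<Longrightarrow> hh y = h y"
  by (simp add: hh_def)

lemma ff_eq: "\<bar>x\<bar> \<le> R \<Longrightarrow> ff mu x = lam * x + mu * g x"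
  by (simp add: ff_def abs_le_iff)

lemma F_energy_deriv: "(F_energy g lam mu has_real_derivative lam * x + mu * g x) (at x)"
  unfolding F_energy_def[abs_def] by (auto intro!: derivative_eq_intros g.deriv)

text \<open>Two antiderivatives of the same function on the box that agree at \<open>0\<close>.\<close>

lemma FF_eq: assumes "\<bar>x\<bar> \<le> R" shows "FF mu x = F_energy g lam mu x"
proof -
  have "FF mu x = primitive (\<lambda>x. lam * x + mu * g x) x"
    unfolding FF_def by (rule primitive_cong) (use assms in \<open>auto simp: ff_eq min_def max_def split: if_splits\<close>)
  also have "\<dots> = F_energy g lam mu x"
  proof -
    have "continuous_on UNIV (\<lambda>x. lam * x + mu * g x)" by (intro continuous_intros g_cont)
    then have "(primitive (\<lambda>x. lam * x + mu * g x) has_real_derivative lam * x + mu * g x) (at x)" for x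
      by (rule primitive_deriv_UNIV)
    then have "((\<lambda>x. primitive (\<lambda>x. lam * x + mu * g x) x - F_energy g lam mu x) has_real_derivative 0) (at x)" for x
      using DERIV_diff[OF _ F_energy_deriv[of mu x]] by fastforce
    then have "primitive (\<lambda>x. lam * x + mu * g x) x - F_energy g lam mu x
        = primitive (\<lambda>x. lam * x + mu * g x) 0 - F_energy g lam mu 0" by (intro DERIV_isconst_all) simp
    then show ?thesis by (simp add: F_energy_def)
  qed
  finally show ?thesis .
qed

lemma F_energy_ge: "0 \<le> mu \<Longrightarrow> lam / 2 * x\<^sup>2 \<le> F_energy g lam mu x"
  using g.primitive_nonneg[of x] by (simp add: F_energy_def)

lemma level_in_box: assumes "0 \<le> mu" "F_energy g lam mu x \<le> C" shows "\<bar>x\<bar> < R"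
proof (rule ccontr)
  assume "\<not> ?thesis"
  then have "R\<^sup>2 \<le> x\<^sup>2" using box(3) by (simp add: abs_le_square_iff[symmetric])
  then have "lam / 2 * R\<^sup>2 \<le> lam / 2 * x\<^sup>2" using lam by (intro mult_left_mono) auto
  then show False using F_energy_ge[OF assms(1), of x] assms(2) box(4) by linarith
qed

lemma HH_box: assumes "HH y \<le> C" shows "ym < y" "y < yp"
proof -
  show "y < yp"
  proof (rule ccontr)
    assume "\<not> y < yp"
    then have "HH yp \<le> HH y" unfolding HH_def using yp by (intro hh.primitive_le) auto
    then show False using assms box(2) HH_eq[of yp] ym yp by simp
  qed
  show "ym < y"
  proof (rule ccontr)
    assume "\<not> ym < y"
    then have "HH ym \<le> HH y" unfolding HH_def using ym by (intro hh.primitive_le_neg) auto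
    then show False using assms box(1) HH_eq[of ym] ym yp by simp
  qed
qed

lemma FF_box: assumes "0 \<le> mu" "FF mu x \<le> C" shows "\<bar>x\<bar> < R"
proof -
  interpret f: restoring "ff mu" by (rule restoring_ff[OF assms(1)])
  have R: "C < FF mu R" "C < FF mu (- R)"
    using F_energy_ge[OF assms(1), of R] F_energy_ge[OF assms(1), of "-R"] box FF_eq[of R mu] FF_eq[of "-R" mu] by auto
  show ?thesis
  proof (rule ccontr)
    assume "\<not> ?thesis"
    then have "R \<le> x \<or> x \<le> - R" by auto
    then have "FF mu R \<le> FF mu x \<or> FF mu (- R) \<le> FF mu x"
      unfolding FF_def using f.primitive_le[of R x] f.primitive_le_neg[of x "- R"] box(3) by auto
    then show False using R assms(2) by auto
  qed
qed

lemma HH_nonneg: "0 \<le> HH y" unfolding HH_def by (rule hh.primitive_nonneg)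

lemma FF_nonneg: assumes "0 \<le> mu" shows "0 \<le> FF mu x"
  unfolding FF_def by (rule restoring.primitive_nonneg[OF restoring_ff[OF assms]])

lemma energy_box:
  assumes "0 \<le> mu" "energy HH (FF mu) p \<le> C"
  shows "ym < snd p" "snd p < yp" "\<bar>fst p\<bar> < R" "snd p \<in> open_interval rm rp"
    "energy HH (FF mu) p = nonlinear_energy h g lam mu p"
proof -
  have "HH (snd p) \<le> C" "FF mu (fst p) \<le> C"
    using assms(2) HH_nonneg[of "snd p"] FF_nonneg[OF assms(1), of "fst p"] by (auto simp: energy_def)
  then show 1: "ym < snd p" "snd p < yp" "\<bar>fst p\<bar> < R" using HH_box FF_box[OF assms(1)] by auto
  then show "snd p \<in> open_interval rm rp" using range_Icc by auto
  show "energy HH (FF mu) p = nonlinear_energy h g lam mu p"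
    using 1 by (simp add: energy_def nonlinear_energy_def HH_eq FF_eq split: prod.split)
qed

text \<open>A point of the original annulus is in the box, because each of the two nonnegative summands of its energy is
at most \<open>C\<close>. From here on only the clipped energies are needed.\<close>

lemma annulus_iff:
  assumes "0 \<le> mu" "c2 \<le> C"
  shows "p \<in> annulus h rm rp g lam mu c1 c2 \<longleftrightarrow> energy HH (FF mu) p \<in> {c1..c2}"
proof
  assume "p \<in> annulus h rm rp g lam mu c1 c2"
  then have p: "snd p \<in> open_interval rm rp" "c1 \<le> nonlinear_energy h g lam mu p" "nonlinear_energy h g lam mu p \<le> c2"
    by (auto simp: annulus_def)
  then have s: "primitive h (snd p) + F_energy g lam mu (fst p) \<le> C"
    using assms by (simp add: nonlinear_energy_def split: prod.splits)
  have F0: "0 \<le> F_energy g lam mu (fst p)" 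
    using order_trans[OF _ F_energy_ge[OF assms(1)], of 0 "fst p"] lam by simp
  have H0: "0 \<le> primitive h (snd p)"
    using H_less[of 0 "snd p"] H_less_neg[of "snd p" 0] p(1) by (cases "snd p" "0::real" rule: linorder_cases) (auto simp: open_interval_def)
  have "\<bar>fst p\<bar> < R" using level_in_box[OF assms(1), of "fst p"] s H0 by simp
  moreover have "snd p < yp"
  proof (rule ccontr)
    assume "\<not> snd p < yp"
    then have "primitive h yp \<le> primitive h (snd p)"
      using H_less[of yp "snd p"] p(1) yp by (cases "yp = snd p") (auto simp: open_interval_def)
    then show False using s F0 box by simp
  qed
  moreover have "ym < snd p"
  proof (rule ccontr)
    assume "\<not> ym < snd p"
    then have "primitive h ym \<le> primitive h (snd p)"
      using H_less_neg[of "snd p" ym] p(1) ym by (cases "ym = snd p") (auto simp: open_interval_def)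
    then show False using s F0 box by simp
  qed
  ultimately have "energy HH (FF mu) p = nonlinear_energy h g lam mu p"
    by (simp add: energy_def nonlinear_energy_def HH_eq FF_eq split: prod.split)
  then show "energy HH (FF mu) p \<in> {c1..c2}" using p by simp
next
  assume "energy HH (FF mu) p \<in> {c1..c2}"
  then show "p \<in> annulus h rm rp g lam mu c1 c2"
    using energy_box[OF assms(1), of p] assms by (auto simp: annulus_def)
qed

lemma field_bound_ex: "\<exists>M. \<forall>x. \<bar>hh x\<bar> \<le> M \<and> \<bar>ff mu x\<bar> \<le> M"
proof -
  have c: "continuous_on {ym..yp} h" by (rule continuous_on_subset[OF h_cont range_Icc])
  obtain B1 where 1: "\<And>x. \<bar>hh x\<bar> \<le> B1" using bounded_compose_clip[OF c] ym yp by (auto simp: hh_def)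
  have "continuous_on {-R..R} (\<lambda>x. lam * x + mu * g x)"
    by (intro continuous_intros continuous_on_subset[OF g_cont]) auto
  then obtain B2 where 2: "\<And>x. \<bar>ff mu x\<bar> \<le> B2" using bounded_compose_clip[of "-R" R] box by (auto simp: ff_def)
  show ?thesis using 1 2 by (intro exI[of _ "max B1 B2"]) (auto intro: le_max_iff_disj[THEN iffD2])
qed

text \<open>Conservation of the clipped energy keeps the solution in the box, where the clipped equation is the original
one.\<close>

lemma seg_sol_ode_sol:
  assumes mu: "0 \<le> mu" and z: "ode_sol (field hh (ff mu)) T z" and C: "energy HH (FF mu) (z 0) \<le> C"
  shows "seg_sol h rm rp g lam (\<lambda>_. mu) a (a + T) (\<lambda>t. fst (z (t - a))) (\<lambda>t. snd (z (t - a)))"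
proof -
  interpret f: restoring "ff mu" by (rule restoring_ff[OF mu])
  obtain M where M: "\<And>x. \<bar>hh x\<bar> \<le> M \<and> \<bar>ff mu x\<bar> \<le> M" using field_bound_ex by blast
  have en: "energy HH (FF mu) (z t) \<le> C" if "t \<in> {0..T}" for t
    using energy_conserved[OF hh.deriv f.deriv z that] C by (simp add: HH_def FF_def)
  have nb: "norm (field hh (ff mu) p) \<le> 2 * M" for p
    using norm_Pair_le[of "hh (snd p)" "- ff mu (fst p)"] M[of "snd p"] M[of "fst p"] by (simp add: field_def)
  have lip: "norm (z s - z t) \<le> 2 * M * \<bar>s - t\<bar>" if "s \<in> {0..T}" "t \<in> {0..T}" for s t
    by (rule ode_sol_lipschitz[OF z nb that])
  show ?thesis
  proof (rule seg_solI)
    show "\<forall>s\<in>{a..a + T}. \<forall>t\<in>{a..a + T}.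
       \<bar>fst (z (s - a)) - fst (z (t - a))\<bar> \<le> (2 * M) * \<bar>s - t\<bar> \<and> \<bar>snd (z (s - a)) - snd (z (t - a))\<bar> \<le> (2 * M) * \<bar>s - t\<bar>"
    proof (intro ballI)
      fix s t assume "s \<in> {a..a + T}" "t \<in> {a..a + T}"
      then have "norm (z (s - a) - z (t - a)) \<le> 2 * M * \<bar>s - t\<bar>" using lip[of "s - a" "t - a"] by auto
      then show "\<bar>fst (z (s - a)) - fst (z (t - a))\<bar> \<le> (2 * M) * \<bar>s - t\<bar> \<and> \<bar>snd (z (s - a)) - snd (z (t - a))\<bar> \<le> (2 * M) * \<bar>s - t\<bar>"
        using dist_fst_le[of "z (s - a)" "z (t - a)"] dist_snd_le[of "z (s - a)" "z (t - a)"]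
        by (simp add: dist_norm)
    qed
    show "\<forall>t\<in>{a..a + T}. snd (z (t - a)) \<in> open_interval rm rp" using energy_box(4)[OF mu en] by auto
    show "finite {a, a + T}" by simp
    show "\<forall>t\<in>{a..a + T} - {a, a + T}.
       ((\<lambda>t. fst (z (t - a))) has_real_derivative h (snd (z (t - a)))) (at t) \<and>
       ((\<lambda>t. snd (z (t - a))) has_real_derivative - lam * fst (z (t - a)) - mu * g (fst (z (t - a)))) (at t)"
    proof
      fix t assume "t \<in> {a..a + T} - {a, a + T}"
      then have t: "0 < t - a" "t - a < T" by auto
      then have w: "at (t - a) within {0..T} = at (t - a)" by (intro at_within_interior) auto
      note b = energy_box[OF mu en[of "t - a"]]
      show "((\<lambda>t. fst (z (t - a))) has_real_derivative h (snd (z (t - a)))) (at t) \<and>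
       ((\<lambda>t. snd (z (t - a))) has_real_derivative - lam * fst (z (t - a)) - mu * g (fst (z (t - a)))) (at t)"
        using ode_sol_planar[OF z, of "t - a"] t b(1-3)
          DERIV_shift[of "\<lambda>t. fst (z t)" "h (snd (z (t - a)))" t "- a"]
          DERIV_shift[of "\<lambda>t. snd (z t)" "- lam * fst (z (t - a)) - mu * g (fst (z (t - a)))" t "- a"]
        unfolding w by (simp add: hh_eq ff_eq)
    qed
  qed
qed

text \<open>Uniqueness for the clipped system comes from the assumed uniqueness of Caratheodory solutions, which is
stated for the original equation.\<close>

lemma planar_oscillator:
  assumes mu: "0 \<le> mu" and uniq: "unique_ivp_solutions h rm rp g lam (\<lambda>_. mu)"
  shows "\<exists>M. planar hh (ff mu) HH (FF mu) C M RR"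
proof -
  interpret f: restoring "ff mu" by (rule restoring_ff[OF mu])
  obtain M where M: "\<And>x. \<bar>hh x\<bar> \<le> M \<and> \<bar>ff mu x\<bar> \<le> M" using field_bound_ex by blast
  have "planar hh (ff mu) HH (FF mu) C M RR"
  proof
    show "ff mu 0 = 0" "hh 0 = 0" using g_0 h_0 box ym yp by (auto simp: ff_def hh_def)
    show "HH x \<le> C \<Longrightarrow> \<bar>x\<bar> \<le> RR" for x using HH_box[of x] by (auto simp: RR_def)
    show "FF mu x \<le> C \<Longrightarrow> \<bar>x\<bar> \<le> RR" for x using FF_box[OF mu, of x] by (auto simp: RR_def)
    fix T z w t
    assume z: "ode_sol (field hh (ff mu)) T z" and w: "ode_sol (field hh (ff mu)) T w"
      and e: "z 0 = w 0" "z 0 \<in> region HH (FF mu) C" and t: "t \<in> {0..T}"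
    have "energy HH (FF mu) (z 0) \<le> C" "energy HH (FF mu) (w 0) \<le> C" using e by (auto simp: region_def)
    from seg_sol_ode_sol[OF mu z this(1), of 0] seg_sol_ode_sol[OF mu w this(2), of 0]
    have "caratheodory_solution h rm rp g lam (\<lambda>_. mu) 0 T (\<lambda>t. fst (z t)) (\<lambda>t. snd (z t))"
      "caratheodory_solution h rm rp g lam (\<lambda>_. mu) 0 T (\<lambda>t. fst (w t)) (\<lambda>t. snd (w t))"
      using seg_sol_caratheodory by force+
    moreover have "0 \<in> {0..T}" using t by auto
    ultimately have "fst (z t) = fst (w t) \<and> snd (z t) = snd (w t)"
      using uniq[unfolded unique_ivp_solutions_def, rule_format, of 0 0 T "\<lambda>t. fst (z t)" "\<lambda>t. snd (z t)" "\<lambda>t. fst (w t)" "\<lambda>t. snd (w t)" t] e t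
      by auto
    then show "z t = w t" by (simp add: prod_eq_iff)
  qed (use M hh.cont f.cont hh.sign f.sign hh.deriv f.deriv in \<open>auto simp: HH_def FF_def\<close>)
  then show ?thesis by blast
qed

text \<open>In the upper half plane \<open>y\<close> is \<open>H\<^sub>+\<^sup>-\<^sup>1(c - F(x))\<close> along the orbit of energy \<open>c\<close>, so the speed
\<open>h(y)\<close> is a function of \<open>x\<close>.\<close>

lemma upper_time:
  assumes pl: "planar hh (ff mu) HH (FF mu) C M RR" and mu: "0 \<le> mu"
    and p: "p \<in> region HH (FF mu) C" and B: "0 < B"
    and pos: "\<And>t. 0 < t \<Longrightarrow> t < B \<Longrightarrow> 0 < snd (flow (field hh (ff mu)) p t)"
    and nn: "\<And>t. 0 \<le> t \<Longrightarrow> t \<le> B \<Longrightarrow> 0 \<le> snd (flow (field hh (ff mu)) p t)"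
  shows "(LBINT u=fst p..fst (flow (field hh (ff mu)) p B). 1 / h (H_inv_plus h rp (energy HH (FF mu) p - F_energy g lam mu u))) = B"
proof -
  interpret planar hh "ff mu" HH "FF mu" C M RR by fact
  have "(LBINT u=X p 0..X p B. 1 / h (H_inv_plus h rp (energy HH (FF mu) p - F_energy g lam mu u))) = B - 0"
  proof (rule traversal_time_increasing[OF B, where v="\<lambda>t. hh (Y p t)"])
    show "continuous_on {0..B} (X p)" by (rule continuous_on_subset[OF flow_continuous(1)[OF p]]) auto
    fix t assume t: "0 < t" "t < B"
    show "(X p has_real_derivative hh (Y p t)) (at t)" by (rule flow_deriv_at(1)[OF p t(1)])
    show "0 < hh (Y p t)" by (rule h_pos[OF pos[OF t]])
    show "isCont (\<lambda>t. hh (Y p t)) t"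
      using DERIV_isCont[OF flow_deriv_at(2)[OF p t(1)]] hh.cont
      by (intro isCont_o2[of t "Y p" hh]) (auto simp: continuous_on_eq_continuous_at)
    have en: "energy HH (FF mu) (flow V p t) = energy HH (FF mu) p" using flow_energy[OF p] t by simp
    then have "energy HH (FF mu) (flow V p t) \<le> C" using p by (simp add: region_def)
    note b = energy_box[OF mu this]
    have "energy HH (FF mu) p - F_energy g lam mu (X p t) = primitive h (Y p t)"
      using en b by (simp add: energy_def HH_eq FF_eq)
    moreover have "H_inv_plus h rp (primitive h (Y p t)) = Y p t"
      using b(4) pos[OF t] by (intro H_inv_plus_eq) (auto simp: open_interval_def)
    ultimately show "h (H_inv_plus h rp (energy HH (FF mu) p - F_energy g lam mu (X p t))) = hh (Y p t)"
      using b by (simp add: hh_eq)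
  next
    fix t assume "0 \<le> t" "t \<le> B"
    then show "0 \<le> hh (Y p t)" using nn[of t] h_pos[of "Y p t"] h_0 by (cases "Y p t = 0") auto
  qed
  then show ?thesis using p by simp
qed

lemma lower_time:
  assumes pl: "planar hh (ff mu) HH (FF mu) C M RR" and mu: "0 \<le> mu"
    and p: "p \<in> region HH (FF mu) C" and B: "0 < B"
    and neg: "\<And>t. 0 < t \<Longrightarrow> t < B \<Longrightarrow> snd (flow (field hh (ff mu)) p t) < 0"
    and np: "\<And>t. 0 \<le> t \<Longrightarrow> t \<le> B \<Longrightarrow> snd (flow (field hh (ff mu)) p t) \<le> 0"
  shows "(LBINT u=fst (flow (field hh (ff mu)) p B)..fst p. 1 / (- h (H_inv_minus h rm (energy HH (FF mu) p - F_energy g lam mu u)))) = B"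
proof -
  interpret planar hh "ff mu" HH "FF mu" C M RR by fact
  have "(LBINT u=X p B..X p 0. 1 / (- h (H_inv_minus h rm (energy HH (FF mu) p - F_energy g lam mu u)))) = B - 0"
  proof (rule traversal_time_decreasing[OF B, where v="\<lambda>t. - hh (Y p t)"])
    show "continuous_on {0..B} (X p)" by (rule continuous_on_subset[OF flow_continuous(1)[OF p]]) auto
    fix t assume t: "0 < t" "t < B"
    show "(X p has_real_derivative - (- hh (Y p t))) (at t)" using flow_deriv_at(1)[OF p t(1)] by simp
    show "0 < - hh (Y p t)" using h_neg[OF neg[OF t]] by simp
    show "isCont (\<lambda>t. - hh (Y p t)) t"
      using DERIV_isCont[OF flow_deriv_at(2)[OF p t(1)]] hh.cont
      by (intro isCont_minus isCont_o2[of t "Y p" hh]) (auto simp: continuous_on_eq_continuous_at)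
    have en: "energy HH (FF mu) (flow V p t) = energy HH (FF mu) p" using flow_energy[OF p] t by simp
    then have "energy HH (FF mu) (flow V p t) \<le> C" using p by (simp add: region_def)
    note b = energy_box[OF mu this]
    have "energy HH (FF mu) p - F_energy g lam mu (X p t) = primitive h (Y p t)"
      using en b by (simp add: energy_def HH_eq FF_eq)
    moreover have "H_inv_minus h rm (primitive h (Y p t)) = Y p t"
      using b(4) neg[OF t] by (intro H_inv_minus_eq) (auto simp: open_interval_def)
    ultimately show "- h (H_inv_minus h rm (energy HH (FF mu) p - F_energy g lam mu (X p t))) = - hh (Y p t)"
      using b by (simp add: hh_eq)
  next
    fix t assume "0 \<le> t" "t \<le> B"
    then show "0 \<le> - hh (Y p t)" using np[of t] h_neg[of "Y p t"] h_0 by (cases "Y p t = 0") auto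
  qed
  then show ?thesis using p by simp
qed

text \<open>In each case the orbit of energy \<open>c\<close> is followed from the axis on which it enters the quadrant to the
axis on which it leaves it; at the ends one of the coordinates is \<open>0\<close> and the energy determines the other.\<close>

lemma quadrant_time_quarter:
  assumes pl: "planar hh (ff mu) HH (FF mu) C M RR" and mu: "0 \<le> mu"
    and c: "0 < c" "c \<le> C" and x: "xm < 0" "0 < xp" "F_energy g lam mu xm = c" "F_energy g lam mu xp = c"
  shows "quadrant_time h rm rp g lam mu xm xp Q_I c = quarter 0 hh (ff mu) HH (FF mu) c"
    "quadrant_time h rm rp g lam mu xm xp Q_IV c = quarter 1 hh (ff mu) HH (FF mu) c"
    "quadrant_time h rm rp g lam mu xm xp Q_III c = quarter 2 hh (ff mu) HH (FF mu) c"
    "quadrant_time h rm rp g lam mu xm xp Q_II c = quarter 3 hh (ff mu) HH (FF mu) c"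
proof -
  interpret planar hh "ff mu" HH "FF mu" C M RR by fact
  interpret f: restoring "ff mu" by (rule restoring_ff[OF mu])
  interpret r1: planar "ff mu" "flip hh" "FF mu" "\<lambda>x. HH (- x)" C M RR by (rule rotated)
  interpret r2: planar "flip hh" "flip (ff mu)" "\<lambda>x. HH (- x)" "\<lambda>x. FF mu (- x)" C M RR by (rule r1.rotated)
  interpret r3: planar "flip (ff mu)" hh "\<lambda>x. FF mu (- x)" HH C M RR by (rule rotated3)
  have Fx: "FF mu xm = c" "FF mu xp = c"
    using level_in_box[OF mu, of xm] level_in_box[OF mu, of xp] FF_eq[of xm mu] FF_eq[of xp mu] x c by auto
  have xp_eq: "u = xp" if "FF mu u = c" "0 \<le> u" for u
    using f.primitive_inj[of u xp] that Fx x by (simp add: FF_def)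
  have xm_eq: "u = xm" if "FF mu u = c" "u \<le> 0" for u
    using f.primitive_inj_neg[of u xm] that Fx x by (simp add: FF_def)
  show "quadrant_time h rm rp g lam mu xm xp Q_I c = quarter 0 hh (ff mu) HH (FF mu) c"
  proof -
    define q where "q = (0::real, the_inv_into {0..} HH c)"
    have q: "q \<in> sector HH (FF mu) C" "energy HH (FF mu) q = c" "fst q = 0" unfolding q_def using level_point_sector[OF c] by auto
    have qD: "q \<in> D" using q(1) by (simp add: sector_def)
    define B where "B = exit_time hh (ff mu) q"
    have B: "0 < B" "Y q B = 0" "0 < X q B" unfolding B_def using exit_time_pos[OF q(1,3)] exit_time[OF q(1)] exit_X_pos[OF q(1)] by auto
    have "FF mu (X q B) = c" using flow_energy[OF qD, of B] B q(2) H_0 by (simp add: energy_def)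
    then have XB: "X q B = xp" using xp_eq B by simp
    have "(LBINT u=fst q..X q B. 1 / h (H_inv_plus h rp (energy HH (FF mu) q - F_energy g lam mu u))) = B"
      by (rule upper_time[OF pl mu qD B(1)]) (use exit_time(3)[OF q(1)] Y_nonneg_in_sector[OF q(1)] in \<open>auto simp: B_def\<close>)
    then show ?thesis using q XB by (simp add: B_def q_def zero_ereal_def)
  qed
  show "quadrant_time h rm rp g lam mu xm xp Q_IV c = quarter 1 hh (ff mu) HH (FF mu) c"
  proof -
    obtain y where y: "0 < y" "FF mu y = c" "the_inv_into {0..} (FF mu) c = y" using r1.level_point[OF c] by blast
    have yx: "y = xp" using xp_eq y by simp
    define q where "q = (xp, 0::real)"
    have q: "rot q = (0, the_inv_into {0..} (FF mu) c)" using y yx by (simp add: q_def rot_def)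
    have s: "rot q \<in> sector (FF mu) (\<lambda>x. HH (- x)) C" "energy (FF mu) (\<lambda>x. HH (- x)) (rot q) = c"
      unfolding q using r1.level_point_sector[OF c] by auto
    have qD: "q \<in> D" using s(1) by (simp add: sector_def)
    define B where "B = exit_time (ff mu) (flip hh) (rot q)"
    have fl: "flow (field (ff mu) (flip hh)) (rot q) t = rot (flow V q t)" if "0 \<le> t" for t by (rule flow_rot[OF qD that])
    have B: "0 < B" unfolding B_def by (rule r1.exit_time_pos[OF s(1)]) (simp add: q)
    have "snd (rot (flow V q B)) = 0" using r1.exit_time(2)[OF s(1)] fl[of B] B by (simp add: B_def[symmetric])
    then have XB: "X q B = 0" by (simp add: rot_def)
    have neg: "Y q t < 0" if "0 < t" "t \<le> B" for t
      using r1.X_pos_in_sector[OF s(1), of t] fl[of t] that by (simp add: B_def rot_def)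
    have "(LBINT u=X q B..fst q. 1 / (- h (H_inv_minus h rm (energy HH (FF mu) q - F_energy g lam mu u)))) = B"
    proof (rule lower_time[OF pl mu qD B])
      show "Y q t \<le> 0" if "0 \<le> t" "t \<le> B" for t using neg[of t] that qD by (cases "t = 0") (auto simp: q_def)
    qed (use neg in auto)
    moreover have "energy HH (FF mu) q = c" using s(2) by simp
    ultimately show ?thesis using XB by (simp add: B_def q_def[symmetric] q[symmetric] zero_ereal_def numeral_eq_Suc) (simp add: q_def)
  qed
  show "quadrant_time h rm rp g lam mu xm xp Q_III c = quarter 2 hh (ff mu) HH (FF mu) c"
  proof -
    define q where "q = (0::real, - the_inv_into {0..} (\<lambda>x. HH (- x)) c)"
    have q: "(-1) *\<^sub>R q = (0, the_inv_into {0..} (\<lambda>x. HH (- x)) c)" by (simp add: q_def)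
    have s: "(-1) *\<^sub>R q \<in> sector (\<lambda>x. HH (- x)) (\<lambda>x. FF mu (- x)) C" 
      "energy (\<lambda>x. HH (- x)) (\<lambda>x. FF mu (- x)) ((-1) *\<^sub>R q) = c"
      unfolding q using r2.level_point_sector[OF c] by auto
    have qD: "q \<in> D" using s(1) region_reflect(1)[of "-1" q HH "FF mu" C] by (simp add: sector_def)
    have en: "energy HH (FF mu) q = c" using s(2) region_reflect(2)[of "-1" HH "FF mu" q] by simp
    define B where "B = exit_time (flip hh) (flip (ff mu)) ((-1) *\<^sub>R q)"
    have fl: "flow (field (flip hh) (flip (ff mu))) ((-1) *\<^sub>R q) t = (-1) *\<^sub>R (flow V q t)" if "0 \<le> t" for t
      using flow_reflect[OF pl _ qD that, of "-1"] by simp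
    have B: "0 < B" unfolding B_def by (rule r2.exit_time_pos[OF s(1)]) (simp add: q_def)
    have YB: "Y q B = 0" using r2.exit_time(2)[OF s(1)] B unfolding B_def[symmetric] by (subst (asm) fl) auto
    have XB: "X q B < 0" using r2.exit_X_pos[OF s(1)] B unfolding B_def[symmetric] by (subst (asm) fl) auto
    have neg: "Y q t < 0" if "0 \<le> t" "t < B" for t
      using r2.exit_time(3)[OF s(1), of t] fl[of t] that by (simp add: B_def)
    have "FF mu (X q B) = c" using flow_energy[OF qD, of B] B YB en H_0 by (simp add: energy_def)
    then have XB: "X q B = xm" using xm_eq XB by simp
    have "(LBINT u=X q B..fst q. 1 / (- h (H_inv_minus h rm (energy HH (FF mu) q - F_energy g lam mu u)))) = B"
    proof (rule lower_time[OF pl mu qD B])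
      show "Y q t \<le> 0" if "0 \<le> t" "t \<le> B" for t using neg[of t] that YB by (cases "t = B") auto
    qed (use neg in auto)
    moreover have "quarter 2 hh (ff mu) HH (FF mu) c = B" unfolding B_def q by (simp add: numeral_eq_Suc)
    moreover have "fst q = 0" by (simp add: q_def)
    ultimately show ?thesis using XB en by (simp add: zero_ereal_def)
  qed
  show "quadrant_time h rm rp g lam mu xm xp Q_II c = quarter 3 hh (ff mu) HH (FF mu) c"
  proof -
    obtain y where y: "0 < y" "FF mu (- y) = c" "the_inv_into {0..} (\<lambda>x. FF mu (- x)) c = y" using r3.level_point[OF c] by blast
    have yx: "y = - xm" using xm_eq[of "- y"] y by simp
    define q where "q = (xm, 0::real)"
    have q: "rot (rot (rot q)) = (0, the_inv_into {0..} (\<lambda>x. FF mu (- x)) c)" using y yx by (simp add: q_def rot_def)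
    have s: "rot (rot (rot q)) \<in> sector (\<lambda>x. FF mu (- x)) HH C" "energy (\<lambda>x. FF mu (- x)) HH (rot (rot (rot q))) = c"
      unfolding q using r3.level_point_sector[OF c] by auto
    have en: "energy HH (FF mu) q = c" using s(2) by (simp add: energy_def rot_def)
    have qD: "q \<in> D" using en c by (simp add: region_def)
    define B where "B = exit_time (flip (ff mu)) hh (rot (rot (rot q)))"
    have fl: "flow (field (flip (ff mu)) hh) (rot (rot (rot q))) t = rot (rot (rot (flow V q t)))" if "0 \<le> t" for t
      by (rule flow_rot3[OF qD that])
    have B: "0 < B" unfolding B_def by (rule r3.exit_time_pos[OF s(1)]) (simp add: q)
    have "snd (rot (rot (rot (flow V q B)))) = 0" using r3.exit_time(2)[OF s(1)] fl[of B] B by (simp add: B_def[symmetric])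
    then have XB: "X q B = 0" by (simp add: rot_def)
    have pos: "0 < Y q t" if "0 < t" "t \<le> B" for t
      using r3.X_pos_in_sector[OF s(1), of t] fl[of t] that by (simp add: B_def rot_def)
    have "(LBINT u=fst q..X q B. 1 / h (H_inv_plus h rp (energy HH (FF mu) q - F_energy g lam mu u))) = B"
    proof (rule upper_time[OF pl mu qD B])
      show "0 \<le> Y q t" if "0 \<le> t" "t \<le> B" for t using pos[of t] that qD by (cases "t = 0") (auto simp: q_def)
    qed (use pos in auto)
    moreover have "quarter 3 hh (ff mu) HH (FF mu) c = B" unfolding B_def q by (simp add: numeral_eq_Suc)
    moreover have "fst q = xm" by (simp add: q_def)
    ultimately show ?thesis using XB en by (simp add: zero_ereal_def)
  qed
qed

end

section \<open>Orbit pieces and meeting paths in a given position\<close>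

context planar
begin

text \<open>An orbit piece in the upper half plane with prescribed end abscissas. Its duration is the transition time.\<close>

lemma upper_segment:
  assumes c: "0 < c" "c \<le> C" and ab: "a \<le> 0" "a \<le> b" "F a < c" "F b < c"
  obtains q s where "q \<in> upper_left H F C" "energy H F q = c" "fst q = a" "0 \<le> s" "X q s = b"
    "\<And>t. 0 \<le> t \<Longrightarrow> t \<le> s \<Longrightarrow> 0 < Y q t"
proof -
  obtain y where y: "0 < y" "H y = c - F a" using level_point[of "c - F a"] ab c F_nonneg[of a] by auto
  obtain z where z: "0 < z" "H z = c - F b" using level_point[of "c - F b"] ab c F_nonneg[of b] by auto
  define q where "q = (a, y)"
  have q: "q \<in> upper_left H F C" "energy H F q = c" "fst q = a"
    using y ab c by (auto simp: q_def upper_left_def region_def energy_def)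
  obtain s where s: "0 \<le> s" "s \<le> upper_exit h f q" "flow V q s = (b, z)"
    using upper_orbit[OF q(1), of "(b, z)"] z q ab by (auto simp: energy_def)
  have "s \<noteq> upper_exit h f q" using upper_exit(2)[OF q(1)] s(3) z by force
  then show thesis using that[OF q s(1)] s upper_exit(4)[OF q(1)] by auto
qed

lemma quadrant_paths_meet:
  fixes w \<gamma> :: "real \<Rightarrow> real \<times> real"
  assumes q: "q \<in> {Q_II, Q_IV}"
    and w: "continuous_on {u..v} w" "u \<le> v"
      "\<And>\<sigma>. \<sigma> \<in> {u..v} \<Longrightarrow> w \<sigma> \<in> closed_quadrant q \<and> energy H F (w \<sigma>) \<in> {c1..c2}"
      "fst (w u) = 0 \<and> snd (w v) = 0 \<or> snd (w u) = 0 \<and> fst (w v) = 0"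
    and \<gamma>: "path \<gamma>" "\<And>r. r \<in> {0..1} \<Longrightarrow> \<gamma> r \<in> closed_quadrant q \<and> energy H F (\<gamma> r) \<in> {c1..c2}"
      "energy H F (pathstart \<gamma>) = c1" "energy H F (pathfinish \<gamma>) = c2"
    and c: "0 < c1" "c2 \<le> C"
  shows "\<exists>\<sigma>\<in>{u..v}. \<exists>r\<in>{0..1}. w \<sigma> = \<gamma> r"
proof -
  have r: "fst (rot z) = - snd z" "snd (rot z) = fst z" for z by (simp_all add: rot_def)
  \<comment> \<open>a power of the rotation that moves the quadrant onto the first one\<close>
  obtain \<rho> h' f' H' F' where pl: "planar h' f' H' F' C M R"
    and e: "\<And>z. energy H' F' (\<rho> z) = energy H F z"
    and sgn: "\<And>z. z \<in> closed_quadrant q \<Longrightarrow> 0 \<le> fst (\<rho> z) \<and> 0 \<le> snd (\<rho> z)"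
    and ax: "\<And>z. fst (\<rho> z) = 0 \<longleftrightarrow> snd z = 0" "\<And>z. snd (\<rho> z) = 0 \<longleftrightarrow> fst z = 0"
    and \<rho>: "\<And>p. continuous_on S p \<Longrightarrow> continuous_on S (\<lambda>x. \<rho> (p x))" "inj \<rho>" for S :: "real set"
  proof (cases "q = Q_IV")
    case True
    show thesis
    proof (rule that[OF rotated, of rot])
      show "inj rot" by (rule inj_on_inverseI[where g="\<lambda>z. rot (rot (rot z))"]) simp
    qed (use True in \<open>auto simp: r intro!: continuous_intros\<close>)
  next
    case False
    then have "q = Q_II" using q by simp
    show thesis
    proof (rule that[OF rotated3, of "\<lambda>z. rot (rot (rot z))"])
      show "inj (\<lambda>z. rot (rot (rot z)))" by (rule inj_on_inverseI[where g=rot]) simp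
    qed (use \<open>q = Q_II\<close> in \<open>auto simp: r energy_def intro!: continuous_intros\<close>)
  qed
  have sec: "\<rho> z \<in> sector H' F' C \<and> energy H' F' (\<rho> z) \<in> {c1..c2}" if "z \<in> closed_quadrant q \<and> energy H F z \<in> {c1..c2}" for z
    using that sgn[of z] c by (auto simp: sector_def region_def e)
  obtain \<sigma> r where "\<sigma> \<in> {u..v}" "r \<in> {0..1}" "\<rho> (w \<sigma>) = \<rho> (\<gamma> r)"
  proof (rule sector_paths_meet[OF pl \<rho>(1)[OF w(1)] w(2) sec[OF w(3)]])
    show "fst (\<rho> (w u)) = 0 \<and> snd (\<rho> (w v)) = 0 \<or> snd (\<rho> (w u)) = 0 \<and> fst (\<rho> (w v)) = 0"
      using w(4) by (auto simp: ax)
    show "path (\<lambda>r. \<rho> (\<gamma> r))" using \<gamma>(1) \<rho>(1) unfolding path_def by blast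
    show "\<rho> (\<gamma> r) \<in> sector H' F' C \<and> energy H' F' (\<rho> (\<gamma> r)) \<in> {c1..c2}" if "r \<in> {0..1}" for r
      by (rule sec[OF \<gamma>(2)[OF that]])
  qed (use \<gamma>(3,4) in \<open>simp_all add: pathstart_def pathfinish_def e\<close>)
  then show ?thesis using \<rho>(2) by (metis injD)
qed

end

lemma rot_funpow_quadrants:
  assumes "odd N"
  shows "N mod 4 = 1 \<Longrightarrow> (rot ^^ N) z = rot z" "N mod 4 = 3 \<Longrightarrow> (rot ^^ N) z = rot (rot (rot z))"
proof -
  have 4: "(rot ^^ 4) = id" by (simp add: fun_eq_iff numeral_eq_Suc)
  have "(rot ^^ (4 * k)) = id" for k by (simp add: funpow_mult[symmetric] 4)
  then have "(rot ^^ N) z = (rot ^^ (N mod 4)) z"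
    using funpow_add[of "N mod 4" "4 * (N div 4)" rot] by simp
  then show "N mod 4 = 1 \<Longrightarrow> (rot ^^ N) z = rot z" "N mod 4 = 3 \<Longrightarrow> (rot ^^ N) z = rot (rot (rot z))"
    by (simp_all add: numeral_3_eq_3)
qed

section \<open>An interval of constant weight\<close>

definition orient :: "quadrant \<Rightarrow> real" where
  "orient \<kappa> = (if \<kappa> = Q_III then -1 else 1)"

lemma orient_cases: "orient \<kappa> = 1 \<or> orient \<kappa> = -1" by (simp add: orient_def)

lemma quadrant_orient:
  assumes "\<kappa> \<in> {Q_I, Q_III}"
  shows "p \<in> closed_quadrant \<kappa> \<longleftrightarrow> 0 \<le> fst (orient \<kappa> *\<^sub>R p) \<and> 0 \<le> snd (orient \<kappa> *\<^sub>R p)"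
    "p \<in> closed_quadrant (q_pred \<kappa>) \<longleftrightarrow> fst (orient \<kappa> *\<^sub>R p) \<le> 0 \<and> 0 \<le> snd (orient \<kappa> *\<^sub>R p)"
    "p \<in> closed_quadrant (q_succ \<kappa>) \<longleftrightarrow> 0 \<le> fst (orient \<kappa> *\<^sub>R p) \<and> snd (orient \<kappa> *\<^sub>R p) \<le> 0"
  using assms by (cases p; auto simp: orient_def)+

context oscillator
begin

abbreviation "En mu \<equiv> energy HH (FF mu)"
abbreviation "Fl mu \<equiv> flow (field hh (ff mu))"

text \<open>In the reflected system the quarters are shifted by two.\<close>

lemma quadrant_time_reflect:
  assumes pl: "planar hh (ff mu) HH (FF mu) C M RR" and mu: "0 \<le> mu"
    and c: "0 < c" "c \<le> C" and x: "xm < 0" "0 < xp" "F_energy g lam mu xm = c" "F_energy g lam mu xp = c"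
    and \<kappa>: "\<kappa> \<in> {Q_I, Q_III}"
  defines "q \<equiv> \<lambda>j. quarter j (reflect (orient \<kappa>) hh) (reflect (orient \<kappa>) (ff mu)) (\<lambda>x. HH (orient \<kappa> * x)) (\<lambda>x. FF mu (orient \<kappa> * x)) c"
  shows "quadrant_time h rm rp g lam mu xm xp \<kappa> c = q 0"
    "quadrant_time h rm rp g lam mu xm xp (q_succ \<kappa>) c = q 1"
    "quadrant_time h rm rp g lam mu xm xp (q_succ (q_succ \<kappa>)) c = q 2"
    "period h rm rp g lam mu xm xp c = (\<Sum>j<4. q j)"
proof -
  note Q = quadrant_time_quarter[OF pl mu c x]
  have p: "period h rm rp g lam mu xm xp c = (\<Sum>j<4. quarter j hh (ff mu) HH (FF mu) c)"
    unfolding period_def by (simp add: Q numeral_eq_Suc del: quadrant_time.simps quarter.simps)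
  have sh: "quarter j (flip hh) (flip (ff mu)) (\<lambda>x. HH (- x)) (\<lambda>x. FF mu (- x)) c = quarter (j + 2) hh (ff mu) HH (FF mu) c" for j
    by (simp add: numeral_2_eq_2)
  have 4: "quarter 4 hh (ff mu) HH (FF mu) c = quarter 0 hh (ff mu) HH (FF mu) c"
    "quarter 5 hh (ff mu) HH (FF mu) c = quarter 1 hh (ff mu) HH (FF mu) c"
    using quarter_periodic[of 0] quarter_periodic[of 1] by auto
  consider "\<kappa> = Q_I" | "\<kappa> = Q_III" using \<kappa> by blast
  then have "quadrant_time h rm rp g lam mu xm xp \<kappa> c = q 0 \<and>
    quadrant_time h rm rp g lam mu xm xp (q_succ \<kappa>) c = q 1 \<and>
    quadrant_time h rm rp g lam mu xm xp (q_succ (q_succ \<kappa>)) c = q 2 \<and>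
    period h rm rp g lam mu xm xp c = (\<Sum>j<4. q j)"
  proof cases
    case 1
    then show ?thesis using Q p unfolding q_def by (simp add: orient_def del: quadrant_time.simps quarter.simps)
  next
    case 2
    have qj: "q j = quarter (j + 2) hh (ff mu) HH (FF mu) c" for j using sh 2 unfolding q_def by (simp add: orient_def del: quarter.simps)
    have "(\<Sum>j<4. q j) = quarter 2 hh (ff mu) HH (FF mu) c + quarter 3 hh (ff mu) HH (FF mu) c + quarter 4 hh (ff mu) HH (FF mu) c + quarter 5 hh (ff mu) HH (FF mu) c"
      unfolding qj by (simp add: eval_nat_numeral del: quarter.simps)
    also have "\<dots> = (\<Sum>j<4. quarter j hh (ff mu) HH (FF mu) c)" unfolding 4 by (simp add: eval_nat_numeral del: quarter.simps)
    finally show ?thesis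
      using Q p 2 4 qj[of 0] qj[of 1] qj[of 2] by (simp add: eval_nat_numeral del: quadrant_time.simps quarter.simps)
  qed
  then show "quadrant_time h rm rp g lam mu xm xp \<kappa> c = q 0"
    "quadrant_time h rm rp g lam mu xm xp (q_succ \<kappa>) c = q 1"
    "quadrant_time h rm rp g lam mu xm xp (q_succ (q_succ \<kappa>)) c = q 2"
    "period h rm rp g lam mu xm xp c = (\<Sum>j<4. q j)" by auto
qed

text \<open>Crossing number \<open>N = 2n + 1\<close> is reached after \<open>n\<close> zeroes of \<open>x\<close>; the remainder of \<open>N\<close> modulo
\<open>4\<close>, that is the parity of \<open>n\<close>, tells in which quadrant the image lies.\<close>

lemma stage_nonlinear:
  fixes p :: "real \<Rightarrow> real \<times> real"
  assumes pl: "planar hh (ff mu) HH (FF mu) C M RR" and mu: "0 \<le> mu"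
    and c: "0 < c1" "c1 < c2" "c2 \<le> C"
    and x: "\<And>c. c \<in> {c1, c2} \<Longrightarrow> xm c < 0 \<and> 0 < xp c \<and> F_energy g lam mu (xm c) = c \<and> F_energy g lam mu (xp c) = c"
    and de: "d \<in> {c1, c2}" "e \<in> {c1, c2}" "d \<noteq> e"
    and \<kappa>: "\<kappa> \<in> {Q_I, Q_III}"
    and twist_d: "quadrant_time h rm rp g lam mu (xm d) (xp d) (q_succ \<kappa>) d
        + quadrant_time h rm rp g lam mu (xm d) (xp d) (q_succ (q_succ \<kappa>)) d
        + real \<alpha> * period h rm rp g lam mu (xm d) (xp d) d > \<tau>"
    and twist_e: "quadrant_time h rm rp g lam mu (xm e) (xp e) \<kappa> e
        + quadrant_time h rm rp g lam mu (xm e) (xp e) (q_succ \<kappa>) e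
        + real \<beta> * period h rm rp g lam mu (xm e) (xp e) e < \<tau>"
    and \<tau>: "0 \<le> \<tau>"
    and N: "3 + 4 * \<alpha> \<le> 2 * n + 1" "2 * n + 1 \<le> 4 * \<beta> + 1"
    and p: "continuous_on {u..v} p" "u \<le> v" "\<And>\<sigma>. \<sigma> \<in> {u..v} \<Longrightarrow> p \<sigma> \<in> closed_quadrant \<kappa> \<and> En mu (p \<sigma>) \<in> {c1..c2}"
      "En mu (p u) = c1 \<and> En mu (p v) = c2 \<or> En mu (p u) = c2 \<and> En mu (p v) = c1"
  obtains u' v' where "u \<le> u'" "u' \<le> v'" "v' \<le> v" "continuous_on {u'..v'} (\<lambda>\<sigma>. Fl mu (p \<sigma>) \<tau>)"
    "\<forall>\<sigma>\<in>{u'..v'}. En mu (Fl mu (p \<sigma>) \<tau>) \<in> {c1..c2} \<and>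
       Fl mu (p \<sigma>) \<tau> \<in> closed_quadrant (if even n then q_succ \<kappa> else q_pred \<kappa>) \<and>
       card {u\<in>{0..\<tau>}. snd (Fl mu (p \<sigma>) u) = 0} = n + 1 \<and>
       card {u\<in>{0<..<\<tau>}. fst (Fl mu (p \<sigma>) u) = 0} = n"
    "fst (Fl mu (p u') \<tau>) = 0 \<and> snd (Fl mu (p v') \<tau>) = 0 \<or> snd (Fl mu (p u') \<tau>) = 0 \<and> fst (Fl mu (p v') \<tau>) = 0"
proof -
  define s where "s = orient \<kappa>"
  have s: "s = 1 \<or> s = -1" unfolding s_def by (rule orient_cases)
  interpret planar hh "ff mu" HH "FF mu" C M RR by fact
  define h' f' H' F' where "h' = reflect s hh" and "f' = reflect s (ff mu)" and "H' = (\<lambda>x. HH (s * x))" and "F' = (\<lambda>x. FF mu (s * x))"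
  have pl': "planar h' f' H' F' C M RR" unfolding h'_def f'_def H'_def F'_def by (rule planar_reflect[OF pl s])
  have reg: "z \<in> region HH (FF mu) C" if "En mu z \<in> {c1..c2}" for z using that c by (auto simp: region_def)
  have en': "energy H' F' (s *\<^sub>R z) = En mu z" for z unfolding H'_def F'_def by (rule region_reflect(2)[OF s])
  have sec: "s *\<^sub>R p \<sigma> \<in> sector H' F' C" if "\<sigma> \<in> {u..v}" for \<sigma>
    using p(3)[OF that] reg region_reflect(1)[OF s, of "p \<sigma>" HH "FF mu" C] quadrant_orient(1)[OF \<kappa>, of "p \<sigma>"]
    by (simp add: sector_def H'_def F'_def s_def)
  have pos: "0 < c \<and> c \<le> C" if "c \<in> {c1, c2}" for c using that c by auto
  have Q: "quadrant_time h rm rp g lam mu (xm c) (xp c) \<kappa> c = quarter 0 h' f' H' F' c"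
    "quadrant_time h rm rp g lam mu (xm c) (xp c) (q_succ \<kappa>) c = quarter 1 h' f' H' F' c"
    "quadrant_time h rm rp g lam mu (xm c) (xp c) (q_succ (q_succ \<kappa>)) c = quarter 2 h' f' H' F' c"
    "period h rm rp g lam mu (xm c) (xp c) c = (\<Sum>j<4. quarter j h' f' H' F' c)" if "c \<in> {c1, c2}" for c
    unfolding h'_def f'_def H'_def F'_def s_def
    using quadrant_time_reflect[OF pl mu _ _ _ _ _ _ \<kappa>, of c "xm c" "xp c"] pos[OF that] x[OF that] by blast+
  have cs: "continuous_on {u..v} (\<lambda>\<sigma>. s *\<^sub>R p \<sigma>)" by (intro continuous_intros p)
  have es: "energy H' F' (s *\<^sub>R p u) = d \<and> energy H' F' (s *\<^sub>R p v) = e \<or> energy H' F' (s *\<^sub>R p u) = e \<and> energy H' F' (s *\<^sub>R p v) = d"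
    using p(4) de unfolding en' by auto
  obtain u' v' where uv': "u \<le> u'" "u' \<le> v'" "v' \<le> v"
    "\<And>\<sigma>. \<sigma> \<in> {u'..v'} \<Longrightarrow> hit (2*n+1) h' f' (s *\<^sub>R p \<sigma>) \<le> \<tau> \<and> \<tau> \<le> hit (Suc (2*n+1)) h' f' (s *\<^sub>R p \<sigma>)"
    "\<tau> = hit (2*n+1) h' f' (s *\<^sub>R p u') \<and> \<tau> = hit (Suc (2*n+1)) h' f' (s *\<^sub>R p v') \<or>
     \<tau> = hit (Suc (2*n+1)) h' f' (s *\<^sub>R p u') \<and> \<tau> = hit (2*n+1) h' f' (s *\<^sub>R p v')"
    using twist_crossing[OF pl' cs sec p(2) es twist_d[unfolded Q[OF de(1)]] twist_e[unfolded Q[OF de(2)]] N]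
    by metis
  have sub: "\<sigma> \<in> {u..v}" if "\<sigma> \<in> {u'..v'}" for \<sigma> using that uv' by auto
  have fl: "flow (field h' f') (s *\<^sub>R p \<sigma>) r = s *\<^sub>R Fl mu (p \<sigma>) r" if "\<sigma> \<in> {u..v}" "0 \<le> r" for \<sigma> r
    unfolding h'_def f'_def using flow_reflect[OF pl s reg that(2)] p(3)[OF that(1)] by blast
  have sz: "fst (s *\<^sub>R z) = 0 \<longleftrightarrow> fst z = 0" "snd (s *\<^sub>R z) = 0 \<longleftrightarrow> snd z = 0" for z :: "real \<times> real" using s by auto
  have odd: "odd (2 * n + 1)" by simp
  show thesis
  proof (rule that[OF uv'(1-3) _ ballI])
    show "continuous_on {u'..v'} (\<lambda>\<sigma>. Fl mu (p \<sigma>) \<tau>)"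
      by (rule continuous_on_flow) (use reg p(3) sub \<tau> uv' in \<open>auto intro: continuous_on_subset[OF p(1)] simp: continuous_on_const\<close>)
    fix \<sigma> assume \<sigma>: "\<sigma> \<in> {u'..v'}"
    note S = sec[OF sub[OF \<sigma>]] and r = fl[OF sub[OF \<sigma>]]
    have t: "hit (2*n+1) h' f' (s *\<^sub>R p \<sigma>) \<le> \<tau>" "\<tau> \<le> hit (2*n+2) h' f' (s *\<^sub>R p \<sigma>)" using uv'(4)[OF \<sigma>] by auto
    define w where "w = Fl mu (p \<sigma>) \<tau>"
    have e: "En mu w \<in> {c1..c2}"
      using flow_energy[OF reg \<tau>] p(3)[OF sub[OF \<sigma>]] by (auto simp: w_def)
    have q: "0 \<le> fst ((rot ^^ (2*n+1)) (s *\<^sub>R w)) \<and> 0 \<le> snd ((rot ^^ (2*n+1)) (s *\<^sub>R w))"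
      using position_between_hits[OF pl' S, of "2*n+1" \<tau>] t r[OF \<tau>] by (simp add: w_def del: funpow.simps)
    have "w \<in> closed_quadrant (if even n then q_succ \<kappa> else q_pred \<kappa>)"
    proof (cases "even n")
      case True
      then have "(2 * n + 1) mod 4 = 1" by (elim evenE) simp
      from rot_funpow_quadrants(1)[OF odd this] have "(rot ^^ (2 * n + 1)) (s *\<^sub>R w) = rot (s *\<^sub>R w)" .
      from q[unfolded this] show ?thesis using True quadrant_orient(3)[OF \<kappa>, of w] by (simp add: rot_def s_def)
    next
      case False
      then have "(2 * n + 1) mod 4 = 3" by presburger
      from rot_funpow_quadrants(2)[OF odd this] have "(rot ^^ (2 * n + 1)) (s *\<^sub>R w) = rot (rot (rot (s *\<^sub>R w)))" .
      from q[unfolded this] show ?thesis using False quadrant_orient(2)[OF \<kappa>, of w] by (simp add: rot_def s_def)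
    qed
    moreover have "{u\<in>{0..\<tau>}. snd (Fl mu (p \<sigma>) u) = 0} = {u\<in>{0..\<tau>}. snd (flow (field h' f') (s *\<^sub>R p \<sigma>) u) = 0}"
      "{u\<in>{0<..<\<tau>}. fst (Fl mu (p \<sigma>) u) = 0} = {u\<in>{0<..<\<tau>}. fst (flow (field h' f') (s *\<^sub>R p \<sigma>) u) = 0}"
      using r s by auto
    ultimately show "En mu (Fl mu (p \<sigma>) \<tau>) \<in> {c1..c2} \<and>
       Fl mu (p \<sigma>) \<tau> \<in> closed_quadrant (if even n then q_succ \<kappa> else q_pred \<kappa>) \<and>
       card {u\<in>{0..\<tau>}. snd (Fl mu (p \<sigma>) u) = 0} = n + 1 \<and>
       card {u\<in>{0<..<\<tau>}. fst (Fl mu (p \<sigma>) u) = 0} = n"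
      using zeros_of_Y[OF pl' S t] zeros_of_X[OF pl' S t] e unfolding w_def by presburger
  next
    have ax: "\<tau> = hit (2*n+1) h' f' (s *\<^sub>R p \<sigma>) \<Longrightarrow> snd (Fl mu (p \<sigma>) \<tau>) = 0"
      "\<tau> = hit (Suc (2*n+1)) h' f' (s *\<^sub>R p \<sigma>) \<Longrightarrow> fst (Fl mu (p \<sigma>) \<tau>) = 0" if \<sigma>: "\<sigma> \<in> {u'..v'}" for \<sigma>
    proof -
      note S = sec[OF sub[OF \<sigma>]] and r = fl[OF sub[OF \<sigma>] \<tau>]
      note P = position_between_hits[OF pl' S, of "2*n+1" \<tau>, OF uv'(4)[OF \<sigma>, THEN conjunct1] uv'(4)[OF \<sigma>, THEN conjunct2]]
      show "\<tau> = hit (2*n+1) h' f' (s *\<^sub>R p \<sigma>) \<Longrightarrow> snd (Fl mu (p \<sigma>) \<tau>) = 0"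
        "\<tau> = hit (Suc (2*n+1)) h' f' (s *\<^sub>R p \<sigma>) \<Longrightarrow> fst (Fl mu (p \<sigma>) \<tau>) = 0"
        using P unfolding rot_funpow_zero r sz by auto
    qed
    show "fst (Fl mu (p u') \<tau>) = 0 \<and> snd (Fl mu (p v') \<tau>) = 0 \<or> snd (Fl mu (p u') \<tau>) = 0 \<and> fst (Fl mu (p v') \<tau>) = 0"
      using uv'(2,5) ax[of u'] ax[of v'] by auto
  qed
qed

section \<open>An interval of vanishing weight\<close>

lemma G_inv_plus_level:
  assumes "0 < c" "0 \<le> k" "k < primitive g (sqrt (2 * c / lam))"
  shows "0 \<le> G_inv_plus g k" "primitive g (G_inv_plus g k) = k" "lam / 2 * (G_inv_plus g k)\<^sup>2 < c"
proof -
  obtain x where x: "0 \<le> x" "x \<le> sqrt (2 * c / lam)" "primitive g x = k"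
    using IVT'[of "primitive g" 0 k "sqrt (2 * c / lam)"] assms lam g.primitive_continuous by auto
  have eq: "G_inv_plus g k = x"
    unfolding G_inv_plus_def by (rule the_inv_into_f_eq) (use x g.primitive_inj in \<open>auto simp: inj_on_def\<close>)
  have "x < sqrt (2 * c / lam)" using x(2,3) assms(3) by (cases "x = sqrt (2 * c / lam)") auto
  then have "x\<^sup>2 < 2 * c / lam" using x(1) assms(1) lam by (metis real_less_rsqrt real_sqrt_less_iff real_sqrt_unique)
  then have "lam / 2 * x\<^sup>2 < c" using lam by (simp add: field_simps)
  then show "0 \<le> G_inv_plus g k" "primitive g (G_inv_plus g k) = k" "lam / 2 * (G_inv_plus g k)\<^sup>2 < c"
    using eq x by auto
qed

lemma G_inv_minus_level:
  assumes "0 < c" "0 \<le> k" "k < primitive g (- sqrt (2 * c / lam))"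
  shows "G_inv_minus g k \<le> 0" "primitive g (G_inv_minus g k) = k" "lam / 2 * (G_inv_minus g k)\<^sup>2 < c"
proof -
  obtain x where x: "x \<le> 0" "- sqrt (2 * c / lam) \<le> x" "primitive g x = k"
    using IVT2'[of "primitive g" 0 k "- sqrt (2 * c / lam)"] assms lam g.primitive_continuous by auto
  have eq: "G_inv_minus g k = x"
    unfolding G_inv_minus_def by (rule the_inv_into_f_eq) (use x g.primitive_inj_neg in \<open>auto simp: inj_on_def\<close>)
  have "- x < sqrt (2 * c / lam)" using x(2,3) assms(3) by (cases "x = - sqrt (2 * c / lam)") auto
  then have "(- x)\<^sup>2 < 2 * c / lam" using x(1) assms(1) lam by (metis neg_0_le_iff_le real_less_rsqrt real_sqrt_less_iff real_sqrt_unique)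
  then have "lam / 2 * x\<^sup>2 < c" using lam by (simp add: field_simps)
  then show "G_inv_minus g k \<le> 0" "primitive g (G_inv_minus g k) = k" "lam / 2 * (G_inv_minus g k)\<^sup>2 < c"
    using eq x by auto
qed

text \<open>What admissibility is for: where \<open>\<lambda> x\<^sup>2/2\<close> alone has reached the level \<open>c\<close>, the term \<open>\<mu>\<^sub>j G(x)\<close> has
lifted the energy above the outer boundary of both annuli.\<close>

lemma admissible_exits_annulus:
  assumes ad: "admissible g lam mu c1 c2 i c" and j: "j \<in> {i, Suc i}" "0 < mu j" and x: "c \<le> lam / 2 * x\<^sup>2"
  shows "c2 j < lam / 2 * x\<^sup>2 + mu j * primitive g x"
proof -
  have c: "0 < c" using ad by (simp add: admissible_def)
  let ?r = "sqrt (2 * c / lam)"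
  have "2 * c / lam \<le> x\<^sup>2" using x lam by (simp add: field_simps)
  from real_sqrt_le_mono[OF this] have r: "?r \<le> \<bar>x\<bar>" "0 \<le> ?r" using c lam by auto
  have "min (primitive g (- ?r)) (primitive g ?r) \<le> primitive g x"
    using g.primitive_le[of ?r x] g.primitive_le_neg[of x "- ?r"] r by (cases "0 \<le> x") (auto simp: min_le_iff_disj)
  moreover have "(c2 j - c) / mu j < min (primitive g (- ?r)) (primitive g ?r)"
    using ad j(1) by (auto simp: admissible_def)
  ultimately have "(c2 j - c) / mu j < primitive g x" by linarith
  then show ?thesis using j(2) x by (simp add: field_simps)
qed

text \<open>The orbit of \<open>\<E> = c\<close> that starts where it meets the boundary \<open>c\<^sub>k\<close> of the annulus \<open>i\<close> on the
incoming side and arrives, after the transition time, where it meets the boundary \<open>c\<^sub>k\<close> of the annulus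
\<open>i + 1\<close> on the outgoing side. In the reflected picture for \<open>\<kappa> = III\<close> the abscissas change sign.\<close>

lemma transition_start:
  assumes pl: "planar hh (ff 0) HH (FF 0) C M RR" and \<kappa>: "\<kappa> \<in> {Q_I, Q_III}"
    and ad: "admissible g lam mu c1 c2 i c" and mu: "0 < mu i" "0 < mu (Suc i)" and cC: "c \<le> C"
    and ck: "ck = c1 \<or> ck = c2" and lt: "c1 i \<le> c2 i" "c1 (Suc i) \<le> c2 (Suc i)"
  defines "s \<equiv> orient \<kappa>" and "T \<equiv> transition_time h rm rp g lam mu ck i (q_pred \<kappa>) \<kappa> c"
  obtains q where
    "q \<in> upper_left (\<lambda>x. HH (s * x)) (\<lambda>x. FF 0 (s * x)) C"
    "energy (\<lambda>x. HH (s * x)) (\<lambda>x. FF 0 (s * x)) q = c"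
    "0 \<le> T"
    "\<And>r. 0 \<le> r \<Longrightarrow> r \<le> T \<Longrightarrow>
       0 < snd (flow (field (reflect s hh) (reflect s (ff 0))) q r)"
    "mu i * primitive g (s * fst q) = ck i - c"
    "0 \<le> fst (flow (field (reflect s hh) (reflect s (ff 0))) q (T))"
    "mu (Suc i) * primitive g (s * fst (flow (field (reflect s hh) (reflect s (ff 0))) q (T)))
       = ck (Suc i) - c"
proof -
  interpret planar hh "ff 0" HH "FF 0" C M RR by fact
  have s: "s = 1 \<or> s = -1" unfolding s_def by (rule orient_cases)
  interpret r: planar "reflect s hh" "reflect s (ff 0)" "\<lambda>x. HH (s * x)" "\<lambda>x. FF 0 (s * x)" C M RR by (rule planar_reflect[OF pl s])
  have c: "0 < c" "c \<le> c1 i" "c \<le> c1 (Suc i)" using ad by (auto simp: admissible_def)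
  define xl xr where "xl j = G_inv_minus g ((ck j - c) / mu j)" and "xr j = G_inv_plus g ((ck j - c) / mu j)" for j
  have X: "xl j \<le> 0" "mu j * primitive g (xl j) = ck j - c" "lam / 2 * (xl j)\<^sup>2 < c"
     "0 \<le> xr j" "mu j * primitive g (xr j) = ck j - c" "lam / 2 * (xr j)\<^sup>2 < c" if j: "j \<in> {i, Suc i}" for j
  proof -
    have m: "0 < mu j" using j mu by auto
    have "0 \<le> ck j - c" "ck j - c \<le> c2 j - c" using j c lt ck by auto
    then have "0 \<le> (ck j - c) / mu j" "(ck j - c) / mu j \<le> (c2 j - c) / mu j" using m by (simp_all add: divide_right_mono)
    moreover have "(c2 j - c) / mu j < primitive g (- sqrt (2 * c / lam))" "(c2 j - c) / mu j < primitive g (sqrt (2 * c / lam))"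
      using ad j by (auto simp: admissible_def)
    ultimately have k: "0 \<le> (ck j - c) / mu j" "(ck j - c) / mu j < primitive g (- sqrt (2 * c / lam))"
      "(ck j - c) / mu j < primitive g (sqrt (2 * c / lam))" by linarith+
    show "xl j \<le> 0" "mu j * primitive g (xl j) = ck j - c" "lam / 2 * (xl j)\<^sup>2 < c"
      using G_inv_minus_level[OF c(1) k(1,2)] m by (auto simp: xl_def)
    show "0 \<le> xr j" "mu j * primitive g (xr j) = ck j - c" "lam / 2 * (xr j)\<^sup>2 < c"
      using G_inv_plus_level[OF c(1) k(1,3)] m by (auto simp: xr_def)
  qed
  have F0: "FF 0 x < c" if "lam / 2 * x\<^sup>2 < c" for x
  proof -
    have "\<bar>x\<bar> < R" using level_in_box[of 0 x] that cC by (simp add: F_energy_def)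
    then show ?thesis using that by (simp add: FF_eq F_energy_def)
  qed
  define a b where "a = (if \<kappa> = Q_I then xl i else - xr i)" and "b = (if \<kappa> = Q_I then xr (Suc i) else - xl (Suc i))"
  have ab: "a \<le> 0" "0 \<le> b" "FF 0 (s * a) < c" "FF 0 (s * b) < c"
    using X(1,4)[of i] X(1,4)[of "Suc i"] F0[OF X(3)] F0[OF X(6)] \<kappa> by (auto simp: a_def b_def s_def orient_def)
  have g: "mu i * primitive g (s * a) = ck i - c" "mu (Suc i) * primitive g (s * b) = ck (Suc i) - c"
    using X[of i] X[of "Suc i"] \<kappa> by (auto simp: a_def b_def s_def orient_def)
  obtain q S where q: "q \<in> upper_left (\<lambda>x. HH (s * x)) (\<lambda>x. FF 0 (s * x)) C"
    "energy (\<lambda>x. HH (s * x)) (\<lambda>x. FF 0 (s * x)) q = c" "fst q = a" "0 \<le> S"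
    "fst (flow r.V q S) = b" "\<And>t. 0 \<le> t \<Longrightarrow> t \<le> S \<Longrightarrow> 0 < snd (flow r.V q t)"
    using r.upper_segment[OF c(1) cC ab(1) _ ab(3,4)] ab by auto
  define p where "p = s *\<^sub>R q"
  have sp: "q = s *\<^sub>R p" using s by (auto simp: p_def)
  have qr: "q \<in> region (\<lambda>x. HH (s * x)) (\<lambda>x. FF 0 (s * x)) C" using q(1) by (simp add: upper_left_def)
  have pD: "p \<in> D" using qr region_reflect(1)[OF s] unfolding sp by blast
  have pe: "energy HH (FF 0) p = c" using q(2) region_reflect(2)[OF s] unfolding sp by metis
  have fl: "flow r.V q t = s *\<^sub>R flow V p t" if "0 \<le> t" for t unfolding sp by (rule flow_reflect[OF pl s pD that])
  have T: "T = S"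
  proof (cases "S = 0")
    case True
    then have "a = b" using q(3,5) r.flow_0[OF qr] by simp
    then show ?thesis using True \<kappa> by (auto simp: T_def transition_time_def a_def b_def xl_def xr_def Let_def)
  next
    case False
    then have S: "0 < S" using q(4) by simp
    consider "\<kappa> = Q_I" | "\<kappa> = Q_III" using \<kappa> by blast
    then show ?thesis
    proof cases
      case 1
      then have [simp]: "s = 1" by (simp add: s_def orient_def)
      have "(LBINT u=fst p..fst (flow V p S). 1 / h (H_inv_plus h rp (energy HH (FF 0) p - F_energy g lam 0 u))) = S"
        by (rule upper_time[OF pl _ pD S]) (use q(6) fl in \<open>auto simp: less_imp_le\<close>)
      moreover have "fst p = xl i" "fst (flow V p S) = xr (Suc i)" using q(3,5) fl[of S] S 1 by (auto simp: p_def a_def b_def)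
      ultimately show ?thesis using 1 by (simp add: pe T_def transition_time_def xl_def xr_def F_energy_def Let_def)
    next
      case 2
      then have [simp]: "s = -1" by (simp add: s_def orient_def)
      have neg: "snd (flow V p t) < 0" if "0 \<le> t" "t \<le> S" for t using q(6)[OF that] fl[of t] that by simp
      have "(LBINT u=fst (flow V p S)..fst p. 1 / (- h (H_inv_minus h rm (energy HH (FF 0) p - F_energy g lam 0 u)))) = S"
        by (rule lower_time[OF pl _ pD S]) (use neg in \<open>auto simp: less_imp_le\<close>)
      moreover have "fst p = xr i" "fst (flow V p S) = xl (Suc i)" using q(3,5) fl[of S] S 2 by (auto simp: p_def a_def b_def)
      ultimately show ?thesis using 2 by (simp add: pe T_def transition_time_def xl_def xr_def F_energy_def Let_def)
    qed
  qed
  show thesis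
    by (rule that[of q]) (use q ab g in \<open>simp_all add: T\<close>)
qed

lemma En_split: "\<bar>fst z\<bar> \<le> R \<Longrightarrow> En mu z = En 0 z + mu * primitive g (fst z)"
  by (simp add: energy_def FF_eq F_energy_def)

text \<open>The hypotheses of \<open>transition_crossing\<close> hold: on the boundary point with \<open>x = 0\<close> both energies agree,
and on the one with \<open>y = 0\<close> admissibility keeps \<open>\<E>\<close> below both levels, since otherwise the point would
be outside the annulus.\<close>

lemma stage_linear:
  fixes p :: "real \<Rightarrow> real \<times> real"
  assumes pl: "planar hh (ff 0) HH (FF 0) C M RR" and \<kappa>: "\<kappa> \<in> {Q_I, Q_III}"
    and mu: "0 < mu i" "0 < mu (Suc i)"
    and lev: "0 < c1 i" "c1 i < c2 i" "c2 i \<le> C" "0 < c1 (Suc i)" "c1 (Suc i) < c2 (Suc i)" "c2 (Suc i) \<le> C"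
    and ad: "admissible g lam mu c1 c2 i dh" "admissible g lam mu c1 c2 i eh" "dh \<noteq> eh"
    and T: "transition_time h rm rp g lam mu c2 i (q_pred \<kappa>) \<kappa> eh \<le> \<tau>"
      "\<tau> \<le> transition_time h rm rp g lam mu c1 i (q_pred \<kappa>) \<kappa> dh"
    and p: "continuous_on {u..v} p" "u \<le> v"
      "\<And>\<sigma>. \<sigma> \<in> {u..v} \<Longrightarrow> p \<sigma> \<in> closed_quadrant (q_pred \<kappa>) \<and> En (mu i) (p \<sigma>) \<in> {c1 i..c2 i}"
      "fst (p u) = 0 \<and> snd (p v) = 0 \<or> snd (p u) = 0 \<and> fst (p v) = 0"
  obtains u' v' where "u \<le> u'" "u' \<le> v'" "v' \<le> v" "continuous_on {u'..v'} (\<lambda>\<sigma>. Fl 0 (p \<sigma>) \<tau>)"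
    "\<forall>\<sigma>\<in>{u'..v'}. p \<sigma> \<in> region HH (FF 0) C \<and> Fl 0 (p \<sigma>) \<tau> \<in> closed_quadrant \<kappa> \<and>
       En (mu (Suc i)) (Fl 0 (p \<sigma>) \<tau>) \<in> {c1 (Suc i)..c2 (Suc i)} \<and>
       (\<forall>r\<in>{0..\<tau>}. snd (Fl 0 (p \<sigma>) r) \<noteq> 0) \<and> (\<exists>!r. r \<in> {0..\<tau>} \<and> fst (Fl 0 (p \<sigma>) r) = 0)"
    "En (mu (Suc i)) (Fl 0 (p u') \<tau>) = c1 (Suc i) \<and> En (mu (Suc i)) (Fl 0 (p v') \<tau>) = c2 (Suc i) \<or>
     En (mu (Suc i)) (Fl 0 (p u') \<tau>) = c2 (Suc i) \<and> En (mu (Suc i)) (Fl 0 (p v') \<tau>) = c1 (Suc i)"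
proof -
  define s where "s = orient \<kappa>"
  have s: "s = 1 \<or> s = -1" unfolding s_def by (rule orient_cases)
  interpret planar hh "ff 0" HH "FF 0" C M RR by fact
  define h' f' H' F' where "h' = reflect s hh" and "f' = reflect s (ff 0)" and "H' = (\<lambda>x. HH (s * x))" and "F' = (\<lambda>x. FF 0 (s * x))"
  have pl': "planar h' f' H' F' C M RR" unfolding h'_def f'_def H'_def F'_def by (rule planar_reflect[OF pl s])
  interpret r: planar h' f' H' F' C M RR by (rule pl')
  have en': "energy H' F' (s *\<^sub>R z) = En 0 z" for z unfolding H'_def F'_def by (rule region_reflect(2)[OF s])
  have ss: "s * (s * x) = x" for x using s by auto
  have de: "max dh eh \<le> c1 i" "max dh eh \<le> c1 (Suc i)" "0 < dh" "0 < eh" using ad by (auto simp: admissible_def)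
  have adm: "admissible g lam mu c1 c2 i (min dh eh)" using ad by (simp add: min_def)
  note far = admissible_exits_annulus[OF adm]
  define T1 T2 where "T1 = transition_time h rm rp g lam mu c1 i (q_pred \<kappa>) \<kappa> dh"
    and "T2 = transition_time h rm rp g lam mu c2 i (q_pred \<kappa>) \<kappa> eh"
  have T': "T2 \<le> \<tau>" "\<tau> \<le> T1" using T by (simp_all add: T1_def T2_def)
  obtain q1 where q1: "q1 \<in> upper_left H' F' C" "energy H' F' q1 = dh"
    "\<And>r. 0 \<le> r \<Longrightarrow> r \<le> T1 \<Longrightarrow> 0 < snd (flow (field h' f') q1 r)"
    "mu i * primitive g (s * fst q1) = c1 i - dh"
    "0 \<le> fst (flow (field h' f') q1 (T1))"
    "mu (Suc i) * primitive g (s * fst (flow (field h' f') q1 (T1)))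
       = c1 (Suc i) - dh"
    unfolding h'_def f'_def H'_def F'_def s_def T1_def
    using transition_start[OF pl \<kappa> ad(1) mu, of c1] de lev by (smt (verit))
  obtain q2 where q2: "q2 \<in> upper_left H' F' C" "energy H' F' q2 = eh"
    "0 \<le> T2"
    "\<And>r. 0 \<le> r \<Longrightarrow> r \<le> T2 \<Longrightarrow> 0 < snd (flow (field h' f') q2 r)"
    "mu i * primitive g (s * fst q2) = c2 i - eh"
    "0 \<le> fst (flow (field h' f') q2 (T2))"
    "mu (Suc i) * primitive g (s * fst (flow (field h' f') q2 (T2)))
       = c2 (Suc i) - eh"
    unfolding h'_def f'_def H'_def F'_def s_def T2_def
    using transition_start[OF pl \<kappa> ad(2) mu, of c2] de lev by (smt (verit))
  have \<tau>: "0 \<le> \<tau>" using q2(3) T'(1) by simp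
  define G where "G x = primitive g (s * x)" for x
  have Gpos: "G x < G y" if "0 \<le> x" "x < y" for x y
    using s g.primitive_less[of x y] g.primitive_less_neg[of "- y" "- x"] that by (auto simp: G_def)
  have Gneg: "G y < G x" if "x < y" "y \<le> 0" for x y
    using s g.primitive_less[of "- y" "- x"] g.primitive_less_neg[of x y] that by (auto simp: G_def)
  have G0: "G 0 = 0" by (simp add: G_def)
  \<comment> \<open>\<open>\<mu> G\<close> with its sign changed for \<open>x < 0\<close>: strictly increasing, and equal to \<open>\<mu> G\<close> in the target
    quadrant\<close>
  define \<Phi> where "\<Phi> x = mu (Suc i) * (G (max x 0) - G (min x 0))" for x
  have \<Phi>pos: "\<Phi> x = mu (Suc i) * G x" if "0 \<le> x" for x using that by (simp add: \<Phi>_def G0 max_def min_def)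
  have Gc: "continuous_on UNIV G"
    unfolding G_def by (intro continuous_on_compose2[OF g.primitive_continuous[of UNIV]] continuous_intros) auto
  have \<Phi>c: "continuous_on UNIV \<Phi>"
    unfolding \<Phi>_def by (intro continuous_intros continuous_on_compose2[OF Gc]) auto
  have \<Phi>m: "strict_mono \<Phi>"
  proof (rule strict_monoI)
    fix x y :: real assume xy: "x < y"
    have "G (max x 0) \<le> G (max y 0)" "G (min y 0) \<le> G (min x 0)"
      "G (max x 0) < G (max y 0) \<or> G (min y 0) < G (min x 0)"
      using xy Gpos[of "max x 0" "max y 0"] Gneg[of "min x 0" "min y 0"]
      by (cases "x = 0"; cases "y = 0"; auto simp: max_def min_def)+
    then have "G (max x 0) - G (min x 0) < G (max y 0) - G (min y 0)" by linarith
    then show "\<Phi> x < \<Phi> y" using mu by (simp add: \<Phi>_def)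
  qed
  have box: "\<bar>fst (p \<sigma>)\<bar> \<le> R" "En (mu i) (p \<sigma>) = En 0 (p \<sigma>) + mu i * primitive g (fst (p \<sigma>))" if "\<sigma> \<in> {u..v}" for \<sigma>
  proof -
    show "\<bar>fst (p \<sigma>)\<bar> \<le> R" using energy_box(3)[of "mu i" "p \<sigma>"] p(3)[OF that] mu lev by auto
    then show "En (mu i) (p \<sigma>) = En 0 (p \<sigma>) + mu i * primitive g (fst (p \<sigma>))" by (rule En_split)
  qed
  have pD: "p \<sigma> \<in> D" if "\<sigma> \<in> {u..v}" for \<sigma>
  proof -
    have "En 0 (p \<sigma>) \<le> C" using box(2)[OF that] p(3)[OF that] mu lev g.primitive_nonneg[of "fst (p \<sigma>)"]
      by (smt (verit) atLeastAtMost_iff mult_nonneg_nonneg)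
    moreover have "p \<sigma> \<noteq> 0" using p(3)[OF that] lev box(2)[OF that] H_0 F_0 by (auto simp: energy_def)
    ultimately show ?thesis by (simp add: region_iff)
  qed
  have fl: "flow (field h' f') (s *\<^sub>R p \<sigma>) t = s *\<^sub>R Fl 0 (p \<sigma>) t" if "\<sigma> \<in> {u..v}" "0 \<le> t" for \<sigma> t
    unfolding h'_def f'_def by (rule flow_reflect[OF pl s pD[OF that(1)] that(2)])
  have axis: "En 0 (p \<sigma>) < min dh eh" if \<sigma>: "\<sigma> \<in> {u..v}" "snd (p \<sigma>) = 0" for \<sigma>
  proof (rule ccontr)
    have e: "En 0 (p \<sigma>) = lam / 2 * (fst (p \<sigma>))\<^sup>2" using \<sigma> box(1)[OF \<sigma>(1)] H_0 by (simp add: energy_def FF_eq F_energy_def)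
    assume "\<not> ?thesis"
    then have "c2 i < lam / 2 * (fst (p \<sigma>))\<^sup>2 + mu i * primitive g (fst (p \<sigma>))" using far[of i] e mu by auto
    then show False using box(2)[OF \<sigma>(1)] p(3)[OF \<sigma>(1)] e by auto
  qed
  have axis0: "max dh eh \<le> En 0 (p \<sigma>)" if \<sigma>: "\<sigma> \<in> {u..v}" "fst (p \<sigma>) = 0" for \<sigma>
    using box(2)[OF \<sigma>(1)] p(3)[OF \<sigma>(1)] \<sigma>(2) de by auto
  have quad: "fst (s *\<^sub>R p \<sigma>) \<le> 0" "0 \<le> snd (s *\<^sub>R p \<sigma>)" if "\<sigma> \<in> {u..v}" for \<sigma>
    using p(3)[OF that] quadrant_orient(2)[OF \<kappa>, of "p \<sigma>"] by (auto simp: s_def)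
  have Gp: "primitive g (fst (p \<sigma>)) = G (fst (s *\<^sub>R p \<sigma>))" for \<sigma> by (simp add: G_def ss)
  have cs: "continuous_on {u..v} (\<lambda>\<sigma>. s *\<^sub>R p \<sigma>)" by (intro continuous_intros p)
  define A where "A \<sigma> = energy H' F' (s *\<^sub>R p \<sigma>) + \<Phi> (r.X (s *\<^sub>R p \<sigma>) \<tau>)" for \<sigma>
  have "\<exists>u' v'. u \<le> u' \<and> u' \<le> v' \<and> v' \<le> v \<and>
    (\<forall>\<sigma>\<in>{u'..v'}. (\<forall>t\<in>{0..\<tau>}. 0 < r.Y (s *\<^sub>R p \<sigma>) t) \<and> 0 \<le> r.X (s *\<^sub>R p \<sigma>) \<tau> \<and>
        A \<sigma> \<in> {c1 (Suc i)..c2 (Suc i)}) \<and>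
    (A u' = c1 (Suc i) \<and> A v' = c2 (Suc i) \<or> A u' = c2 (Suc i) \<and> A v' = c1 (Suc i))"
  proof (rule r.transition_crossing[OF cs _ p(2) ad(3) de(2) lev(5) _ _ \<Phi>c \<Phi>m _ _ q2(1-3) T'(1) _ _ _ q1(1,2) T'(2) _ _])
    fix u' v' assume "u \<le> u'" "u' \<le> v'" "v' \<le> v"
      "\<And>\<sigma>. \<sigma> \<in> {u'..v'} \<Longrightarrow> (\<forall>t\<in>{0..\<tau>}. 0 < r.Y (s *\<^sub>R p \<sigma>) t) \<and> 0 \<le> r.X (s *\<^sub>R p \<sigma>) \<tau> \<and>
        energy H' F' (s *\<^sub>R p \<sigma>) + \<Phi> (r.X (s *\<^sub>R p \<sigma>) \<tau>) \<in> {c1 (Suc i)..c2 (Suc i)}"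
      "energy H' F' (s *\<^sub>R p u') + \<Phi> (r.X (s *\<^sub>R p u') \<tau>) = c1 (Suc i) \<and>
       energy H' F' (s *\<^sub>R p v') + \<Phi> (r.X (s *\<^sub>R p v') \<tau>) = c2 (Suc i) \<or>
     energy H' F' (s *\<^sub>R p u') + \<Phi> (r.X (s *\<^sub>R p u') \<tau>) = c2 (Suc i) \<and>
       energy H' F' (s *\<^sub>R p v') + \<Phi> (r.X (s *\<^sub>R p v') \<tau>) = c1 (Suc i)"
    then show ?thesis unfolding A_def by (intro exI[of _ u'] exI[of _ v']) simp
  next
    show "0 < r.Y q2 t" if "0 \<le> t" "t \<le> T2" for t
      using q2(4)[OF that] .
    show "0 < r.Y q1 t" if "0 \<le> t" "t \<le> T1" for t
      using q1(3)[OF that] .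
    show "s *\<^sub>R p \<sigma> \<in> region H' F' C \<and> fst (s *\<^sub>R p \<sigma>) \<le> 0 \<and> 0 \<le> snd (s *\<^sub>R p \<sigma>)" if "\<sigma> \<in> {u..v}" for \<sigma>
      using pD[OF that] region_reflect(1)[OF s, of "p \<sigma>" HH "FF 0" C] quad[OF that] by (simp add: H'_def F'_def)
    show "energy H' F' (s *\<^sub>R p u) \<le> min dh eh \<and> max dh eh \<le> energy H' F' (s *\<^sub>R p v) \<or>
       max dh eh \<le> energy H' F' (s *\<^sub>R p u) \<and> energy H' F' (s *\<^sub>R p v) \<le> min dh eh"
      unfolding en' using p(2,4) axis[of u] axis[of v] axis0[of u] axis0[of v] by auto
    show "0 < snd (s *\<^sub>R p \<sigma>)" if "\<sigma> \<in> {u..v}" "min dh eh \<le> energy H' F' (s *\<^sub>R p \<sigma>)" for \<sigma>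
      using axis[OF that(1)] that(2) quad[OF that(1)] s unfolding en' by (cases "snd (p \<sigma>) = 0") auto
    show "\<Phi> 0 = 0" by (simp add: \<Phi>_def)
    show "c2 (Suc i) < F' x + \<Phi> x" if x: "0 \<le> x" "min dh eh \<le> F' x" "F' x \<le> max dh eh" for x
    proof -
      have "FF 0 (s * x) \<le> C" using x(3) de(1) lev(2,3) unfolding F'_def by linarith
      then have "FF 0 (s * x) = lam / 2 * (s * x)\<^sup>2" using FF_box[of 0 "s * x"] by (simp add: FF_eq F_energy_def)
      then show ?thesis using far[of "Suc i" "s * x"] x mu by (simp add: F'_def \<Phi>pos G_def)
    qed
    show "c2 (Suc i) \<le> eh + \<Phi> (r.X q2 (T2))"
      using q2(6,7) by (simp add: \<Phi>pos G_def)
    show "dh + \<Phi> (r.X q1 (T1)) \<le> c1 (Suc i)"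
      using q1(5,6) by (simp add: \<Phi>pos G_def)
    have ul: "fst q1 \<le> 0" "fst q2 \<le> 0" using q1(1) q2(1) by (auto simp: upper_left_def)
    show "fst q2 \<le> fst (s *\<^sub>R p \<sigma>)" if "\<sigma> \<in> {u..v}" "energy H' F' (s *\<^sub>R p \<sigma>) = eh" for \<sigma>
    proof (rule ccontr)
      assume "\<not> ?thesis"
      then have "G (fst q2) < G (fst (s *\<^sub>R p \<sigma>))" using Gneg ul by auto
      then have "mu i * G (fst q2) < mu i * primitive g (fst (p \<sigma>))" unfolding Gp using mu by (intro mult_strict_left_mono) auto
      then show False using q2(5) box(2)[OF that(1)] p(3)[OF that(1)] that(2) unfolding en' G_def by auto
    qed
    show "fst (s *\<^sub>R p \<sigma>) \<le> fst q1" if "\<sigma> \<in> {u..v}" "energy H' F' (s *\<^sub>R p \<sigma>) = dh" for \<sigma>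
    proof (rule ccontr)
      assume "\<not> ?thesis"
      then have "G (fst (s *\<^sub>R p \<sigma>)) < G (fst q1)" using Gneg[of "fst q1" "fst (s *\<^sub>R p \<sigma>)"] quad[OF that(1)] by auto
      then have "mu i * primitive g (fst (p \<sigma>)) < mu i * G (fst q1)" unfolding Gp using mu by (intro mult_strict_left_mono) auto
      then show False using q1(4) box(2)[OF that(1)] p(3)[OF that(1)] that(2) unfolding en' G_def by auto
    qed
  qed
  then obtain u' v' where uvs: "u \<le> u' \<and> u' \<le> v' \<and> v' \<le> v \<and>
    (\<forall>\<sigma>\<in>{u'..v'}. (\<forall>t\<in>{0..\<tau>}. 0 < r.Y (s *\<^sub>R p \<sigma>) t) \<and> 0 \<le> r.X (s *\<^sub>R p \<sigma>) \<tau> \<and>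
        A \<sigma> \<in> {c1 (Suc i)..c2 (Suc i)}) \<and>
    (A u' = c1 (Suc i) \<and> A v' = c2 (Suc i) \<or> A u' = c2 (Suc i) \<and> A v' = c1 (Suc i))"
    by (elim exE)
  have uv': "u \<le> u'" "u' \<le> v'" "v' \<le> v"
    "\<And>\<sigma>. \<sigma> \<in> {u'..v'} \<Longrightarrow> (\<forall>t\<in>{0..\<tau>}. 0 < r.Y (s *\<^sub>R p \<sigma>) t) \<and> 0 \<le> r.X (s *\<^sub>R p \<sigma>) \<tau> \<and>
        A \<sigma> \<in> {c1 (Suc i)..c2 (Suc i)}"
    "A u' = c1 (Suc i) \<and> A v' = c2 (Suc i) \<or> A u' = c2 (Suc i) \<and> A v' = c1 (Suc i)"
    using uvs by simp_all
  have sub: "\<sigma> \<in> {u..v}" if "\<sigma> \<in> {u'..v'}" for \<sigma> using that uv' by auto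
  have final: "En (mu (Suc i)) (Fl 0 (p \<sigma>) \<tau>) = A \<sigma>" if \<sigma>: "\<sigma> \<in> {u'..v'}" for \<sigma>
  proof -
    note D = pD[OF sub[OF \<sigma>]]
    have "En 0 (Fl 0 (p \<sigma>) \<tau>) = En 0 (p \<sigma>)" by (rule flow_energy[OF D \<tau>])
    moreover from this have "\<bar>X (p \<sigma>) \<tau>\<bar> \<le> R" using energy_box(3)[of 0 "Fl 0 (p \<sigma>) \<tau>"] D by (auto simp: region_def)
    ultimately have 1: "En (mu (Suc i)) (Fl 0 (p \<sigma>) \<tau>) = En 0 (p \<sigma>) + mu (Suc i) * primitive g (X (p \<sigma>) \<tau>)"
      using En_split[of "Fl 0 (p \<sigma>) \<tau>" "mu (Suc i)"] by simp
    have "r.X (s *\<^sub>R p \<sigma>) \<tau> = s * X (p \<sigma>) \<tau>" using fl[OF sub[OF \<sigma>] \<tau>] by simp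
    moreover have "0 \<le> r.X (s *\<^sub>R p \<sigma>) \<tau>" using uv'(4)[OF \<sigma>] by simp
    ultimately have "\<Phi> (r.X (s *\<^sub>R p \<sigma>) \<tau>) = mu (Suc i) * primitive g (X (p \<sigma>) \<tau>)"
      using \<Phi>pos by (simp add: G_def ss)
    then show ?thesis using 1 by (simp add: A_def en')
  qed
  show thesis
  proof (rule that[OF uv'(1-3) _ ballI])
    show "continuous_on {u'..v'} (\<lambda>\<sigma>. Fl 0 (p \<sigma>) \<tau>)"
      by (rule continuous_on_flow) (use pD sub \<tau> uv' in \<open>auto intro: continuous_on_subset[OF p(1)] simp: continuous_on_const\<close>)
    show "En (mu (Suc i)) (Fl 0 (p u') \<tau>) = c1 (Suc i) \<and> En (mu (Suc i)) (Fl 0 (p v') \<tau>) = c2 (Suc i) \<or>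
      En (mu (Suc i)) (Fl 0 (p u') \<tau>) = c2 (Suc i) \<and> En (mu (Suc i)) (Fl 0 (p v') \<tau>) = c1 (Suc i)"
      using uv'(2,5) final[of u'] final[of v'] by auto
    fix \<sigma> assume \<sigma>: "\<sigma> \<in> {u'..v'}"
    note D = pD[OF sub[OF \<sigma>]] and f = fl[OF sub[OF \<sigma>]] and U = uv'(4)[OF \<sigma>]
    have pos: "0 < s * Y (p \<sigma>) t" if t: "t \<in> {0..\<tau>}" for t
    proof -
      have "0 < r.Y (s *\<^sub>R p \<sigma>) t" using U t by blast
      then show ?thesis using f[of t] t by simp
    qed
    have "0 < snd (s *\<^sub>R Fl 0 (p \<sigma>) \<tau>)" "0 \<le> fst (s *\<^sub>R Fl 0 (p \<sigma>) \<tau>)" using pos[of \<tau>] U f[OF \<tau>] \<tau> by auto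
    then have "Fl 0 (p \<sigma>) \<tau> \<in> closed_quadrant \<kappa>" using quadrant_orient(1)[OF \<kappa>] by (simp add: s_def)
    moreover have "\<forall>r\<in>{0..\<tau>}. snd (Fl 0 (p \<sigma>) r) \<noteq> 0" using pos by force
    moreover have "\<exists>!r. r \<in> {0..\<tau>} \<and> fst (Fl 0 (p \<sigma>) r) = 0"
    proof -
      let ?z = "s *\<^sub>R p \<sigma>"
      have zD: "?z \<in> region H' F' C" using D region_reflect(1)[OF s, of "p \<sigma>" HH "FF 0" C] by (simp add: H'_def F'_def)
      have inc: "r.X ?z a < r.X ?z b" if "0 \<le> a" "a < b" "b \<le> \<tau>" for a b
        by (rule r.X_increasing[OF zD that(1,2)]) (use U that in auto)
      have "r.X ?z 0 \<le> 0" "0 \<le> r.X ?z \<tau>" using quad[OF sub[OF \<sigma>]] zD U by auto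
      then obtain r where r: "0 \<le> r" "r \<le> \<tau>" "r.X ?z r = 0"
        using IVT'[of "r.X ?z" 0 0 \<tau>] \<tau> continuous_on_subset[OF r.flow_continuous(1)[OF zD], of "{0..\<tau>}"] by auto
      have ex: "\<exists>!r. r \<in> {0..\<tau>} \<and> r.X ?z r = 0"
      proof (rule ex1I[of _ r])
        fix r' assume r': "r' \<in> {0..\<tau>} \<and> r.X ?z r' = 0"
        show "r' = r"
        proof (rule ccontr)
          assume "r' \<noteq> r"
          then consider "r < r'" | "r' < r" by linarith
          then show False by cases (use inc[of r r'] inc[of r' r] r r' in simp_all)
        qed
      qed (use r in simp)
      have eq: "(r \<in> {0..\<tau>} \<and> r.X ?z r = 0) = (r \<in> {0..\<tau>} \<and> fst (Fl 0 (p \<sigma>) r) = 0)" for r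
        using f[of r] s by auto
      show ?thesis using ex unfolding eq .
    qed
    ultimately show "p \<sigma> \<in> region HH (FF 0) C \<and> Fl 0 (p \<sigma>) \<tau> \<in> closed_quadrant \<kappa> \<and>
       En (mu (Suc i)) (Fl 0 (p \<sigma>) \<tau>) \<in> {c1 (Suc i)..c2 (Suc i)} \<and>
       (\<forall>r\<in>{0..\<tau>}. snd (Fl 0 (p \<sigma>) r) \<noteq> 0) \<and> (\<exists>!r. r \<in> {0..\<tau>} \<and> fst (Fl 0 (p \<sigma>) r) = 0)"
      using D U unfolding final[OF \<sigma>] by (intro conjI) simp_all
  qed
qed

end

section \<open>Levels below the smaller limit of the potential\<close>

context momentum
begin

lemma limit_at_upper_end:
  fixes K :: "ereal \<Rightarrow> ereal"
  assumes mono: "\<And>z z'. 0 \<le> z \<Longrightarrow> z \<le> z' \<Longrightarrow> z' < b \<Longrightarrow> K z \<le> K z'" and b: "0 < (b::ereal)"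
  shows "Lim (at_left b) K = (SUP z\<in>{0..<b}. K z)"
proof (rule tendsto_Lim)
  show "at_left b \<noteq> bot"
    unfolding trivial_limit_def eventually_at_left[OF b] using dense by blast
  show "(K \<longlongrightarrow> (SUP z\<in>{0..<b}. K z)) (at_left b)"
  proof (rule order_tendstoI)
    fix x assume "x < (SUP z\<in>{0..<b}. K z)"
    then obtain z where z: "z \<in> {0..<b}" "x < K z" by (auto simp: less_SUP_iff)
    show "\<forall>\<^sub>F w in at_left b. x < K w"
      unfolding eventually_at_left[OF b]
      using z mono[of z] by (intro exI[of _ z]) (auto simp: less_imp_le intro: less_le_trans)
  next
    fix x assume x: "(SUP z\<in>{0..<b}. K z) < x"
    have "K w < x" if "0 < w" "w < b" for w
      using le_less_trans[OF SUP_upper[of w "{0..<b}" K] x] that by auto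
    then show "\<forall>\<^sub>F w in at_left b. K w < x"
      unfolding eventually_at_left[OF b] using b by blast
  qed
qed

lemma limit_at_lower_end:
  fixes K :: "ereal \<Rightarrow> ereal"
  assumes mono: "\<And>z z'. z \<le> 0 \<Longrightarrow> z' \<le> z \<Longrightarrow> b < z' \<Longrightarrow> K z \<le> K z'" and b: "(b::ereal) < 0"
  shows "Lim (at_right b) K = (SUP z\<in>{b<..0}. K z)"
proof (rule tendsto_Lim)
  show "at_right b \<noteq> bot"
    unfolding trivial_limit_def eventually_at_right[OF b] using dense by blast
  show "(K \<longlongrightarrow> (SUP z\<in>{b<..0}. K z)) (at_right b)"
  proof (rule order_tendstoI)
    fix x assume "x < (SUP z\<in>{b<..0}. K z)"
    then obtain z where z: "z \<in> {b<..0}" "x < K z" by (auto simp: less_SUP_iff)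
    show "\<forall>\<^sub>F w in at_right b. x < K w"
      unfolding eventually_at_right[OF b]
      using z mono[of z] by (intro exI[of _ z]) (auto simp: less_imp_le intro: less_le_trans)
  next
    fix x assume x: "(SUP z\<in>{b<..0}. K z) < x"
    have "K w < x" if "b < w" "w < 0" for w
      using le_less_trans[OF SUP_upper[of w "{b<..0}" K] x] that by auto
    then show "\<forall>\<^sub>F w in at_right b. K w < x"
      unfolding eventually_at_right[OF b] using b by blast
  qed
qed

text \<open>The potential is monotone on each side of \<open>0\<close>, so its limits at the ends are suprema and a level below
both is exceeded somewhere on each side.\<close>

lemma below_H_star:
  assumes C: "0 < C" "ereal C < H_star h rm rp"
  obtains ym yp where "rm < ereal ym" "ym < 0" "0 < yp" "ereal yp < rp" "C < primitive h ym" "C < primitive h yp"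
proof -
  define K where "K z = ereal (primitive h (real_of_ereal z))" for z
  have up: "K z \<le> K z'" if z: "0 \<le> z" "z \<le> z'" "z' < rp" for z z'
  proof -
    obtain x where x: "z = ereal x" using z by (cases z) auto
    obtain x' where x': "z' = ereal x'" using z by (cases z') auto
    show ?thesis using H_less[of x x'] z unfolding K_def x x' by (cases "x = x'") auto
  qed
  have lo: "K z \<le> K z'" if z: "z \<le> 0" "z' \<le> z" "rm < z'" for z z'
  proof -
    obtain x where x: "z = ereal x" using z by (cases z) auto
    obtain x' where x': "z' = ereal x'" using z by (cases z') auto
    show ?thesis using H_less_neg[of x' x] z unfolding K_def x x' by (cases "x = x'") auto
  qed
  have "ereal C < (SUP z\<in>{0..<rp}. K z)" "ereal C < (SUP z\<in>{rm<..0}. K z)"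
    using C(2) limit_at_upper_end[OF up rp] limit_at_lower_end[OF lo rm]
    unfolding H_star_def K_def[symmetric] by auto
  then obtain z z' where z: "z \<in> {0..<rp}" "ereal C < K z" and z': "z' \<in> {rm<..0}" "ereal C < K z'"
    unfolding less_SUP_iff by blast
  obtain x where x: "z = ereal x" using z by (cases z) auto
  obtain x' where x': "z' = ereal x'" using z' by (cases z') auto
  have "C < primitive h x" "C < primitive h x'" using z z' by (auto simp: K_def x x')
  moreover from this have "x \<noteq> 0" "x' \<noteq> 0" using C(1) by auto
  ultimately show thesis using that[of x' x] z z' x x' by auto
qed

end

section \<open>One stage of the itinerary\<close>

definition stage_nodal where
  "stage_nodal t s \<alpha> \<kappa> j i x y \<longleftrightarrow>
     card {u\<in>{t i<..<s i}. x u = (0::real)} = 2 * (\<alpha> i + j i) - (if \<kappa> (Suc i) = \<kappa> i then 1 else 0) \<and>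
     card {u\<in>{t i..s i}. y u = (0::real)} = 2 * (\<alpha> i + j i) + (if \<kappa> (Suc i) = \<kappa> i then 0 else 1) \<and>
     (\<exists>!u. u \<in> {s i..t (Suc i)::real} \<and> x u = 0) \<and> (\<forall>u\<in>{s i..t (Suc i)}. y u \<noteq> 0)"

lemma stage_nodal_cong:
  assumes "stage_nodal t s \<alpha> \<kappa> j i x y" "\<And>u. t i \<le> u \<Longrightarrow> u \<le> t (Suc i) \<Longrightarrow> x u = x' u \<and> y u = y' u"
    and "t i \<le> s i" "s i \<le> t (Suc i)"
  shows "stage_nodal t s \<alpha> \<kappa> j i x' y'"
proof -
  have "{u\<in>{t i<..<s i}. x u = 0} = {u\<in>{t i<..<s i}. x' u = 0}" "{u\<in>{t i..s i}. y u = 0} = {u\<in>{t i..s i}. y' u = 0}"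
    using assms(2-4) by auto
  moreover have "(u \<in> {s i..t (Suc i)} \<and> x u = 0) = (u \<in> {s i..t (Suc i)} \<and> x' u = 0)" for u
    using assms(2)[of u] assms(3,4) by auto
  moreover have "\<forall>u\<in>{s i..t (Suc i)}. y u = y' u" using assms(2-4) by auto
  ultimately show ?thesis using assms(1) unfolding stage_nodal_def by auto
qed

lemma card_shift:
  fixes a b :: real
  shows "card {u\<in>{a..b}. P (u - a)} = card {u\<in>{0..b - a}. P u}"
    "card {u\<in>{a<..<b}. P (u - a)} = card {u\<in>{0<..<b - a}. P u}"
proof -
  show "card {u\<in>{a..b}. P (u - a)} = card {u\<in>{0..b - a}. P u}"
    by (rule bij_betw_same_card[of "\<lambda>u. u - a"], rule bij_betw_byWitness[where f'="\<lambda>u. u + a"]) auto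
  show "card {u\<in>{a<..<b}. P (u - a)} = card {u\<in>{0<..<b - a}. P u}"
    by (rule bij_betw_same_card[of "\<lambda>u. u - a"], rule bij_betw_byWitness[where f'="\<lambda>u. u + a"]) auto
qed

text \<open>The annuli are bounded by one level \<open>C\<close>, so that the same box serves all stages.\<close>

locale switched = oscillator h rm rp g lam C ym yp R
  for h :: "real \<Rightarrow> real" and rm rp :: ereal and g :: "real \<Rightarrow> real" and lam C ym yp R :: real +
  fixes m :: nat and t s mu c1 c2 d e :: "nat \<Rightarrow> real" and a :: "real \<Rightarrow> real"
    and xm xp :: "nat \<Rightarrow> real \<Rightarrow> real" and \<alpha> \<beta> :: "nat \<Rightarrow> nat"
  assumes t0: "t 0 = 0" and ts: "i \<le> m \<Longrightarrow> t i < s i" and st: "i < m \<Longrightarrow> s i < t (Suc i)"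
    and mu: "i \<le> m \<Longrightarrow> mu i > 0"
    and weight: "i \<le> m \<Longrightarrow> u \<in> {t i..s i} \<Longrightarrow> a u = mu i" "i < m \<Longrightarrow> u \<in> {s i<..<t (Suc i)} \<Longrightarrow> a u = 0"
    and uniqueness: "i \<le> m \<Longrightarrow> unique_ivp_solutions h rm rp g lam (\<lambda>_. mu i)"
      "unique_ivp_solutions h rm rp g lam (\<lambda>_. 0)"
    and levels: "i \<le> m \<Longrightarrow> 0 < c1 i \<and> c1 i < c2 i \<and> c2 i \<le> C"
    and turning: "i \<le> m \<Longrightarrow> c \<in> {c1 i..c2 i} \<Longrightarrow> xm i c < 0 \<and> 0 < xp i c \<and>
         F_energy g lam (mu i) (xm i c) = c \<and> F_energy g lam (mu i) (xp i c) = c"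
    and twist: "i \<le> m \<Longrightarrow> d i \<in> {c1 i, c2 i} \<and> e i \<in> {c1 i, c2 i} \<and> d i \<noteq> e i"
      "i \<le> m \<Longrightarrow> \<kappa> \<in> {Q_I, Q_III} \<Longrightarrow>
        quadrant_time h rm rp g lam (mu i) (xm i (d i)) (xp i (d i)) (q_succ \<kappa>) (d i)
        + quadrant_time h rm rp g lam (mu i) (xm i (d i)) (xp i (d i)) (q_succ (q_succ \<kappa>)) (d i)
        + real (\<alpha> i) * period h rm rp g lam (mu i) (xm i (d i)) (xp i (d i)) (d i)
          > s i - t i"
      "i \<le> m \<Longrightarrow> \<kappa> \<in> {Q_I, Q_III} \<Longrightarrow>
        quadrant_time h rm rp g lam (mu i) (xm i (e i)) (xp i (e i)) \<kappa> (e i)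
        + quadrant_time h rm rp g lam (mu i) (xm i (e i)) (xp i (e i)) (q_succ \<kappa>) (e i)
        + real (\<beta> i) * period h rm rp g lam (mu i) (xm i (e i)) (xp i (e i)) (e i)
          < s i - t i"
    and transition: "i < m \<Longrightarrow> \<kappa> \<in> {Q_I, Q_III} \<Longrightarrow> \<exists>dh eh. dh \<noteq> eh \<and>
        admissible g lam mu c1 c2 i dh \<and> admissible g lam mu c1 c2 i eh \<and>
        transition_time h rm rp g lam mu c2 i (q_pred \<kappa>) \<kappa> eh \<le> t (Suc i) - s i \<and>
        t (Suc i) - s i \<le> transition_time h rm rp g lam mu c1 i (q_pred \<kappa>) \<kappa> dh"
begin

abbreviation "AQ i \<equiv> annulus_quadrant h rm rp g lam (mu i) (c1 i) (c2 i)"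

lemma AQ_iff: "i \<le> m \<Longrightarrow> p \<in> AQ i \<kappa> \<longleftrightarrow> p \<in> closed_quadrant \<kappa> \<and> En (mu i) p \<in> {c1 i..c2 i}"
  unfolding annulus_quadrant_def using annulus_iff[of "mu i" "c2 i" p "c1 i"] mu[of i] levels[of i] by auto

definition crossing :: "nat \<Rightarrow> quadrant \<Rightarrow> real \<Rightarrow> real \<Rightarrow> (real \<Rightarrow> real \<times> real) \<Rightarrow> bool" where
  "crossing i \<kappa> u v P \<longleftrightarrow> u \<le> v \<and> continuous_on {u..v} P \<and> (\<forall>\<sigma>\<in>{u..v}. P \<sigma> \<in> AQ i \<kappa>) \<and>
     (En (mu i) (P u) = c1 i \<and> En (mu i) (P v) = c2 i \<or> En (mu i) (P u) = c2 i \<and> En (mu i) (P v) = c1 i)"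

abbreviation "arrival i p \<equiv> Fl (mu i) p (s i - t i)"

definition lands :: "nat \<Rightarrow> quadrant \<Rightarrow> quadrant \<Rightarrow> nat \<Rightarrow> real \<times> real \<Rightarrow> bool" where
  "lands i \<kappa> q j p \<longleftrightarrow> En (mu i) (arrival i p) \<in> {c1 i..c2 i} \<and> arrival i p \<in> closed_quadrant q \<and>
     p \<in> region HH (FF (mu i)) C \<and>
     seg_sol h rm rp g lam a (t i) (s i) (\<lambda>r. fst (Fl (mu i) p (r - t i))) (\<lambda>r. snd (Fl (mu i) p (r - t i))) \<and>
     card {r\<in>{t i<..<s i}. fst (Fl (mu i) p (r - t i)) = 0} = 2 * (\<alpha> i + j) - (if q = q_pred \<kappa> then 1 else 0) \<and>
     card {r\<in>{t i..s i}. snd (Fl (mu i) p (r - t i)) = 0} = 2 * (\<alpha> i + j) + (if q = q_pred \<kappa> then 0 else 1)"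

lemma seg_sol_flow:
  assumes pl: "planar hh (ff \<nu>) HH (FF \<nu>) C M RR" and nu: "0 \<le> \<nu>" and p: "p \<in> region HH (FF \<nu>) C"
    and ab: "x0 \<le> x1" and w: "\<And>u. x0 < u \<Longrightarrow> u < x1 \<Longrightarrow> w u = \<nu>"
  shows "seg_sol h rm rp g lam w x0 x1 (\<lambda>u. fst (Fl \<nu> p (u - x0))) (\<lambda>u. snd (Fl \<nu> p (u - x0)))"
proof -
  interpret planar hh "ff \<nu>" HH "FF \<nu>" C M RR by fact
  have "seg_sol h rm rp g lam (\<lambda>_. \<nu>) x0 (x0 + (x1 - x0)) (\<lambda>u. fst (Fl \<nu> p (u - x0))) (\<lambda>u. snd (Fl \<nu> p (u - x0)))"
    by (rule seg_sol_ode_sol[OF nu flow_sol[OF p]]) (use p in \<open>simp add: region_def\<close>)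
  then have "seg_sol h rm rp g lam (\<lambda>_. \<nu>) x0 x1 (\<lambda>u. fst (Fl \<nu> p (u - x0))) (\<lambda>u. snd (Fl \<nu> p (u - x0)))"
    by simp
  then show ?thesis
    by (rule seg_sol_cong[where S="{x0, x1}"]) (use w in \<open>auto simp: less_le\<close>)
qed

text \<open>The target \<open>q\<close> is reached with \<open>n\<close> zeroes of \<open>x\<close>, where \<open>n = 2(\<alpha> + j) - 1\<close> for the predecessor
of \<open>\<kappa>\<close> and \<open>n = 2(\<alpha> + j)\<close> for the successor. These are exactly the values for which \<open>2n + 1\<close>
lies between \<open>4\<alpha> + 3\<close> and \<open>4\<beta> + 1\<close>.\<close>

lemma stretch:
  assumes i: "i \<le> m" and \<kappa>: "\<kappa> \<in> {Q_I, Q_III}" and j: "1 \<le> j" "j \<le> \<beta> i - \<alpha> i" and P: "crossing i \<kappa> u v P"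
    and q: "q \<in> {q_pred \<kappa>, q_succ \<kappa>}"
  obtains u' v' where "u \<le> u'" "u' \<le> v'" "v' \<le> v" "continuous_on {u'..v'} (\<lambda>\<sigma>. arrival i (P \<sigma>))"
    "\<forall>\<sigma>\<in>{u'..v'}. lands i \<kappa> q j (P \<sigma>)"
    "fst (arrival i (P u')) = 0 \<and> snd (arrival i (P v')) = 0 \<or>
     snd (arrival i (P u')) = 0 \<and> fst (arrival i (P v')) = 0"
proof -
  have mu0: "0 \<le> mu i" using mu[OF i] by simp
  obtain M where pl: "planar hh (ff (mu i)) HH (FF (mu i)) C M RR"
    using planar_oscillator[OF mu0 uniqueness(1)[OF i]] by blast
  note L = levels[OF i]
  define n where "n = 2 * (\<alpha> i + j) - (if q = q_pred \<kappa> then 1 else 0)"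
  have N: "3 + 4 * \<alpha> i \<le> 2 * n + 1" "2 * n + 1 \<le> 4 * \<beta> i + 1" using j by (auto simp: n_def)
  have n1: "n + 1 = 2 * (\<alpha> i + j) + (if q = q_pred \<kappa> then 0 else 1)" using j by (auto simp: n_def)
  have ne: "q_pred \<kappa> \<noteq> q_succ \<kappa>" using \<kappa> by auto
  have qn: "(if even n then q_succ \<kappa> else q_pred \<kappa>) = q" using q j ne by (auto simp: n_def)
  have \<tau>: "0 \<le> s i - t i" using ts[OF i] by simp
  have Pc: "continuous_on {u..v} P" "u \<le> v"
    "\<And>\<sigma>. \<sigma> \<in> {u..v} \<Longrightarrow> P \<sigma> \<in> closed_quadrant \<kappa> \<and> En (mu i) (P \<sigma>) \<in> {c1 i..c2 i}"
    "En (mu i) (P u) = c1 i \<and> En (mu i) (P v) = c2 i \<or> En (mu i) (P u) = c2 i \<and> En (mu i) (P v) = c1 i"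
    using P AQ_iff[OF i] by (auto simp: crossing_def)
  have x: "xm i c < 0 \<and> 0 < xp i c \<and> F_energy g lam (mu i) (xm i c) = c \<and> F_energy g lam (mu i) (xp i c) = c"
    if "c \<in> {c1 i, c2 i}" for c using turning[OF i, of c] that L by auto
  obtain u' v' where uv': "u \<le> u'" "u' \<le> v'" "v' \<le> v" "continuous_on {u'..v'} (\<lambda>\<sigma>. arrival i (P \<sigma>))"
    "\<forall>\<sigma>\<in>{u'..v'}. En (mu i) (arrival i (P \<sigma>)) \<in> {c1 i..c2 i} \<and>
       arrival i (P \<sigma>) \<in> closed_quadrant (if even n then q_succ \<kappa> else q_pred \<kappa>) \<and>
       card {u\<in>{0..s i - t i}. snd (Fl (mu i) (P \<sigma>) u) = 0} = n + 1 \<and>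
       card {u\<in>{0<..<s i - t i}. fst (Fl (mu i) (P \<sigma>) u) = 0} = n"
    "fst (arrival i (P u')) = 0 \<and> snd (arrival i (P v')) = 0 \<or>
     snd (arrival i (P u')) = 0 \<and> fst (arrival i (P v')) = 0"
    by (rule stage_nonlinear[OF pl mu0 L[THEN conjunct1] L[THEN conjunct2, THEN conjunct1] L[THEN conjunct2, THEN conjunct2]
        x twist(1)[OF i, THEN conjunct1] twist(1)[OF i, THEN conjunct2, THEN conjunct1] twist(1)[OF i, THEN conjunct2, THEN conjunct2]
        \<kappa> twist(2)[OF i \<kappa>] twist(3)[OF i \<kappa>] \<tau> N Pc])
  show thesis
  proof (rule that[OF uv'(1-4) ballI uv'(6)])
    fix \<sigma> assume \<sigma>: "\<sigma> \<in> {u'..v'}"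
    have reg: "P \<sigma> \<in> region HH (FF (mu i)) C" using Pc(3)[of \<sigma>] \<sigma> uv'(1,3) L by (auto simp: region_def)
    have "seg_sol h rm rp g lam a (t i) (s i) (\<lambda>r. fst (Fl (mu i) (P \<sigma>) (r - t i))) (\<lambda>r. snd (Fl (mu i) (P \<sigma>) (r - t i)))"
      by (rule seg_sol_flow[OF pl mu0 reg]) (use ts[OF i] weight(1)[OF i] in auto)
    then show "lands i \<kappa> q j (P \<sigma>)"
      using bspec[OF uv'(5) \<sigma>] reg unfolding qn lands_def
      by (simp only: card_shift(1)[of "t i" "s i" "\<lambda>r. snd (Fl (mu i) (P \<sigma>) r) = 0"]
        card_shift(2)[of "t i" "s i" "\<lambda>r. fst (Fl (mu i) (P \<sigma>) r) = 0"] n1[symmetric] n_def[symmetric] simp_thms)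
  qed
qed

text \<open>To continue in quadrant \<open>\<kappa> (Suc i)\<close> the image has to be in its predecessor at time \<open>s i\<close>. This is
the predecessor of \<open>\<kappa> i\<close> if both agree and the successor otherwise.\<close>

lemma stage:
  assumes i: "i < m" and \<kappa>: "\<kappa> i \<in> {Q_I, Q_III}" "\<kappa> (Suc i) \<in> {Q_I, Q_III}"
    and j: "1 \<le> j i" "j i \<le> \<beta> i - \<alpha> i" and P: "crossing i (\<kappa> i) u v P"
  obtains u' v' P' where "u \<le> u'" "v' \<le> v" "crossing (Suc i) (\<kappa> (Suc i)) u' v' P'"
    "\<And>\<sigma>. \<sigma> \<in> {u'..v'} \<Longrightarrow> \<exists>x y. seg_sol h rm rp g lam a (t i) (t (Suc i)) x y \<and>
       (x (t i), y (t i)) = P \<sigma> \<and> (x (t (Suc i)), y (t (Suc i))) = P' \<sigma> \<and> stage_nodal t s \<alpha> \<kappa> j i x y"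
proof -
  have im: "i \<le> m" "Suc i \<le> m" using i by auto
  define q where "q = q_pred (\<kappa> (Suc i))"
  have q: "q \<in> {q_pred (\<kappa> i), q_succ (\<kappa> i)}" using \<kappa> by (auto simp: q_def)
  have qe: "q = q_pred (\<kappa> i) \<longleftrightarrow> \<kappa> (Suc i) = \<kappa> i" using \<kappa> by (auto simp: q_def)
  let ?W = "\<lambda>\<sigma>. arrival i (P \<sigma>)"
  obtain u1 v1 where 1: "u \<le> u1" "u1 \<le> v1" "v1 \<le> v" "continuous_on {u1..v1} ?W"
    "\<forall>\<sigma>\<in>{u1..v1}. lands i (\<kappa> i) q (j i) (P \<sigma>)"
    "fst (?W u1) = 0 \<and> snd (?W v1) = 0 \<or> snd (?W u1) = 0 \<and> fst (?W v1) = 0"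
    by (rule stretch[OF im(1) \<kappa>(1) j P q])
  obtain M0 where pl0: "planar hh (ff 0) HH (FF 0) C M0 RR"
    using planar_oscillator[OF order_refl uniqueness(2)] by blast
  obtain M where pl: "planar hh (ff (mu i)) HH (FF (mu i)) C M RR"
    using planar_oscillator[OF _ uniqueness(1)[OF im(1)]] mu[OF im(1)] by auto
  obtain dh eh where de: "dh \<noteq> eh" "admissible g lam mu c1 c2 i dh" "admissible g lam mu c1 c2 i eh"
    "transition_time h rm rp g lam mu c2 i (q_pred (\<kappa> (Suc i))) (\<kappa> (Suc i)) eh \<le> t (Suc i) - s i"
    "t (Suc i) - s i \<le> transition_time h rm rp g lam mu c1 i (q_pred (\<kappa> (Suc i))) (\<kappa> (Suc i)) dh"
    using transition[OF i \<kappa>(2)] by blast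
  let ?P' = "\<lambda>\<sigma>. Fl 0 (?W \<sigma>) (t (Suc i) - s i)"
  have W: "?W \<sigma> \<in> closed_quadrant (q_pred (\<kappa> (Suc i))) \<and> En (mu i) (?W \<sigma>) \<in> {c1 i..c2 i}" if "\<sigma> \<in> {u1..v1}" for \<sigma>
    using bspec[OF 1(5) that, unfolded lands_def] by (simp add: q_def)
  note L = levels[OF im(1)] levels[OF im(2)]
  obtain u2 v2 where 2: "u1 \<le> u2" "u2 \<le> v2" "v2 \<le> v1" "continuous_on {u2..v2} ?P'"
    "\<forall>\<sigma>\<in>{u2..v2}. ?W \<sigma> \<in> region HH (FF 0) C \<and> ?P' \<sigma> \<in> closed_quadrant (\<kappa> (Suc i)) \<and>
       En (mu (Suc i)) (?P' \<sigma>) \<in> {c1 (Suc i)..c2 (Suc i)} \<and>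
       (\<forall>r\<in>{0..t (Suc i) - s i}. snd (Fl 0 (?W \<sigma>) r) \<noteq> 0) \<and> (\<exists>!r. r \<in> {0..t (Suc i) - s i} \<and> fst (Fl 0 (?W \<sigma>) r) = 0)"
    "En (mu (Suc i)) (?P' u2) = c1 (Suc i) \<and> En (mu (Suc i)) (?P' v2) = c2 (Suc i) \<or>
     En (mu (Suc i)) (?P' u2) = c2 (Suc i) \<and> En (mu (Suc i)) (?P' v2) = c1 (Suc i)"
    by (rule stage_linear[where ?c1.0=c1 and ?c2.0=c2 and mu=mu and i=i, OF pl0 \<kappa>(2) mu[OF im(1)] mu[OF im(2)]
        L(1)[THEN conjunct1] L(1)[THEN conjunct2, THEN conjunct1] L(1)[THEN conjunct2, THEN conjunct2]
        L(2)[THEN conjunct1] L(2)[THEN conjunct2, THEN conjunct1] L(2)[THEN conjunct2, THEN conjunct2]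
        de(2,3,1,4,5) 1(4,2) W 1(6)])
  show thesis
  proof (rule that[of u2 v2 ?P'])
    show "u \<le> u2" "v2 \<le> v" using 1 2 by auto
    show "crossing (Suc i) (\<kappa> (Suc i)) u2 v2 ?P'"
      unfolding crossing_def using 2(2,4,6) 2(5) AQ_iff[OF im(2)] by blast
    fix \<sigma> assume \<sigma>: "\<sigma> \<in> {u2..v2}"
    have \<sigma>1: "\<sigma> \<in> {u1..v1}" using \<sigma> 2 by auto
    note A = bspec[OF 1(5) \<sigma>1, unfolded lands_def] and B = bspec[OF 2(5) \<sigma>]
    interpret n: planar hh "ff (mu i)" HH "FF (mu i)" C M RR by (rule pl)
    interpret l: planar hh "ff 0" HH "FF 0" C M0 RR by (rule pl0)
    define x1 y1 where "x1 r = fst (Fl (mu i) (P \<sigma>) (r - t i))" and "y1 r = snd (Fl (mu i) (P \<sigma>) (r - t i))" for r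
    define x2 y2 where "x2 r = fst (Fl 0 (?W \<sigma>) (r - s i))" and "y2 r = snd (Fl 0 (?W \<sigma>) (r - s i))" for r
    have s1: "seg_sol h rm rp g lam a (t i) (s i) x1 y1" using A unfolding x1_def[abs_def] y1_def[abs_def] by blast
    have s2: "seg_sol h rm rp g lam a (s i) (t (Suc i)) x2 y2"
      unfolding x2_def[abs_def] y2_def[abs_def]
      by (rule seg_sol_flow[OF pl0 order_refl]) (use B st[OF i] weight(2)[OF i] in auto)
    have m: "x1 (s i) = x2 (s i)" "y1 (s i) = y2 (s i)"
      using B by (auto simp: x1_def y1_def x2_def y2_def)
    note ord = ts[OF im(1)] st[OF i]
    define x y where "x r = (if r \<le> s i then x1 r else x2 r)" and "y r = (if r \<le> s i then y1 r else y2 r)" for r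
    have "seg_sol h rm rp g lam a (t i) (t (Suc i)) x y"
      unfolding x_def[abs_def] y_def[abs_def] by (rule seg_sol_glue[OF s1 s2 m]) (use ord in auto)
    moreover have "(x (t i), y (t i)) = P \<sigma>" using ord A by (simp add: x_def y_def x1_def y1_def)
    moreover have "(x (t (Suc i)), y (t (Suc i))) = ?P' \<sigma>" using ord by (simp add: x_def y_def x2_def y2_def)
    moreover have "stage_nodal t s \<alpha> \<kappa> j i x y"
    proof -
      have e1: "x r = x1 r" "y r = y1 r" if "r \<le> s i" for r using that by (auto simp: x_def y_def)
      have e2: "x r = x2 r" "y r = y2 r" if "s i \<le> r" for r using that m by (auto simp: x_def y_def order_antisym)
      have "{r\<in>{t i<..<s i}. x r = 0} = {r\<in>{t i<..<s i}. fst (Fl (mu i) (P \<sigma>) (r - t i)) = 0}"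
        "{r\<in>{t i..s i}. y r = 0} = {r\<in>{t i..s i}. snd (Fl (mu i) (P \<sigma>) (r - t i)) = 0}"
        using e1 by (auto simp: x1_def y1_def)
      moreover have "\<forall>r\<in>{s i..t (Suc i)}. y r \<noteq> 0" using B e2(2) by (auto simp: y2_def)
      moreover have "\<exists>!r. r \<in> {s i..t (Suc i)} \<and> x r = 0"
      proof -
        obtain r where r: "r \<in> {0..t (Suc i) - s i}" "fst (Fl 0 (?W \<sigma>) r) = 0"
          "\<And>r'. r' \<in> {0..t (Suc i) - s i} \<Longrightarrow> fst (Fl 0 (?W \<sigma>) r') = 0 \<Longrightarrow> r' = r" using B by blast
        show ?thesis
        proof (rule ex1I[of _ "r + s i"])
          show "r + s i \<in> {s i..t (Suc i)} \<and> x (r + s i) = 0" using r(1,2) e2(1)[of "r + s i"] by (auto simp: x2_def)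
          fix r' assume "r' \<in> {s i..t (Suc i)} \<and> x r' = 0"
          then show "r' = r + s i" using r(3)[of "r' - s i"] e2(1)[of r'] by (auto simp: x2_def)
        qed
      qed
      ultimately show ?thesis unfolding stage_nodal_def using A by (simp add: qe)
    qed
    ultimately show "\<exists>x y. seg_sol h rm rp g lam a (t i) (t (Suc i)) x y \<and>
       (x (t i), y (t i)) = P \<sigma> \<and> (x (t (Suc i)), y (t (Suc i))) = ?P' \<sigma> \<and> stage_nodal t s \<alpha> \<kappa> j i x y" by blast
  qed
qed

lemma final_stage:
  assumes \<kappa>: "\<kappa> \<in> {Q_I, Q_III}" and j: "1 \<le> j" "j \<le> \<beta> m - \<alpha> m" and P: "crossing m \<kappa> u v P"
    and q: "q \<in> {Q_II, Q_IV}" and rL: "crossing_arc h rm rp g lam (mu m) (c1 m) (c2 m) rL" "rL \<subseteq> AQ m q"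
  obtains \<sigma> x y where "\<sigma> \<in> {u..v}" "seg_sol h rm rp g lam a (t m) (s m) x y" "(x (t m), y (t m)) = P \<sigma>" "(x (s m), y (s m)) \<in> rL"
    "card {r\<in>{t m<..<s m}. x r = 0} = 2 * (\<alpha> m + j) - (if q = q_pred \<kappa> then 1 else 0)"
    "card {r\<in>{t m..s m}. y r = 0} = 2 * (\<alpha> m + j) + (if q = q_pred \<kappa> then 0 else 1)"
proof -
  let ?W = "\<lambda>\<sigma>. arrival m (P \<sigma>)"
  have q': "q \<in> {q_pred \<kappa>, q_succ \<kappa>}" using q \<kappa> by auto
  have mm: "m \<le> m" by simp
  obtain u1 v1 where 1: "u \<le> u1" "u1 \<le> v1" "v1 \<le> v" "continuous_on {u1..v1} ?W"
    "\<forall>\<sigma>\<in>{u1..v1}. lands m \<kappa> q j (P \<sigma>)"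
    "fst (?W u1) = 0 \<and> snd (?W v1) = 0 \<or> snd (?W u1) = 0 \<and> fst (?W v1) = 0"
    by (rule stretch[OF mm \<kappa> j P q'])
  have mu0: "0 \<le> mu m" using mu[of m] by simp
  obtain M where pl: "planar hh (ff (mu m)) HH (FF (mu m)) C M RR"
    using planar_oscillator[OF mu0 uniqueness(1)] by auto
  interpret n: planar hh "ff (mu m)" HH "FF (mu m)" C M RR by (rule pl)
  note L = levels[OF mm]
  obtain \<gamma> where \<gamma>: "arc \<gamma>" "path_image \<gamma> = rL" "nonlinear_energy h g lam (mu m) (pathstart \<gamma>) = c1 m"
     "nonlinear_energy h g lam (mu m) (pathfinish \<gamma>) = c2 m"
    using rL(1) unfolding crossing_arc_def by blast
  have path: "path \<gamma>" using \<gamma>(1) by (rule arc_imp_path)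
  have \<gamma>q: "\<gamma> r \<in> closed_quadrant q \<and> En (mu m) (\<gamma> r) \<in> {c1 m..c2 m}" if "r \<in> {0..1}" for r
  proof -
    have "\<gamma> r \<in> AQ m q" using rL(2) \<gamma>(2) that unfolding path_image_def by blast
    then show ?thesis using AQ_iff[OF mm] by blast
  qed
  have ends: "En (mu m) (pathstart \<gamma>) = c1 m" "En (mu m) (pathfinish \<gamma>) = c2 m"
    using \<gamma>(3,4) energy_box(5)[OF mu0, of "\<gamma> 0"] energy_box(5)[OF mu0, of "\<gamma> 1"] \<gamma>q[of 0] \<gamma>q[of 1] L
    unfolding pathstart_def pathfinish_def by auto
  have "\<exists>\<sigma>\<in>{u1..v1}. \<exists>r\<in>{0..1}. ?W \<sigma> = \<gamma> r"
  proof (rule n.quadrant_paths_meet[OF q 1(4,2) _ 1(6) path \<gamma>q ends])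
    show "?W \<sigma> \<in> closed_quadrant q \<and> En (mu m) (?W \<sigma>) \<in> {c1 m..c2 m}" if "\<sigma> \<in> {u1..v1}" for \<sigma>
      using bspec[OF 1(5) that] by (simp add: lands_def)
  qed (use L in auto)
  then obtain \<sigma> r where \<sigma>: "\<sigma> \<in> {u1..v1}" "r \<in> {0..1}" "?W \<sigma> = \<gamma> r" by blast
  note A = bspec[OF 1(5) \<sigma>(1), unfolded lands_def]
  show thesis
  proof (rule that[of \<sigma> "\<lambda>r. fst (Fl (mu m) (P \<sigma>) (r - t m))" "\<lambda>r. snd (Fl (mu m) (P \<sigma>) (r - t m))"])
    show "\<sigma> \<in> {u..v}" using \<sigma>(1) 1 by auto
    show "(fst (?W \<sigma>), snd (?W \<sigma>)) \<in> rL" using \<sigma>(2,3) \<gamma>(2) by (auto simp: path_image_def)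
    show "(fst (Fl (mu m) (P \<sigma>) (t m - t m)), snd (Fl (mu m) (P \<sigma>) (t m - t m))) = P \<sigma>" using A by simp
  qed (use A in auto)
qed

end

section \<open>Existence and number of solutions\<close>

lemma nodal_cong_index:
  assumes "\<And>i. i \<le> m \<Longrightarrow> \<kappa> i = \<kappa>' i" "\<And>i. i \<le> m \<Longrightarrow> j i = j' i"
  shows "nodal m t s \<alpha> qL \<kappa> j x y \<longleftrightarrow> nodal m t s \<alpha> qL \<kappa>' j' x y"
  unfolding nodal_def using assms by (simp add: less_imp_le Suc_leI)

context switched
begin

lemma t_mono: "i \<le> k \<Longrightarrow> k \<le> m \<Longrightarrow> t i \<le> t k"
proof (induction k)
  case (Suc k)
  then show ?case using ts[of k] st[of k] by (cases "i = Suc k") auto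
qed simp

lemma t_nonneg: "i \<le> m \<Longrightarrow> 0 \<le> t i"
  using t_mono[of 0 i] t0 by simp

lemma s_mono: "i < k \<Longrightarrow> k \<le> m \<Longrightarrow> s i < t k"
  using st[of i] t_mono[of "Suc i" k] by simp

lemma s_le: "i \<le> m \<Longrightarrow> s i \<le> s m"
  using s_mono[of i m] ts[of m] by (cases "i = m") auto

lemma nodal_cong:
  assumes "nodal m t s \<alpha> qL \<kappa> j x y" "\<And>u. 0 \<le> u \<Longrightarrow> u \<le> s m \<Longrightarrow> x u = x' u \<and> y u = y' u"
  shows "nodal m t s \<alpha> qL \<kappa> j x' y'"
proof -
  have C: "card {u\<in>{t i<..<s i}. x' u = 0} = card {u\<in>{t i<..<s i}. x u = 0}"
    "card {u\<in>{t i..s i}. y' u = 0} = card {u\<in>{t i..s i}. y u = 0}" if "i \<le> m" for i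
    by (rule arg_cong[where f=card]; use assms(2) t_nonneg[OF that] s_le[OF that] in auto)+
  have in_range: "0 \<le> u \<and> u \<le> s m" if "u \<in> {s i..t (Suc i)}" "i < m" for u i
    using that t_nonneg[of i] ts[of i] ts[of "Suc i"] s_le[of "Suc i"] by auto
  have E: "(\<exists>!u. u \<in> {s i..t (Suc i)} \<and> x' u = 0) \<longleftrightarrow> (\<exists>!u. u \<in> {s i..t (Suc i)} \<and> x u = 0)" if "i < m" for i
    using assms(2) in_range[OF _ that] by metis
  have B: "(\<forall>u\<in>{s i..t (Suc i)}. y' u \<noteq> 0) \<longleftrightarrow> (\<forall>u\<in>{s i..t (Suc i)}. y u \<noteq> 0)" if "i < m" for i
    using assms(2) in_range[OF _ that] by metis
  have C': "card {u\<in>{t i<..<s i}. x' u = 0} = card {u\<in>{t i<..<s i}. x u = 0}"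
    "card {u\<in>{t i..s i}. y' u = 0} = card {u\<in>{t i..s i}. y u = 0}" if "i < m" for i
    using C[of i] that by auto
  have "nodal m t s \<alpha> qL \<kappa> j x' y' \<longleftrightarrow> nodal m t s \<alpha> qL \<kappa> j x y"
    unfolding nodal_def by (simp only: C[OF order_refl] C' E B cong: imp_cong)
  then show ?thesis using assms(1) by simp
qed

lemma seg_sol_point: assumes "q \<in> open_interval rm rp" shows "seg_sol h rm rp g lam w b b (\<lambda>_. p) (\<lambda>_. q)"
  by (rule seg_solI[where K=0 and S="{b}"]) (use assms in auto)

definition itinerary where
  "itinerary \<kappa> j k p x y \<longleftrightarrow> seg_sol h rm rp g lam a 0 (t k) x y \<and> (x 0, y 0) = p \<and>
     (\<forall>i\<le>k. (x (t i), y (t i)) \<in> AQ i (\<kappa> i)) \<and> (\<forall>i<k. stage_nodal t s \<alpha> \<kappa> j i x y)"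

text \<open>Induction over the stages: the initial points whose solutions follow the prescribed itinerary up to
\<open>t k\<close> contain a subarc whose image crosses the annulus \<open>k\<close>.\<close>

lemma reach:
  assumes \<kappa>: "\<And>i. i \<le> m \<Longrightarrow> \<kappa> i \<in> {Q_I, Q_III}" and j: "\<And>i. i \<le> m \<Longrightarrow> 1 \<le> j i \<and> j i \<le> \<beta> i - \<alpha> i"
    and \<gamma>: "crossing 0 (\<kappa> 0) 0 1 \<gamma>" and k: "k \<le> m"
  shows "\<exists>u v P. 0 \<le> u \<and> v \<le> 1 \<and> crossing k (\<kappa> k) u v P \<and> 
    (\<forall>\<sigma>\<in>{u..v}. \<exists>x y. itinerary \<kappa> j k (\<gamma> \<sigma>) x y \<and> (x (t k), y (t k)) = P \<sigma>)"
  using k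
proof (induction k)
  case 0
  have "\<exists>x y. itinerary \<kappa> j 0 (\<gamma> \<sigma>) x y \<and> (x (t 0), y (t 0)) = \<gamma> \<sigma>" if "\<sigma> \<in> {0..1}" for \<sigma>
    unfolding itinerary_def
  proof (intro exI conjI)
    have A: "\<gamma> \<sigma> \<in> AQ 0 (\<kappa> 0)" using \<gamma> that by (auto simp: crossing_def)
    then have "snd (\<gamma> \<sigma>) \<in> open_interval rm rp" by (auto simp: annulus_quadrant_def annulus_def)
    then show "seg_sol h rm rp g lam a 0 (t 0) (\<lambda>_. fst (\<gamma> \<sigma>)) (\<lambda>_. snd (\<gamma> \<sigma>))" unfolding t0 by (rule seg_sol_point)
    show "\<forall>i\<le>0. (fst (\<gamma> \<sigma>), snd (\<gamma> \<sigma>)) \<in> AQ i (\<kappa> i)" using A by simp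
  qed auto
  then show ?case using \<gamma> by (intro exI[of _ 0] exI[of _ 1] exI[of _ \<gamma>]) auto
next
  case (Suc k)
  then have km: "k < m" "k \<le> m" "Suc k \<le> m" by auto
  obtain u v P where uv: "0 \<le> u" "v \<le> 1" "crossing k (\<kappa> k) u v P" and IH: "\<And>\<sigma>. \<sigma> \<in> {u..v} \<Longrightarrow>
    \<exists>x y. itinerary \<kappa> j k (\<gamma> \<sigma>) x y \<and> (x (t k), y (t k)) = P \<sigma>"
    using Suc.IH[OF km(2)] by blast
  obtain u' v' P' where uv': "u \<le> u'" "v' \<le> v" "crossing (Suc k) (\<kappa> (Suc k)) u' v' P'"
    and step: "\<And>\<sigma>. \<sigma> \<in> {u'..v'} \<Longrightarrow> \<exists>x y. seg_sol h rm rp g lam a (t k) (t (Suc k)) x y \<and>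
       (x (t k), y (t k)) = P \<sigma> \<and> (x (t (Suc k)), y (t (Suc k))) = P' \<sigma> \<and> stage_nodal t s \<alpha> \<kappa> j k x y"
    using stage[where \<kappa>=\<kappa> and j=j and i=k, OF km(1) \<kappa>[OF km(2)] \<kappa>[OF km(3)] j[OF km(2), THEN conjunct1] j[OF km(2), THEN conjunct2] uv(3)] by blast
  have tk: "t k < t (Suc k)" "0 \<le> t k" using ts[OF km(2)] st[OF km(1)] t_nonneg[OF km(2)] by auto
  have "\<exists>x y. itinerary \<kappa> j (Suc k) (\<gamma> \<sigma>) x y \<and> (x (t (Suc k)), y (t (Suc k))) = P' \<sigma>" if \<sigma>: "\<sigma> \<in> {u'..v'}" for \<sigma>
  proof -
    from \<sigma> have \<sigma>': "\<sigma> \<in> {u..v}" using uv' by auto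
    obtain x1 y1 where 1: "seg_sol h rm rp g lam a 0 (t k) x1 y1" "(x1 0, y1 0) = \<gamma> \<sigma>" "(x1 (t k), y1 (t k)) = P \<sigma>"
      "\<And>i. i \<le> k \<Longrightarrow> (x1 (t i), y1 (t i)) \<in> AQ i (\<kappa> i)" "\<And>i. i < k \<Longrightarrow> stage_nodal t s \<alpha> \<kappa> j i x1 y1"
      using IH[OF \<sigma>'] unfolding itinerary_def by blast
    obtain x2 y2 where 2: "seg_sol h rm rp g lam a (t k) (t (Suc k)) x2 y2" "(x2 (t k), y2 (t k)) = P \<sigma>"
      "(x2 (t (Suc k)), y2 (t (Suc k))) = P' \<sigma>" "stage_nodal t s \<alpha> \<kappa> j k x2 y2" using step[OF \<sigma>] by blast
    define x y where "x r = (if r \<le> t k then x1 r else x2 r)" and "y r = (if r \<le> t k then y1 r else y2 r)" for r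
    have m: "x1 (t k) = x2 (t k)" "y1 (t k) = y2 (t k)" using 1(3) 2(2) by (metis prod.inject)+
    have e1: "x r = x1 r \<and> y r = y1 r" if "r \<le> t k" for r using that by (simp add: x_def y_def)
    have e2: "x r = x2 r \<and> y r = y2 r" if "t k \<le> r" for r using that m by (auto simp: x_def y_def order_antisym)
    have "seg_sol h rm rp g lam a 0 (t (Suc k)) x y"
      unfolding x_def[abs_def] y_def[abs_def] by (rule seg_sol_glue[OF 1(1) 2(1) m]) (use tk in auto)
    moreover have "(x 0, y 0) = \<gamma> \<sigma>" using e1[of 0] tk 1(2) by simp
    moreover have end2: "(x (t (Suc k)), y (t (Suc k))) = P' \<sigma>" using e2[of "t (Suc k)"] tk 2(3) by simp
    moreover have "(x (t i), y (t i)) \<in> AQ i (\<kappa> i)" if "i \<le> Suc k" for i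
    proof (cases "i = Suc k")
      case True
      have "P' \<sigma> \<in> AQ (Suc k) (\<kappa> (Suc k))" using uv'(3) \<sigma> by (auto simp: crossing_def)
      then show ?thesis using end2 True by simp
    next
      case False
      then have "i \<le> k" using that by simp
      then show ?thesis using 1(4)[of i] e1[of "t i"] t_mono[of i k] km by simp
    qed
    moreover have "stage_nodal t s \<alpha> \<kappa> j i x y" if "i < Suc k" for i
    proof (cases "i = k")
      case True
      show ?thesis unfolding True
        by (rule stage_nodal_cong[OF 2(4)]) (use e2 ts[OF km(2)] st[OF km(1)] in auto)
    next
      case False
      then have ik: "i < k" using that by simp
      have "t (Suc i) \<le> t k" using t_mono[of "Suc i" k] ik km by simp
      then show ?thesis
        by (intro stage_nodal_cong[OF 1(5)[OF ik]]) (use e1 ts[of i] st[of i] ik km in auto)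
    qed
    ultimately show ?thesis unfolding itinerary_def by blast
  qed
  moreover have "0 \<le> u'" "v' \<le> 1" using uv uv' by auto
  ultimately show ?case using uv'(3) by blast
qed

lemma solution_exists:
  assumes \<kappa>: "\<And>i. i \<le> m \<Longrightarrow> \<kappa> i \<in> {Q_I, Q_III}" and j: "\<And>i. i \<le> m \<Longrightarrow> 1 \<le> j i \<and> j i \<le> \<beta> i - \<alpha> i"
    and r0: "crossing_arc h rm rp g lam (mu 0) (c1 0) (c2 0) r0" "r0 \<subseteq> AQ 0 (\<kappa> 0)"
    and q: "qL \<in> {Q_II, Q_IV}" and rL: "crossing_arc h rm rp g lam (mu m) (c1 m) (c2 m) rL" "rL \<subseteq> AQ m qL"
  shows "\<exists>x y. (x, y) \<in> bvp_solutions h rm rp g lam a (s m) r0 rL \<and>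
    (\<forall>i\<le>m. (x (t i), y (t i)) \<in> AQ i (\<kappa> i)) \<and> nodal m t s \<alpha> qL \<kappa> j x y"
proof -
  obtain \<gamma> where \<gamma>: "arc \<gamma>" "path_image \<gamma> = r0" "nonlinear_energy h g lam (mu 0) (pathstart \<gamma>) = c1 0"
     "nonlinear_energy h g lam (mu 0) (pathfinish \<gamma>) = c2 0"
    using r0(1) unfolding crossing_arc_def by blast
  have mu0: "0 \<le> mu 0" using mu[of 0] by simp
  have \<gamma>in: "\<gamma> \<sigma> \<in> AQ 0 (\<kappa> 0)" if "\<sigma> \<in> {0..1}" for \<sigma>
    using r0(2) \<gamma>(2) that unfolding path_image_def by blast
  have en: "En (mu 0) (\<gamma> \<sigma>) = nonlinear_energy h g lam (mu 0) (\<gamma> \<sigma>)" if "\<sigma> \<in> {0..1}" for \<sigma>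
    using energy_box(5)[OF mu0, of "\<gamma> \<sigma>"] \<gamma>in[OF that] AQ_iff[of 0 "\<gamma> \<sigma>"] levels[of 0] by auto
  have "crossing 0 (\<kappa> 0) 0 1 \<gamma>"
    unfolding crossing_def using \<gamma>in en[of 0] en[of 1] \<gamma>(3,4) arc_imp_path[OF \<gamma>(1)]
    by (simp add: path_def pathstart_def pathfinish_def)
  from reach[where \<kappa>=\<kappa> and j=j and \<gamma>=\<gamma> and k=m, OF \<kappa> j this order_refl]
  obtain u v P where uv: "0 \<le> u" "v \<le> 1" "crossing m (\<kappa> m) u v P" and R: "\<And>\<sigma>. \<sigma> \<in> {u..v} \<Longrightarrow>
    \<exists>x y. itinerary \<kappa> j m (\<gamma> \<sigma>) x y \<and> (x (t m), y (t m)) = P \<sigma>"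
    by blast
  have jm: "1 \<le> j m" "j m \<le> \<beta> m - \<alpha> m" using j by auto
  obtain \<sigma> x2 y2 where 2: "\<sigma> \<in> {u..v}" "seg_sol h rm rp g lam a (t m) (s m) x2 y2" "(x2 (t m), y2 (t m)) = P \<sigma>" "(x2 (s m), y2 (s m)) \<in> rL"
    "card {r\<in>{t m<..<s m}. x2 r = 0} = 2 * (\<alpha> m + j m) - (if qL = q_pred (\<kappa> m) then 1 else 0)"
    "card {r\<in>{t m..s m}. y2 r = 0} = 2 * (\<alpha> m + j m) + (if qL = q_pred (\<kappa> m) then 0 else 1)"
    by (rule final_stage[OF \<kappa>[OF order_refl] jm uv(3) q rL])
  obtain x1 y1 where 1: "seg_sol h rm rp g lam a 0 (t m) x1 y1" "(x1 0, y1 0) = \<gamma> \<sigma>" "(x1 (t m), y1 (t m)) = P \<sigma>"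
    "\<And>i. i \<le> m \<Longrightarrow> (x1 (t i), y1 (t i)) \<in> AQ i (\<kappa> i)" "\<And>i. i < m \<Longrightarrow> stage_nodal t s \<alpha> \<kappa> j i x1 y1"
    using R[OF 2(1)] unfolding itinerary_def by blast
  define x y where "x r = (if r \<le> t m then x1 r else x2 r)" and "y r = (if r \<le> t m then y1 r else y2 r)" for r
  have m: "x1 (t m) = x2 (t m)" "y1 (t m) = y2 (t m)" using 1(3) 2(3) by (metis prod.inject)+
  have tm: "0 \<le> t m" "t m < s m" using t_nonneg[of m] ts[of m] by auto
  have e1: "x r = x1 r \<and> y r = y1 r" if "r \<le> t m" for r using that by (simp add: x_def y_def)
  have e2: "x r = x2 r \<and> y r = y2 r" if "t m \<le> r" for r using that m by (auto simp: x_def y_def order_antisym)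
  have seg: "seg_sol h rm rp g lam a 0 (s m) x y"
    unfolding x_def[abs_def] y_def[abs_def] by (rule seg_sol_glue[OF 1(1) 2(2) m]) (use tm in auto)
  have st: "stage_nodal t s \<alpha> \<kappa> j i x y" if im: "i < m" for i
  proof -
    have "t (Suc i) \<le> t m" using t_mono[of "Suc i" m] im by simp
    then show ?thesis
      by (intro stage_nodal_cong[OF 1(5)[OF im]]) (use e1 ts[of i] st[of i] im in auto)
  qed
  have c: "{r\<in>{t m<..<s m}. x r = 0} = {r\<in>{t m<..<s m}. x2 r = 0}" "{r\<in>{t m..s m}. y r = 0} = {r\<in>{t m..s m}. y2 r = 0}"
    using e2 by auto
  have ne: "q_succ (\<kappa> m) \<noteq> q_pred (\<kappa> m)" using \<kappa>[OF order_refl] by auto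
  have nod: "nodal m t s \<alpha> qL \<kappa> j x y"
    unfolding nodal_def c using st 2(5,6) ne by (simp add: stage_nodal_def)
  let ?x = "restrict x {0..s m}" and ?y = "restrict y {0..s m}"
  have sm: "0 \<le> s m" using tm by simp
  have "seg_sol h rm rp g lam a 0 (s m) ?x ?y"
    by (rule seg_sol_cong[OF seg, of "{}"]) auto
  then have "caratheodory_solution h rm rp g lam a 0 (s m) ?x ?y" by (rule seg_sol_caratheodory)
  moreover have "(?x 0, ?y 0) \<in> r0"
    using 1(2) e1[of 0] tm 2(1) uv \<gamma>(2) by (auto simp: path_image_def)
  moreover have "(?x (s m), ?y (s m)) \<in> rL" using 2(4) e2[of "s m"] tm by simp
  ultimately have "(?x, ?y) \<in> bvp_solutions h rm rp g lam a (s m) r0 rL" by (simp add: bvp_solutions_def)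
  moreover have "(?x (t i), ?y (t i)) \<in> AQ i (\<kappa> i)" if "i \<le> m" for i
    using 1(4)[OF that] e1[of "t i"] t_mono[OF that] t_nonneg[OF that] tm by simp
  moreover have "nodal m t s \<alpha> qL \<kappa> j ?x ?y" by (rule nodal_cong[OF nod]) simp
  ultimately show ?thesis by blast
qed

text \<open>For \<open>i \<ge> 1\<close>, \<open>y\<close> has no zero on \<open>[s (i-1), t i]\<close>, so the sign of \<open>y (t i)\<close> decides between
quadrants I and III. Once the quadrants are known, the number of zeroes gives \<open>j i\<close>.\<close>

lemma itinerary_unique:
  assumes \<kappa>: "\<And>i. i \<le> m \<Longrightarrow> \<kappa> i \<in> {Q_I, Q_III}" "\<And>i. i \<le> m \<Longrightarrow> \<kappa>' i \<in> {Q_I, Q_III}" "\<kappa> 0 = \<kappa>' 0"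
    and q: "qL \<in> {Q_II, Q_IV}"
    and n: "nodal m t s \<alpha> qL \<kappa> j x y" "nodal m t s \<alpha> qL \<kappa>' j' x y"
    and A: "\<And>i. i \<le> m \<Longrightarrow> (x (t i), y (t i)) \<in> AQ i (\<kappa> i)" "\<And>i. i \<le> m \<Longrightarrow> (x (t i), y (t i)) \<in> AQ i (\<kappa>' i)"
    and i: "i \<le> m"
  shows "\<kappa> i = \<kappa>' i" "j i = j' i"
proof -
  have k: "\<kappa> i = \<kappa>' i" if i: "i \<le> m" for i
  proof (cases i)
    case (Suc k)
    then have "k < m" using i by simp
    moreover from this have "t (Suc k) \<in> {s k..t (Suc k)}" using st[of k] by auto
    ultimately have "y (t i) \<noteq> 0" using n(1) unfolding nodal_def Suc by blast
    then show ?thesis using A[OF i] \<kappa>(1,2)[OF i] by (auto simp: annulus_quadrant_def)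
  qed (use \<kappa>(3) in simp)
  then show "\<kappa> i = \<kappa>' i" using i by simp
  show "j i = j' i"
  proof (cases "i = m")
    case True
    consider "qL = q_pred (\<kappa> m)" | "qL = q_succ (\<kappa> m)" using q \<kappa>(1)[OF order_refl] by auto
    then show ?thesis
      using n k[OF order_refl] unfolding True nodal_def by cases auto
  next
    case False
    then have im: "i < m" using i by simp
    then have "\<kappa>' (Suc i) = \<kappa> (Suc i)" "\<kappa>' i = \<kappa> i" using k by auto
    moreover have "card {u\<in>{t i..s i}. y u = 0} = 2 * (\<alpha> i + j i) + (if \<kappa> (Suc i) = \<kappa> i then 0 else 1)"
      using n(1) im unfolding nodal_def by (cases "\<kappa> (Suc i) = \<kappa> i") simp_all
    moreover have "card {u\<in>{t i..s i}. y u = 0} = 2 * (\<alpha> i + j' i) + (if \<kappa>' (Suc i) = \<kappa>' i then 0 else 1)"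
      using n(2) im unfolding nodal_def by (cases "\<kappa>' (Suc i) = \<kappa>' i") simp_all
    ultimately show ?thesis by (simp split: if_splits)
  qed
qed

text \<open>One solution is chosen for each itinerary; the choice is injective because a solution determines its
itinerary. Extensional functions represent the itineraries, so that there are finitely many of them.\<close>

lemma many_solutions:
  assumes \<kappa>0: "\<kappa>0 \<in> {Q_I, Q_III}"
    and r0: "crossing_arc h rm rp g lam (mu 0) (c1 0) (c2 0) r0" "r0 \<subseteq> AQ 0 \<kappa>0"
    and q: "qL \<in> {Q_II, Q_IV}" and rL: "crossing_arc h rm rp g lam (mu m) (c1 m) (c2 m) rL" "rL \<subseteq> AQ m qL"
  shows "\<exists>S. S \<subseteq> bvp_solutions h rm rp g lam a (s m) r0 rL \<and> finite S \<and>
           card S = 2 ^ m * (\<Prod>i\<le>m. \<beta> i - \<alpha> i) \<and>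
           (\<forall>\<kappa> j. \<kappa> 0 = \<kappa>0 \<and> (\<forall>i\<in>{1..m}. \<kappa> i \<in> {Q_I, Q_III}) \<and>
                   (\<forall>i\<le>m. 1 \<le> j i \<and> j i \<le> \<beta> i - \<alpha> i) \<longrightarrow>
              (\<exists>(x, y)\<in>S. (\<forall>i\<le>m. (x (t i), y (t i)) \<in> AQ i (\<kappa> i)) \<and> nodal m t s \<alpha> qL \<kappa> j x y))"
proof -
  define I where "I = ({1..m} \<rightarrow>\<^sub>E {Q_I, Q_III}) \<times> (\<Pi>\<^sub>E i\<in>{..m}. {1..\<beta> i - \<alpha> i})"
  define K where "K k i = (if i = 0 then \<kappa>0 else k i)" for k :: "nat \<Rightarrow> quadrant" and i :: nat
  define good where "good p z \<longleftrightarrow> z \<in> bvp_solutions h rm rp g lam a (s m) r0 rL \<and>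
     (\<forall>i\<le>m. (fst z (t i), snd z (t i)) \<in> AQ i (K (fst p) i)) \<and> nodal m t s \<alpha> qL (K (fst p)) (snd p) (fst z) (snd z)"
    for p :: "(nat \<Rightarrow> quadrant) \<times> (nat \<Rightarrow> nat)" and z
  have Kin: "K (fst p) i \<in> {Q_I, Q_III}" if "p \<in> I" "i \<le> m" for p i
  proof (cases "i = 0")
    case False
    have "fst p \<in> {1..m} \<rightarrow>\<^sub>E {Q_I, Q_III}" using that by (simp add: I_def mem_Times_iff)
    from PiE_mem[OF this, of i] have "fst p i \<in> {Q_I, Q_III}" using False that by simp
    then show ?thesis using False by (simp add: K_def)
  qed (use \<kappa>0 in \<open>simp add: K_def\<close>)
  have jin: "1 \<le> snd p i \<and> snd p i \<le> \<beta> i - \<alpha> i" if "p \<in> I" "i \<le> m" for p i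
  proof -
    have "snd p \<in> (\<Pi>\<^sub>E i\<in>{..m}. {1..\<beta> i - \<alpha> i})" using that by (simp add: I_def mem_Times_iff)
    from PiE_mem[OF this, of i] show ?thesis using that by simp
  qed
  have "\<exists>z. good p z" if p: "p \<in> I" for p
  proof -
    have "r0 \<subseteq> AQ 0 (K (fst p) 0)" using r0(2) by (simp add: K_def)
    from solution_exists[where \<kappa>="K (fst p)" and j="snd p", OF Kin[OF p] jin[OF p] r0(1) this q rL]
    obtain x y where "good p (x, y)" unfolding good_def by auto
    then show ?thesis by blast
  qed
  then obtain f where f: "\<And>p. p \<in> I \<Longrightarrow> good p (f p)" by metis
  have inj: "inj_on f I"
  proof (rule inj_onI)
    fix p p' assume p: "p \<in> I" "p' \<in> I" and eq: "f p = f p'"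
    have g: "good p (f p)" "good p' (f p)" using f[OF p(1)] f[OF p(2)] eq by auto
    have u: "K (fst p) i = K (fst p') i" "snd p i = snd p' i" if "i \<le> m" for i
    proof -
      have n: "nodal m t s \<alpha> qL (K (fst p)) (snd p) (fst (f p)) (snd (f p))"
        "nodal m t s \<alpha> qL (K (fst p')) (snd p') (fst (f p)) (snd (f p))"
        using g unfolding good_def by blast+
      have A: "(fst (f p) (t i), snd (f p) (t i)) \<in> AQ i (K (fst p) i)"
        "(fst (f p) (t i), snd (f p) (t i)) \<in> AQ i (K (fst p') i)" if "i \<le> m" for i
        using g that unfolding good_def by blast+
      have "K (fst p) 0 = K (fst p') 0" by (simp add: K_def)
      from itinerary_unique[OF Kin[OF p(1)] Kin[OF p(2)] this q n A that]
      show "K (fst p) i = K (fst p') i" "snd p i = snd p' i" by auto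
    qed
    have "fst p = fst p'"
    proof (rule PiE_ext)
      show "fst p \<in> {1..m} \<rightarrow>\<^sub>E {Q_I, Q_III}" "fst p' \<in> {1..m} \<rightarrow>\<^sub>E {Q_I, Q_III}" using p by (auto simp: I_def)
      show "fst p i = fst p' i" if "i \<in> {1..m}" for i using u(1)[of i] that by (simp add: K_def)
    qed
    moreover have "snd p = snd p'"
    proof (rule PiE_ext)
      show "snd p \<in> (\<Pi>\<^sub>E i\<in>{..m}. {1..\<beta> i - \<alpha> i})" "snd p' \<in> (\<Pi>\<^sub>E i\<in>{..m}. {1..\<beta> i - \<alpha> i})" using p by (auto simp: I_def)
      show "snd p i = snd p' i" if "i \<in> {..m}" for i using u(2)[of i] that by simp
    qed
    ultimately show "p = p'" by (simp add: prod_eq_iff)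
  qed
  have "card I = 2 ^ m * (\<Prod>i\<le>m. \<beta> i - \<alpha> i)"
    by (simp add: I_def card_cartesian_product card_PiE numeral_2_eq_2)
  moreover have "finite I" by (auto simp: I_def intro!: finite_PiE)
  ultimately have "finite (f ` I)" "card (f ` I) = 2 ^ m * (\<Prod>i\<le>m. \<beta> i - \<alpha> i)"
    using card_image[OF inj] by auto
  moreover have "f ` I \<subseteq> bvp_solutions h rm rp g lam a (s m) r0 rL" using f by (auto simp: good_def)
  moreover have "\<exists>(x, y)\<in>f ` I. (\<forall>i\<le>m. (x (t i), y (t i)) \<in> AQ i (\<kappa> i)) \<and> nodal m t s \<alpha> qL \<kappa> j x y"
    if *: "\<kappa> 0 = \<kappa>0" "\<forall>i\<in>{1..m}. \<kappa> i \<in> {Q_I, Q_III}" "\<forall>i\<le>m. 1 \<le> j i \<and> j i \<le> \<beta> i - \<alpha> i" for \<kappa> j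
  proof -
    define p where "p = (restrict \<kappa> {1..m}, restrict j {..m})"
    have p: "p \<in> I" using * by (auto simp: I_def p_def)
    have e: "K (fst p) i = \<kappa> i" "snd p i = j i" if "i \<le> m" for i using that *(1) by (auto simp: K_def p_def)
    have "nodal m t s \<alpha> qL \<kappa> j (fst (f p)) (snd (f p))"
      using f[OF p] nodal_cong_index[of m "K (fst p)" \<kappa> "snd p" j, OF e] unfolding good_def by blast
    moreover have "\<forall>i\<le>m. (fst (f p) (t i), snd (f p) (t i)) \<in> AQ i (\<kappa> i)" using f[OF p] e(1) unfolding good_def by simp
    ultimately show ?thesis using p by (intro bexI[of _ "f p"]) (auto simp: case_prod_beta)
  qed
  ultimately show ?thesis by blast
qed

end

lemma momentum_of_homeomorphism:
  assumes "strict_mono_on J \<phi>" "homeomorphism J (open_interval rm rp) \<phi> h" "h 0 = 0" "rm < 0" "0 < rp"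
  shows "momentum h rm rp"
proof
  show "continuous_on (open_interval rm rp) h" using assms(2) by (simp add: homeomorphism_def)
  have inJ: "h y \<in> J" "\<phi> (h y) = y" if "y \<in> open_interval rm rp" for y
    using assms(2) that by (auto simp: homeomorphism_def)
  show "strict_mono_on (open_interval rm rp) h"
  proof (rule strict_mono_onI)
    fix y z assume yz: "y \<in> open_interval rm rp" "z \<in> open_interval rm rp" "y < z"
    show "h y < h z"
    proof (rule ccontr)
      assume "\<not> h y < h z"
      then consider "h z < h y" | "h z = h y" by linarith
      then show False
        using strict_mono_onD[OF assms(1) inJ(1)[OF yz(2)] inJ(1)[OF yz(1)]] inJ(2)[OF yz(1)] inJ(2)[OF yz(2)] yz(3)
        by cases auto
    qed
  qed
qed (use assms in auto)

theorem theorem6p3: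
  fixes m :: nat and t s mu c1 c2 d e :: "nat \<Rightarrow> real" and L lam :: real
    and a h g :: "real \<Rightarrow> real" and rm rp :: ereal
    and xm xp :: "nat \<Rightarrow> real \<Rightarrow> real"
    and r0 rL :: "(real \<times> real) set"
    and \<alpha> \<beta> :: "nat \<Rightarrow> nat"
    and \<kappa>0 qL :: quadrant
  assumes m: "m \<ge> 1"
    and times: "t 0 = 0" "\<forall>i\<le>m. t i < s i" "\<forall>i<m. s i < t (Suc i)" "s m = L"
    and mu: "\<forall>i\<le>m. mu i > 0"
    and weight: "\<forall>i\<le>m. \<forall>u\<in>{t i..s i}. a u = mu i"
      "\<forall>i<m. \<forall>u\<in>{s i<..<t (Suc i)}. a u = 0"
    and range: "rm < 0" "0 < rp"
    and h: "\<exists>J \<phi>. open J \<and> is_interval J \<and> 0 \<in> J \<and> strict_mono_on J \<phi> \<and>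
              homeomorphism J (open_interval rm rp) \<phi> h"
      "h 0 = 0"
    and g: "continuous_on UNIV g" "g 0 = 0" "\<forall>z. z \<noteq> 0 \<longrightarrow> g z * z > 0"
    and uniqueness: "\<forall>i\<le>m. unique_ivp_solutions h rm rp g lam (\<lambda>_. mu i)"
      "unique_ivp_solutions h rm rp g lam (\<lambda>_. 0)"
    and lam: "lam > 0"
    and levels: "\<forall>i\<le>m. 0 < c1 i \<and> c1 i < c2 i \<and> ereal (c2 i) < H_star h rm rp"
      "\<forall>i\<le>m. \<forall>c\<in>{c1 i..c2 i}. xm i c < 0 \<and> 0 < xp i c \<and>
         F_energy g lam (mu i) (xm i c) = c \<and> F_energy g lam (mu i) (xp i c) = c \<and>
         (\<forall>x\<in>{xm i c<..<xp i c}. F_energy g lam (mu i) x < c) \<and>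
         deriv (F_energy g lam (mu i)) (xm i c) < 0 \<and>
         0 < deriv (F_energy g lam (mu i)) (xp i c)"
    and r0: "crossing_arc h rm rp g lam (mu 0) (c1 0) (c2 0) r0"
      "\<kappa>0 \<in> {Q_I, Q_III}"
      "r0 \<subseteq> annulus_quadrant h rm rp g lam (mu 0) (c1 0) (c2 0) \<kappa>0"
    and rL: "crossing_arc h rm rp g lam (mu m) (c1 m) (c2 m) rL"
      "qL \<in> {Q_II, Q_IV}"
      "rL \<subseteq> annulus_quadrant h rm rp g lam (mu m) (c1 m) (c2 m) qL"
    and twist: "\<forall>i\<le>m. d i \<in> {c1 i, c2 i} \<and> e i \<in> {c1 i, c2 i} \<and> d i \<noteq> e i \<and> \<alpha> i < \<beta> i \<and>
      (\<forall>\<kappa>\<in>{Q_I, Q_III}.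
        quadrant_time h rm rp g lam (mu i) (xm i (d i)) (xp i (d i)) (q_succ \<kappa>) (d i)
        + quadrant_time h rm rp g lam (mu i) (xm i (d i)) (xp i (d i)) (q_succ (q_succ \<kappa>)) (d i)
        + real (\<alpha> i) * period h rm rp g lam (mu i) (xm i (d i)) (xp i (d i)) (d i)
          > s i - t i \<and>
        quadrant_time h rm rp g lam (mu i) (xm i (e i)) (xp i (e i)) \<kappa> (e i)
        + quadrant_time h rm rp g lam (mu i) (xm i (e i)) (xp i (e i)) (q_succ \<kappa>) (e i)
        + real (\<beta> i) * period h rm rp g lam (mu i) (xm i (e i)) (xp i (e i)) (e i)
          < s i - t i)"
    and transition: "\<forall>i<m. \<forall>\<kappa>\<in>{Q_I, Q_III}. \<exists>dh eh. dh > 0 \<and> eh > 0 \<and> dh \<noteq> eh \<and>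
        admissible g lam mu c1 c2 i dh \<and> admissible g lam mu c1 c2 i eh \<and>
        transition_time h rm rp g lam mu c2 i (q_pred \<kappa>) \<kappa> eh \<le> t (Suc i) - s i \<and>
        t (Suc i) - s i \<le> transition_time h rm rp g lam mu c1 i (q_pred \<kappa>) \<kappa> dh"
  shows "\<exists>S. S \<subseteq> bvp_solutions h rm rp g lam a L r0 rL \<and> finite S \<and>
           card S = 2 ^ m * (\<Prod>i\<le>m. \<beta> i - \<alpha> i) \<and>
           (\<forall>\<kappa> j. \<kappa> 0 = \<kappa>0 \<and> (\<forall>i\<in>{1..m}. \<kappa> i \<in> {Q_I, Q_III}) \<and>
                   (\<forall>i\<le>m. 1 \<le> j i \<and> j i \<le> \<beta> i - \<alpha> i) \<longrightarrow>
              (\<exists>(x, y)\<in>S.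
                 (\<forall>i\<le>m. (x (t i), y (t i)) \<in>
                    annulus_quadrant h rm rp g lam (mu i) (c1 i) (c2 i) (\<kappa> i)) \<and>
                 nodal m t s \<alpha> qL \<kappa> j x y))"
proof -
  obtain J \<phi> where J: "strict_mono_on J \<phi>" "homeomorphism J (open_interval rm rp) \<phi> h" using h(1) by blast
  interpret momentum h rm rp by (rule momentum_of_homeomorphism[OF J h(2) range])
  define C where "C = Max (c2 ` {..m})"
  have C2: "c2 i \<le> C" if "i \<le> m" for i unfolding C_def using that by (intro Max_ge) auto
  have "C \<in> c2 ` {..m}" unfolding C_def by (rule Max_in) auto
  then have C: "0 < C" "ereal C < H_star h rm rp" using levels(1) by force+
  obtain ym yp where box: "rm < ereal ym" "ym < 0" "0 < yp" "ereal yp < rp" "C < primitive h ym" "C < primitive h yp"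
    by (rule below_H_star[OF C])
  define R where "R = sqrt (2 * (C + 1) / lam)"
  have R: "0 < R" "C < lam / 2 * R\<^sup>2" using C(1) lam by (auto simp: R_def)
  interpret switched h rm rp g lam C ym yp R m t s mu c1 c2 d e a xm xp \<alpha> \<beta>
  proof
    fix i assume i: "i \<le> m"
    show "0 < c1 i \<and> c1 i < c2 i \<and> c2 i \<le> C" using levels(1) C2[OF i] i by blast
    fix c assume "c \<in> {c1 i..c2 i}"
    then show "xm i c < 0 \<and> 0 < xp i c \<and>
         F_energy g lam (mu i) (xm i c) = c \<and> F_energy g lam (mu i) (xp i c) = c" using levels(2) i by blast
  next
    fix i \<kappa> assume "i < m" "\<kappa> \<in> {Q_I, Q_III}"
    then show "\<exists>dh eh. dh \<noteq> eh \<and> admissible g lam mu c1 c2 i dh \<and> admissible g lam mu c1 c2 i eh \<and>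
        transition_time h rm rp g lam mu c2 i (q_pred \<kappa>) \<kappa> eh \<le> t (Suc i) - s i \<and>
        t (Suc i) - s i \<le> transition_time h rm rp g lam mu c1 i (q_pred \<kappa>) \<kappa> dh"
      using transition by metis
  next
    fix z :: real assume "z \<noteq> 0" then show "0 < g z * z" using g(3) by simp
  next
    fix i assume i: "i \<le> m"
    show "t i < s i" "0 < mu i" "unique_ivp_solutions h rm rp g lam (\<lambda>_. mu i)" using times(2) mu uniqueness(1) i by auto
    show "a u = mu i" if "u \<in> {t i..s i}" for u using weight(1) i that by blast
    show "d i \<in> {c1 i, c2 i} \<and> e i \<in> {c1 i, c2 i} \<and> d i \<noteq> e i" using twist i by blast
    fix \<kappa> assume k: "\<kappa> \<in> {Q_I, Q_III}"
    show "quadrant_time h rm rp g lam (mu i) (xm i (d i)) (xp i (d i)) (q_succ \<kappa>) (d i)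
        + quadrant_time h rm rp g lam (mu i) (xm i (d i)) (xp i (d i)) (q_succ (q_succ \<kappa>)) (d i)
        + real (\<alpha> i) * period h rm rp g lam (mu i) (xm i (d i)) (xp i (d i)) (d i)
          > s i - t i" using twist i k by blast
    show "quadrant_time h rm rp g lam (mu i) (xm i (e i)) (xp i (e i)) \<kappa> (e i)
        + quadrant_time h rm rp g lam (mu i) (xm i (e i)) (xp i (e i)) (q_succ \<kappa>) (e i)
        + real (\<beta> i) * period h rm rp g lam (mu i) (xm i (e i)) (xp i (e i)) (e i)
          < s i - t i" using twist i k by blast
  next
    fix i assume i: "i < m"
    show "s i < t (Suc i)" using times(3) i by simp
    show "a u = 0" if "u \<in> {s i<..<t (Suc i)}" for u using weight(2) i that by blast
  qed (fact g(1) g(2) lam C(1) box R times(1) uniqueness(2))+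
  show ?thesis
    using many_solutions[OF r0(2) r0(1,3) rL(2) rL(1,3)] unfolding times(4) .
qed

end
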